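(* Let $d\ge1$, let $\alpha>0$ and let $\rho_\alpha,\rho_{1/\alpha}:\mathbb{R}^d\to(0,+\infty)$ be two continuous positive functions such that $\rho_\alpha(x)=O(|x|^{-\alpha})$ and $\rho_{1/\alpha}(x)=O(|x|^{-1/\alpha})$ as $|x|\to\infty$. For any $T>S>0$, there exists $\gamma=\gamma(T-S)\in(0,1)$ such that if $\mathcal{O}_1\subset\mathbb{R}^d$ is a measurable $(\gamma,\rho_\alpha)$-thick set and $\mathcal{O}_2\subset\mathbb{R}^d$ is a measurable $(\gamma,\rho_{1/\alpha})$-thick set, then the free Schrödinger equation is observable in $(\{T\}\times\mathcal{O}_1)\cup(\{S\}\times\mathcal{O}_2)$, that is, there exists $C>0$ such that $$\|u_0\|_{L^2(\mathbb{R}^d)}^2\le C\left(\int_{\mathcal{O}_1}|e^{iT\Delta}u_0|^2\,dx+\int_{\mathcal{O}_2}|e^{iS\Delta}u_0|^2\,dx\right)\qquad\forall u_0\in L^2(\mathbb{R}^d).$$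
   Context: The free Schrödinger equation is $i\partial_t u+\Delta u=0$ in $(0,+\infty)\times\mathbb{R}^d$, $u(0,\cdot)=u_0\in L^2(\mathbb{R}^d)$; $(e^{it\Delta})_{t\in\mathbb{R}}$ is the unitary group on $L^2(\mathbb{R}^d)$ generated by $i\Delta$. For $\gamma\in(0,1]$ and a continuous positive function $\rho:\mathbb{R}^d\to(0,\infty)$, a set $\mathcal{O}\subset\mathbb{R}^d$ is $(\gamma,\rho)$-thick if $|\mathcal{O}\cap B(x,\rho(x))|\ge\gamma|B(x,\rho(x))|$ for all $x\in\mathbb{R}^d$, where $|\cdot|$ is Lebesgue measure and $B(x,r)$ is the Euclidean ball of center $x$ and radius $r$. *)

theory Defs
  imports "HOL-Analysis.Analysis" "HOL-Library.Landau_Symbols"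
begin

text \<open>
  $L^2(\mathbb{R}^d;\mathbb{C})$ is rendered by functions with respect to Lebesgue measure; elements
  are not quotiented, so every identity between elements of \<open>L2\<close> below is an almost-everywhere one.
  The dimension $d \ge 1$ is \<open>DIM('a)\<close>.
\<close>

definition L2 :: "('a::euclidean_space \<Rightarrow> complex) set" where
  "L2 = {f \<in> borel_measurable lebesgue. integrable lebesgue (\<lambda>x. (cmod (f x))\<^sup>2)}"

definition L2norm :: "('a::euclidean_space \<Rightarrow> complex) \<Rightarrow> real" where
  "L2norm f = sqrt (LINT x|lebesgue. (cmod (f x))\<^sup>2)"

fun iter_deriv :: "'a list \<Rightarrow> ('a::euclidean_space \<Rightarrow> complex) \<Rightarrow> 'a \<Rightarrow> complex" where
  "iter_deriv [] f = f"
| "iter_deriv (v # vs) f = (\<lambda>x. frechet_derivative (iter_deriv vs f) (at x) v)"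

definition test_functions :: "('a::euclidean_space \<Rightarrow> complex) set" where
  "test_functions = {\<phi>. (\<forall>vs. iter_deriv vs \<phi> differentiable_on UNIV) \<and>
                        compact (closure {x. \<phi> x \<noteq> 0})}"

definition laplacian :: "('a::euclidean_space \<Rightarrow> complex) \<Rightarrow> 'a \<Rightarrow> complex" where
  "laplacian \<phi> x = (\<Sum>b\<in>Basis. iter_deriv [b, b] \<phi> x)"

text \<open>
  The graph of the Laplacian as an unbounded operator on $L^2$, with its maximal domain
  $\{f \in L^2 : \Delta f \in L^2\} = H^2$, where $\Delta f$ is taken in the sense of distributions.
\<close>

definition L2_laplacian ::
    "(('a::euclidean_space \<Rightarrow> complex) \<times> ('a \<Rightarrow> complex)) set" where
  "L2_laplacian = {(f, g). f \<in> L2 \<and> g \<in> L2 \<and>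
     (\<forall>\<phi>\<in>test_functions.
        (LINT x|lebesgue. g x * \<phi> x) = (LINT x|lebesgue. f x * laplacian \<phi> x))}"

text \<open>
  Strongly continuous one-parameter groups of unitary operators on $L^2$. Each operator is a linear
  isometry; it is onto (hence unitary) by the group law. Compatibility with almost-everywhere
  equality follows from linearity and isometry.
\<close>

definition unitary_group ::
    "(real \<Rightarrow> ('a::euclidean_space \<Rightarrow> complex) \<Rightarrow> 'a \<Rightarrow> complex) \<Rightarrow> bool" where
  "unitary_group U \<longleftrightarrow>
     (\<forall>t. \<forall>f\<in>L2. U t f \<in> L2) \<and>
     (\<forall>t a b. \<forall>f\<in>L2. \<forall>g\<in>L2.
        AE x in lebesgue. U t (\<lambda>y. a * f y + b * g y) x = a * U t f x + b * U t g x) \<and>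
     (\<forall>t. \<forall>f\<in>L2. L2norm (U t f) = L2norm f) \<and>
     (\<forall>f\<in>L2. AE x in lebesgue. U 0 f x = f x) \<and>
     (\<forall>s t. \<forall>f\<in>L2. AE x in lebesgue. U (s + t) f x = U s (U t f) x) \<and>
     (\<forall>f\<in>L2. ((\<lambda>t. L2norm (\<lambda>x. U t f x - f x)) \<longlongrightarrow> 0) (at 0))"

text \<open>The graph of the infinitesimal generator: the $L^2$-derivative of $t \mapsto U_t f$ at $0$.\<close>

definition generator ::
    "(real \<Rightarrow> ('a::euclidean_space \<Rightarrow> complex) \<Rightarrow> 'a \<Rightarrow> complex)
      \<Rightarrow> (('a \<Rightarrow> complex) \<times> ('a \<Rightarrow> complex)) set" where
  "generator U = {(f, g). f \<in> L2 \<and> g \<in> L2 \<and>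
     ((\<lambda>h. L2norm (\<lambda>x. (U h f x - f x) / of_real h - g x)) \<longlongrightarrow> 0) (at 0)}"

text \<open>
  \<open>U\<close> is $(e^{it\Delta})_{t\in\mathbb{R}}$, the unitary group generated by $i\Delta$. Such a group
  exists and, for each \<open>t\<close> and each \<open>f\<close> in \<open>L2\<close>, determines \<open>U t f\<close> up to null sets.
\<close>

definition schroedinger_group ::
    "(real \<Rightarrow> ('a::euclidean_space \<Rightarrow> complex) \<Rightarrow> 'a \<Rightarrow> complex) \<Rightarrow> bool" where
  "schroedinger_group U \<longleftrightarrow>
     unitary_group U \<and> generator U = {(f, \<lambda>x. \<i> * g x) |f g. (f, g) \<in> L2_laplacian}"

definition thick :: "real \<Rightarrow> ('a::euclidean_space \<Rightarrow> real) \<Rightarrow> 'a set \<Rightarrow> bool" where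
  "thick \<gamma> \<rho> A \<longleftrightarrow>
     (\<forall>x. measure lebesgue (A \<inter> ball x (\<rho> x)) \<ge> \<gamma> * measure lebesgue (ball x (\<rho> x)))"

end

theory Submission
  imports Defs "HOL-Probability.Probability"
begin

text \<open>
  Write \<open>V = U (T - S)\<close>, \<open>f = U S u\<^sub>0\<close> and \<open>g = V f\<close>. Let \<open>G\<^sub>n\<close> and \<open>M\<^sub>n\<close> be the multiplications by
  \<open>exp (- \<bar>x\<bar>\<^sup>2 / a\<^sup>2\<^sup>n)\<close> and \<open>exp (- \<bar>x\<bar>\<^sup>2 / b\<^sup>2\<^sup>n)\<close> with \<open>a = 2\<^sup>\<alpha>\<close>, \<open>b = 2\<close>, and put \<open>H\<^sub>n = V\<^sup>* M\<^sub>n V\<close>, which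
  plays the part of a frequency cutoff. Summation by parts gives
  \<open>G\<^sub>N H\<^sub>N = \<Sum> (G\<^sub>n - G\<^sub>n\<^sub>-\<^sub>1) H\<^sub>n + \<Sum> G\<^sub>n (H\<^sub>n\<^sub>+\<^sub>1 - H\<^sub>n)\<close>, and the left side tends to the identity.

  The operator \<open>H\<^sub>n\<close> is dominated by a Gaussian average at scale \<open>b\<^sup>-\<^sup>n\<close>. On the shell \<open>\<bar>x\<bar> \<sim> a\<^sup>n\<close>
  this is the scale \<open>\<bar>x\<bar>\<^bsup>-1/\<alpha>\<^esup>\<close> at which the complement of \<open>O2\<close> is thin, so that Schur's test
  makes the first sum small there. After conjugation with \<open>V\<close> the second sum has the same form for \<open>g\<close>,
  with the roles of \<open>a\<close> and \<open>b\<close> exchanged and the complement of \<open>O1\<close> in place of that of \<open>O2\<close>. Both sums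
  paired with \<open>f\<close> are therefore at most \<open>\<parallel>f\<parallel>\<^sup>2 / 4\<close> up to the observed terms.

  The kernel bound for \<open>V M V\<^sup>*\<close> comes from writing a Gaussian as a superposition of plane waves, which
  \<open>V\<close> turns into modulated translations. That in turn is verified on explicit Gaussian packets, which the
  group evolves by the classical formula because its orbits are determined by the generator.
\<close>

section \<open>The space \<open>L\<^sup>2\<close> and unitary groups\<close>

text \<open>Position and frequency cutoffs are tied together because no single frequency cutoff
  serves the whole space: the averages in \<open>H_n\<close> have length of order b^-n, and much
  closer to the origin than a^n the complement of \<open>O2\<close> need not be thin at so small a
  scale. There the n-th shell has little weight instead, since differences of Gaussian cutoffs
  vanish quadratically at the origin. Schur's test cannot be used symmetrically: row sums see no
  thin set and are merely bounded, and only column sums over the unobserved set are small. Weights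
  in Young's inequality repair this and fix the order of choices: first the row bound, which depends
  on \<alpha>, the dimension and T - S, then the weight, the column smallness and \<gamma>.
  Displacements under the flow are proportional to T - S, which is how \<gamma> depends on it.
  Gaussian cutoffs have explicit positive transforms, and Gaussians separate functions, so operator
  identities can be tested on them without Fourier analysis on L2.\<close>

definition ip :: "('a::euclidean_space \<Rightarrow> complex) \<Rightarrow> ('a \<Rightarrow> complex) \<Rightarrow> complex" where
  "ip f g = (LINT x|lebesgue. f x * cnj (g x))"

lemma L2_measurable: "f \<in> L2 \<Longrightarrow> f \<in> borel_measurable lebesgue"
  by (simp add: L2_def)

lemma L2_integrable: "f \<in> L2 \<Longrightarrow> integrable lebesgue (\<lambda>x. (cmod (f x))\<^sup>2)"
  by (simp add: L2_def)

lemma L2norm_nonneg [simp]: "0 \<le> L2norm f"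
  by (simp add: L2norm_def)

lemma L2norm_power2: "(L2norm f)\<^sup>2 = (LINT x|lebesgue. (cmod (f x))\<^sup>2)"
  by (simp add: L2norm_def)

lemma L2_cong_AE:
  assumes "f \<in> L2" "g \<in> borel_measurable lebesgue" "AE x in lebesgue. f x = g x"
  shows "g \<in> L2"
proof -
  have "integrable lebesgue (\<lambda>x. (cmod (g x))\<^sup>2)"
    by (rule integrable_cong_AE_imp[OF L2_integrable[OF assms(1)]])
       (use assms in auto)
  then show ?thesis using assms by (simp add: L2_def)
qed

lemma L2norm_cong_AE:
  assumes "f \<in> borel_measurable lebesgue" "g \<in> borel_measurable lebesgue" "AE x in lebesgue. f x = g x"
  shows "L2norm f = L2norm g"
proof -
  have "(LINT x|lebesgue. (cmod (f x))\<^sup>2) = (LINT x|lebesgue. (cmod (g x))\<^sup>2)"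
    by (rule integral_cong_AE) (use assms in auto)
  then show ?thesis by (simp add: L2norm_def)
qed

lemma borel_measurable_cnj [measurable (raw)]:
  "h \<in> borel_measurable M \<Longrightarrow> (\<lambda>x. cnj (h x)) \<in> borel_measurable M"
  by (rule borel_measurable_continuous_on[of cnj]) (auto intro: continuous_intros)

lemma ip_cong_AE:
  assumes "f \<in> borel_measurable lebesgue" "f' \<in> borel_measurable lebesgue"
    "g \<in> borel_measurable lebesgue" "g' \<in> borel_measurable lebesgue"
    "AE x in lebesgue. f x = f' x" "AE x in lebesgue. g x = g' x"
  shows "ip f g = ip f' g'"
  unfolding ip_def
proof (rule integral_cong_AE)
  show "AE x in lebesgue. f x * cnj (g x) = f' x * cnj (g' x)"
    using assms(5,6) by eventually_elim simp
  show "(\<lambda>x. f x * cnj (g x)) \<in> borel_measurable lebesgue" "(\<lambda>x. f' x * cnj (g' x)) \<in> borel_measurable lebesgue"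
    using assms by simp_all
qed

lemma L2_integrable_cmod_mult:
  assumes "f \<in> L2" "g \<in> L2"
  shows "integrable lebesgue (\<lambda>x. cmod (f x) * cmod (g x))"
proof (rule Bochner_Integration.integrable_bound)
  show "integrable lebesgue (\<lambda>x. (cmod (f x))\<^sup>2 + (cmod (g x))\<^sup>2)"
    using assms by (intro Bochner_Integration.integrable_add L2_integrable)
  show "(\<lambda>x. cmod (f x) * cmod (g x)) \<in> borel_measurable lebesgue"
    using assms[THEN L2_measurable] by auto
  show "AE x in lebesgue. norm (cmod (f x) * cmod (g x)) \<le> norm ((cmod (f x))\<^sup>2 + (cmod (g x))\<^sup>2)"
  proof (intro AE_I2)
    fix x
    have "2 * (cmod (f x) * cmod (g x)) \<le> (cmod (f x))\<^sup>2 + (cmod (g x))\<^sup>2"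
      using sum_squares_bound[of "cmod (f x)" "cmod (g x)"] by simp
    moreover have "0 \<le> cmod (f x) * cmod (g x)" by simp
    ultimately have "cmod (f x) * cmod (g x) \<le> (cmod (f x))\<^sup>2 + (cmod (g x))\<^sup>2" by linarith
    then show "norm (cmod (f x) * cmod (g x)) \<le> norm ((cmod (f x))\<^sup>2 + (cmod (g x))\<^sup>2)"
      by simp
  qed
qed

lemma L2_integrable_mult_cnj:
  assumes "f \<in> L2" "g \<in> L2"
  shows "integrable lebesgue (\<lambda>x. f x * cnj (g x))"
  by (rule Bochner_Integration.integrable_bound[OF L2_integrable_cmod_mult[OF assms]])
     (use assms[THEN L2_measurable] in \<open>auto simp: norm_mult\<close>)

lemma L2_bdd_mult:
  assumes "f \<in> L2" "m \<in> borel_measurable lebesgue" "\<And>x. cmod (m x) \<le> B"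
  shows "(\<lambda>x. m x * f x) \<in> L2"
proof -
  have "integrable lebesgue (\<lambda>x. (cmod (m x * f x))\<^sup>2)"
  proof (rule Bochner_Integration.integrable_bound)
    show "integrable lebesgue (\<lambda>x. B\<^sup>2 * (cmod (f x))\<^sup>2)"
      using L2_integrable[OF assms(1)] by simp
    show "(\<lambda>x. (cmod (m x * f x))\<^sup>2) \<in> borel_measurable lebesgue"
      using assms(2) L2_measurable[OF assms(1)] by simp
    show "AE x in lebesgue. norm ((cmod (m x * f x))\<^sup>2) \<le> norm (B\<^sup>2 * (cmod (f x))\<^sup>2)"
      using assms(3) by (auto simp: norm_mult power_mult_distrib intro!: mult_right_mono power_mono)
  qed
  then show ?thesis using assms(2) L2_measurable[OF assms(1)] by (simp add: L2_def)
qed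

lemma L2_cmult: "f \<in> L2 \<Longrightarrow> (\<lambda>x. c * f x) \<in> L2"
  by (rule L2_bdd_mult[where B="cmod c"]) auto

lemma L2_add:
  assumes "f \<in> L2" "g \<in> L2" shows "(\<lambda>x. f x + g x) \<in> L2"
proof -
  have "integrable lebesgue (\<lambda>x. (cmod (f x + g x))\<^sup>2)"
  proof (rule Bochner_Integration.integrable_bound)
    show "integrable lebesgue (\<lambda>x. 2 * (cmod (f x))\<^sup>2 + 2 * (cmod (g x))\<^sup>2)"
      using assms[THEN L2_integrable] by simp
    show "(\<lambda>x. (cmod (f x + g x))\<^sup>2) \<in> borel_measurable lebesgue"
      using assms[THEN L2_measurable] by simp
    show "AE x in lebesgue. norm ((cmod (f x + g x))\<^sup>2) \<le> norm (2 * (cmod (f x))\<^sup>2 + 2 * (cmod (g x))\<^sup>2)"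
    proof (intro AE_I2)
      fix x
      have "(cmod (f x + g x))\<^sup>2 \<le> (cmod (f x) + cmod (g x))\<^sup>2"
        by (intro power_mono norm_triangle_ineq) auto
      also have "\<dots> \<le> 2 * (cmod (f x))\<^sup>2 + 2 * (cmod (g x))\<^sup>2"
        using sum_squares_bound[of "cmod (f x)" "cmod (g x)"] by (simp add: power2_sum)
      finally show "norm ((cmod (f x + g x))\<^sup>2) \<le> norm (2 * (cmod (f x))\<^sup>2 + 2 * (cmod (g x))\<^sup>2)"
        by simp
    qed
  qed
  then show ?thesis using assms[THEN L2_measurable] by (simp add: L2_def)
qed

lemma L2_lincomb: "f \<in> L2 \<Longrightarrow> g \<in> L2 \<Longrightarrow> (\<lambda>x. a * f x + b * g x) \<in> L2"
  by (intro L2_add L2_cmult)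

lemma L2_diff: "f \<in> L2 \<Longrightarrow> g \<in> L2 \<Longrightarrow> (\<lambda>x. f x - g x) \<in> L2"
  using L2_lincomb[of f g 1 "-1"] by simp

lemma ip_cnj: "cnj (ip g f) = ip f g"
  unfolding ip_def by (subst Bochner_Integration.integral_cnj[symmetric]) (simp add: mult.commute del: Bochner_Integration.integral_cnj)

lemma ip_self: "f \<in> L2 \<Longrightarrow> ip f f = of_real ((L2norm f)\<^sup>2)"
  unfolding ip_def L2norm_power2 integral_complex_of_real[symmetric] complex_norm_square ..

lemma ip_add_left:
  "f \<in> L2 \<Longrightarrow> g \<in> L2 \<Longrightarrow> h \<in> L2 \<Longrightarrow> ip (\<lambda>x. f x + g x) h = ip f h + ip g h"
  unfolding ip_def by (simp add: distrib_right L2_integrable_mult_cnj)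

lemma ip_cmult_left: "ip (\<lambda>x. c * f x) h = c * ip f h"
  unfolding ip_def by (simp add: mult.assoc)

lemma ip_diff_left:
  "f \<in> L2 \<Longrightarrow> g \<in> L2 \<Longrightarrow> h \<in> L2 \<Longrightarrow> ip (\<lambda>x. f x - g x) h = ip f h - ip g h"
  unfolding ip_def by (simp add: left_diff_distrib L2_integrable_mult_cnj)

lemma ip_diff_right:
  "f \<in> L2 \<Longrightarrow> g \<in> L2 \<Longrightarrow> h \<in> L2 \<Longrightarrow> ip h (\<lambda>x. f x - g x) = ip h f - ip h g"
  using ip_diff_left[of f g h] by (metis complex_cnj_diff ip_cnj)

lemma ip_add_right:
  "f \<in> L2 \<Longrightarrow> g \<in> L2 \<Longrightarrow> h \<in> L2 \<Longrightarrow> ip h (\<lambda>x. f x + g x) = ip h f + ip h g"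
  using ip_add_left[of f g h] by (metis complex_cnj_add ip_cnj)

lemma ip_cmult_right: "ip h (\<lambda>x. c * f x) = cnj c * ip h f"
  by (metis complex_cnj_mult ip_cmult_left ip_cnj)

lemma L2norm_add_power2:
  assumes "f \<in> L2" "g \<in> L2"
  shows "(L2norm (\<lambda>x. f x + g x))\<^sup>2 = (L2norm f)\<^sup>2 + (L2norm g)\<^sup>2 + 2 * Re (ip f g)"
proof -
  have "complex_of_real ((L2norm (\<lambda>x. f x + g x))\<^sup>2) = ip (\<lambda>x. f x + g x) (\<lambda>x. f x + g x)"
    by (rule ip_self[symmetric, OF L2_add[OF assms]])
  also have "\<dots> = ip f f + ip g f + (ip f g + ip g g)"
    using assms by (simp add: L2_add ip_add_left ip_add_right)
  also have "ip g f = cnj (ip f g)" by (simp add: ip_cnj)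
  finally have "complex_of_real ((L2norm (\<lambda>x. f x + g x))\<^sup>2) =
     of_real ((L2norm f)\<^sup>2) + cnj (ip f g) + (ip f g + of_real ((L2norm g)\<^sup>2))"
    using assms by (simp add: ip_self)
  from arg_cong[OF this, of Re] show ?thesis by simp
qed

lemma L2norm_eq_0_AE:
  assumes "f \<in> L2" "L2norm f = 0" shows "AE x in lebesgue. f x = 0"
proof -
  have "(LINT x|lebesgue. (cmod (f x))\<^sup>2) = 0"
    using assms(2) by (simp flip: L2norm_power2)
  then have "AE x in lebesgue. (cmod (f x))\<^sup>2 = 0"
    using integral_nonneg_eq_0_iff_AE[OF L2_integrable[OF assms(1)]] by simp
  then show ?thesis by simp
qed

lemma integral_cmod_mult_le:
  assumes "f \<in> L2" "g \<in> L2"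
  shows "(LINT x|lebesgue. cmod (f x) * cmod (g x)) \<le> L2norm f * L2norm g"
proof (cases "L2norm f = 0 \<or> L2norm g = 0")
  case True
  then have "AE x in lebesgue. cmod (f x) * cmod (g x) = 0"
    using L2norm_eq_0_AE[OF assms(1)] L2norm_eq_0_AE[OF assms(2)] by auto
  then have "(LINT x|lebesgue. cmod (f x) * cmod (g x)) = 0"
    by (rule integral_eq_zero_AE)
  then show ?thesis by simp
next
  case False
  then have pos: "L2norm f > 0" "L2norm g > 0"
    by (simp_all add: less_le)
  let ?a = "L2norm f" and ?b = "L2norm g"
  \<comment> \<open>With the weights b/(2a) and a/(2b) the pointwise inequality of means integrates
    to exactly the product of the two norms.\<close>
  have "(LINT x|lebesgue. cmod (f x) * cmod (g x)) \<le>
      (LINT x|lebesgue. (?b/(2*?a)) * (cmod (f x))\<^sup>2 + (?a/(2*?b)) * (cmod (g x))\<^sup>2)"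
  proof (rule integral_mono)
    fix x
    have "0 \<le> (?b * cmod (f x) - ?a * cmod (g x))\<^sup>2 / (2 * ?a * ?b)"
      using pos by simp
    also have "\<dots> = (?b/(2*?a)) * (cmod (f x))\<^sup>2 + (?a/(2*?b)) * (cmod (g x))\<^sup>2 - cmod (f x) * cmod (g x)"
      using pos by (simp add: field_simps power2_eq_square)
    finally show "cmod (f x) * cmod (g x) \<le> (?b/(2*?a)) * (cmod (f x))\<^sup>2 + (?a/(2*?b)) * (cmod (g x))\<^sup>2"
      by simp
  next
    show "integrable lebesgue (\<lambda>x. (?b/(2*?a)) * (cmod (f x))\<^sup>2 + (?a/(2*?b)) * (cmod (g x))\<^sup>2)"
      using assms[THEN L2_integrable]
      by (intro Bochner_Integration.integrable_add integrable_mult_right)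
  qed (rule L2_integrable_cmod_mult[OF assms])
  also have "\<dots> = (?b/(2*?a)) * ?a\<^sup>2 + (?a/(2*?b)) * ?b\<^sup>2"
    using assms by (simp add: L2_integrable L2norm_power2)
  also have "\<dots> = ?a * ?b"
    using pos by (simp add: field_simps power2_eq_square)
  finally show ?thesis .
qed

lemma cmod_ip_le_integral:
  assumes "f \<in> L2" "g \<in> L2"
  shows "cmod (ip f g) \<le> (LINT x|lebesgue. cmod (f x) * cmod (g x))"
  using integral_norm_bound[of lebesgue "\<lambda>x. f x * cnj (g x)"] by (simp add: ip_def norm_mult)

lemma cmod_ip_le:
  assumes "f \<in> L2" "g \<in> L2"
  shows "cmod (ip f g) \<le> L2norm f * L2norm g"
  using cmod_ip_le_integral[OF assms] integral_cmod_mult_le[OF assms] by linarith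

lemma L2norm_triangle:
  assumes "f \<in> L2" "g \<in> L2"
  shows "L2norm (\<lambda>x. f x + g x) \<le> L2norm f + L2norm g"
proof (rule power2_le_imp_le)
  have "Re (ip f g) \<le> L2norm f * L2norm g"
    using cmod_ip_le[OF assms] complex_Re_le_cmod[of "ip f g"] by linarith
  then show "(L2norm (\<lambda>x. f x + g x))\<^sup>2 \<le> (L2norm f + L2norm g)\<^sup>2"
    using assms by (simp add: L2norm_add_power2 power2_sum)
qed simp

lemma L2norm_cmult: "L2norm (\<lambda>x. c * f x) = cmod c * L2norm f"
  by (simp add: L2norm_def norm_mult power_mult_distrib real_sqrt_mult)

lemma L2norm_triangle_diff:
  assumes "f \<in> L2" "g \<in> L2"
  shows "L2norm f \<le> L2norm g + L2norm (\<lambda>x. f x - g x)"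
  using L2norm_triangle[OF assms(2) L2_diff[OF assms]] by simp

lemma L2norm_diff_le:
  assumes "f \<in> L2" "g \<in> L2"
  shows "L2norm (\<lambda>x. f x - g x) \<le> L2norm f + L2norm g"
  using L2norm_triangle[OF assms(1) L2_cmult[OF assms(2), of "-1"]] L2norm_cmult[of "-1" g] by simp

lemma L2norm_diff_commute: "L2norm (\<lambda>x. f x - g x) = L2norm (\<lambda>x. g x - f x)"
  by (simp add: L2norm_def norm_minus_commute)

section \<open>Consequences of the unitary group axioms, up to null sets\<close>

context
  fixes U :: "real \<Rightarrow> ('a::euclidean_space \<Rightarrow> complex) \<Rightarrow> 'a \<Rightarrow> complex"
  assumes U: "unitary_group U"
begin

lemma unitary_group_L2: "f \<in> L2 \<Longrightarrow> U t f \<in> L2"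
  using U by (simp add: unitary_group_def)

lemma unitary_group_norm: "f \<in> L2 \<Longrightarrow> L2norm (U t f) = L2norm f"
  using U by (simp add: unitary_group_def)

lemma unitary_group_linear:
  "f \<in> L2 \<Longrightarrow> g \<in> L2 \<Longrightarrow> AE x in lebesgue. U t (\<lambda>y. a * f y + b * g y) x = a * U t f x + b * U t g x"
  using U by (simp add: unitary_group_def)

lemma unitary_group_diff:
  "f \<in> L2 \<Longrightarrow> g \<in> L2 \<Longrightarrow> AE x in lebesgue. U t (\<lambda>y. f y - g y) x = U t f x - U t g x"
  using unitary_group_linear[of f g t 1 "-1"] by simp

lemma unitary_group_add: "f \<in> L2 \<Longrightarrow> AE x in lebesgue. U (s + t) f x = U s (U t f) x"
  using U by (simp add: unitary_group_def)

lemma unitary_group_L2norm_diff: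
  assumes "f \<in> L2" "g \<in> L2"
  shows "L2norm (\<lambda>x. U t f x - U t g x) = L2norm (\<lambda>x. f x - g x)"
proof -
  have "L2norm (\<lambda>x. U t f x - U t g x) = L2norm (U t (\<lambda>x. f x - g x))"
    by (rule L2norm_cong_AE)
       (use unitary_group_diff[OF assms, of t] assms in
         \<open>auto intro!: L2_measurable L2_diff unitary_group_L2\<close>)
  then show ?thesis using assms by (simp add: unitary_group_norm L2_diff)
qed

lemma unitary_group_cong_AE:
  assumes "f \<in> L2" "g \<in> L2" "AE x in lebesgue. f x = g x"
  shows "AE x in lebesgue. U t f x = U t g x"
proof -
  have "L2norm (\<lambda>x. f x - g x) = L2norm (\<lambda>x::'a. 0)"
    by (rule L2norm_cong_AE) (use assms in \<open>auto intro!: L2_measurable L2_diff\<close>)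
  also have "\<dots> = 0" by (simp add: L2norm_def)
  finally have "L2norm (\<lambda>x. U t f x - U t g x) = 0"
    using assms by (simp add: unitary_group_L2norm_diff)
  from L2norm_eq_0_AE[OF _ this] assms show ?thesis
    by (simp add: L2_diff unitary_group_L2)
qed

lemma unitary_group_inverse:
  assumes "f \<in> L2" shows "AE x in lebesgue. U (- t) (U t f) x = f x" "AE x in lebesgue. U t (U (- t) f) x = f x"
proof -
  have 0: "AE x in lebesgue. U 0 f x = f x"
    using U assms by (simp add: unitary_group_def)
  show "AE x in lebesgue. U (- t) (U t f) x = f x"
    using 0 unitary_group_add[OF assms, of "-t" t] by eventually_elim simp
  show "AE x in lebesgue. U t (U (- t) f) x = f x"
    using 0 unitary_group_add[OF assms, of t "-t"] by eventually_elim simp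
qed

text \<open>Polarisation: the real part is read off from the norm of a sum, and the imaginary part
  is a real part with \<open>\<i> * g\<close> in place of \<open>g\<close>. Linearity moves this
  factor through \<open>U t\<close> only almost everywhere.\<close>

lemma unitary_group_ip:
  assumes f: "f \<in> L2" and g: "g \<in> L2"
  shows "ip (U t f) (U t g) = ip f g"
proof -
  have *: "Re (ip (U t f) (U t g)) = Re (ip f g)" if g: "g \<in> L2" for g
  proof -
    have "L2norm (\<lambda>x. U t f x + U t g x) = L2norm (U t (\<lambda>x. 1 * f x + 1 * g x))"
      by (rule L2norm_cong_AE)
         (use unitary_group_linear[OF f g, of t 1 1] f g in
           \<open>auto intro!: L2_measurable L2_add unitary_group_L2\<close>)
    also have "\<dots> = L2norm (\<lambda>x. f x + g x)"
      using f g by (simp add: unitary_group_norm L2_add)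
    finally show ?thesis
      using L2norm_add_power2[OF f g] L2norm_add_power2[OF unitary_group_L2[OF f] unitary_group_L2[OF g], of t t] f g
      by (simp add: unitary_group_norm)
  qed
  have ig: "(\<lambda>x. \<i> * g x) \<in> L2" by (rule L2_cmult[OF g])
  have "ip (U t f) (U t (\<lambda>x. \<i> * g x)) = ip (U t f) (\<lambda>x. \<i> * U t g x)"
    by (rule ip_cong_AE)
       (use unitary_group_linear[OF g g, of t \<i> 0] f g ig in \<open>auto intro!: L2_measurable L2_cmult unitary_group_L2\<close>)
  then have "Re (- \<i> * ip (U t f) (U t g)) = Re (- \<i> * ip f g)"
    using *[OF ig] by (simp add: ip_cmult_right)
  then have "Im (ip (U t f) (U t g)) = Im (ip f g)" by simp
  then show ?thesis using *[OF g] by (simp add: complex_eq_iff)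
qed

lemma unitary_group_adjoint:
  assumes f: "f \<in> L2" and g: "g \<in> L2"
  shows "ip (U t f) g = ip f (U (- t) g)"
proof -
  have "ip (U t f) g = ip (U t f) (U t (U (- t) g))"
    by (rule ip_cong_AE)
       (use unitary_group_inverse(2)[OF g, of t] f g in
         \<open>auto simp: eq_commute intro!: L2_measurable unitary_group_L2\<close>)
  also have "\<dots> = ip f (U (- t) g)"
    by (rule unitary_group_ip) (auto intro!: unitary_group_L2 f g)
  finally show ?thesis .
qed

end

section \<open>Gaussian densities\<close>

lemma product_sigma_finite_lborel: "product_sigma_finite (\<lambda>_::'a. lborel :: real measure)"
  by standard

text \<open>\<open>lborel\<close> on a Euclidean space is the image of a product of copies of the
  one-dimensional measure, where functions of separate coordinates integrate factor by
  factor.\<close>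

lemma
  fixes f :: "'a::euclidean_space \<Rightarrow> real \<Rightarrow> 'b::{real_normed_field,banach,second_countable_topology}"
  assumes f: "\<And>b. b \<in> Basis \<Longrightarrow> integrable lborel (f b)"
  shows integrable_lborel_prod: "integrable lborel (\<lambda>x. \<Prod>b\<in>Basis. f b (x \<bullet> b))"
    and integral_lborel_prod: "(LINT x|lborel. (\<Prod>b\<in>Basis. f b (x \<bullet> b))) = (\<Prod>b\<in>Basis. integral\<^sup>L lborel (f b))"
proof -
  interpret product_sigma_finite "\<lambda>_::'a. lborel :: real measure"
    by (rule product_sigma_finite_lborel)
  have [measurable]: "f b \<in> borel_measurable borel" if "b \<in> Basis" for b
    using borel_measurable_integrable[OF f[OF that]] by simp
  have m: "(\<lambda>x. \<Prod>b\<in>Basis. f b (x \<bullet> b)) \<in> borel_measurable borel"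
    by (rule borel_measurable_prod) measurable
  have e: "(\<Prod>b\<in>Basis. f b ((\<Sum>c\<in>Basis. y c *\<^sub>R c) \<bullet> b)) = (\<Prod>b\<in>Basis. f b (y b))" for y
    by (intro prod.cong refl) simp
  show "integrable lborel (\<lambda>x. \<Prod>b\<in>Basis. f b (x \<bullet> b))"
    by (subst lborel_eq, subst integrable_distr_eq[OF _ m])
       (auto simp: e intro!: product_integrable_prod f)
  show "(LINT x|lborel. (\<Prod>b\<in>Basis. f b (x \<bullet> b))) = (\<Prod>b\<in>Basis. integral\<^sup>L lborel (f b))"
    by (subst lborel_eq, subst integral_distr[OF _ m])
       (auto simp: e intro!: product_integral_prod f)
qed

text \<open>The standard normal density, kept as a product so that its mass and its Fourier
  transform reduce to one coordinate; \<open>gauss_eq\<close> is the radial form.\<close>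

definition gauss :: "'a::euclidean_space \<Rightarrow> real" where
  "gauss x = (\<Prod>b\<in>Basis. std_normal_density (x \<bullet> b))"

lemma norm_power2_Basis: "(norm x)\<^sup>2 = (\<Sum>b\<in>Basis. (x \<bullet> b)\<^sup>2)"
  for x :: "'a::euclidean_space"
  by (simp add: norm_eq_sqrt_inner euclidean_inner[of x x] power2_eq_square sum_nonneg)

lemma gauss_eq: "gauss x = (1 / sqrt (2 * pi)) ^ DIM('a) * exp (- (norm x)\<^sup>2 / 2)"
  for x :: "'a::euclidean_space"
  unfolding gauss_def std_normal_density_def prod.distrib norm_power2_Basis
  by (simp add: sum_negf sum_divide_distrib flip: exp_sum)

lemma gauss_measurable [measurable]: "gauss \<in> borel_measurable borel"
  unfolding gauss_eq[abs_def] by measurable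

lemma gauss_nonneg [simp]: "0 \<le> gauss x"
  by (simp add: gauss_eq)

lemma gauss_le_1: "gauss (x :: 'a::euclidean_space) \<le> 1"
proof -
  have "1 \<le> sqrt (2 * pi)" using pi_gt3 by simp
  then have "(1 / sqrt (2 * pi)) ^ DIM('a) \<le> 1"
    by (intro power_le_one) auto
  then show ?thesis unfolding gauss_eq by (intro mult_le_one) auto
qed

lemma gauss_integrable [intro, simp]: "integrable lborel gauss"
  unfolding gauss_def[abs_def] using integrable_normal_moment[of 1 0 0]
  by (intro integrable_lborel_prod) simp

lemma gauss_integral: "integral\<^sup>L lborel (gauss :: 'a::euclidean_space \<Rightarrow> real) = 1"
  unfolding gauss_def[abs_def] using integrable_normal_moment[of 1 0 0] integral_normal_density[of 1 0]
  by (subst integral_lborel_prod) simp_all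

lemma nn_integral_gauss: "(\<integral>\<^sup>+ x. ennreal (gauss (x::'a::euclidean_space)) \<partial>lborel) = 1"
  by (subst nn_integral_eq_integral) (auto simp: gauss_integral)

lemma integrable_exp_norm_power2:
  assumes "0 < a"
  shows "integrable lborel (\<lambda>x::'a::euclidean_space. exp (- a * (norm x)\<^sup>2))"
proof -
  have "integrable lborel (\<lambda>x::real. exp (- a * x\<^sup>2))"
  proof -
    \<comment> \<open>The standard deviation whose normal density is a multiple of the given
      exponential.\<close>
    define s where "s = 1 / sqrt (2 * a)"
    have s: "0 < s" "2 * s\<^sup>2 = 1 / a" using assms by (simp_all add: s_def power_divide)
    have "integrable lborel (\<lambda>x. sqrt (2 * pi * s\<^sup>2) * normal_density 0 s x)"
      using integrable_normal_moment[OF s(1), of 0 0] by simp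
    also have "(\<lambda>x. sqrt (2 * pi * s\<^sup>2) * normal_density 0 s x) = (\<lambda>x. exp (- a * x\<^sup>2))"
    proof
      fix x
      have "x\<^sup>2 / (2 * s\<^sup>2) = a * x\<^sup>2" unfolding s(2) by simp
      then show "sqrt (2 * pi * s\<^sup>2) * normal_density 0 s x = exp (- a * x\<^sup>2)"
        using s(1) by (simp add: normal_density_def)
    qed
    finally show ?thesis .
  qed
  then have "integrable lborel (\<lambda>x::'a. \<Prod>b\<in>Basis. exp (- a * (x \<bullet> b)\<^sup>2))"
    by (rule integrable_lborel_prod)
  also have "(\<lambda>x::'a. \<Prod>b\<in>Basis. exp (- a * (x \<bullet> b)\<^sup>2)) = (\<lambda>x. exp (- a * (norm x)\<^sup>2))"
    by (simp add: norm_power2_Basis sum_distrib_left sum_negf flip: exp_sum)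
  finally show ?thesis .
qed

lemma gauss_moment_integrable: "integrable lborel (\<lambda>x::'a::euclidean_space. gauss x * norm x)"
proof (rule Bochner_Integration.integrable_bound)
  show "integrable lborel (\<lambda>x::'a. (1 / sqrt (2 * pi)) ^ DIM('a) * exp (- (1/4) * (norm x)\<^sup>2))"
    using integrable_exp_norm_power2[of "1/4"] by simp
  show "AE x::'a in lborel. norm (gauss x * norm x) \<le> norm ((1 / sqrt (2 * pi)) ^ DIM('a) * exp (- (1/4) * (norm x)\<^sup>2))"
  proof (intro AE_I2)
    fix x :: 'a
    \<comment> \<open>The linear factor costs half of the Gaussian exponent: t \<le> 1 + t^2/4 \<le>
      exp (t^2/4).\<close>
    have "0 \<le> (norm x / 2 - 1)\<^sup>2" by simp
    then have "norm x \<le> 1 + (norm x)\<^sup>2 / 4" by (simp add: power2_eq_square field_simps)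
    also have "\<dots> \<le> exp ((norm x)\<^sup>2 / 4)" by (rule exp_ge_add_one_self)
    finally have "exp (- (norm x)\<^sup>2 / 2) * norm x \<le> exp (- (norm x)\<^sup>2 / 2) * exp ((norm x)\<^sup>2 / 4)"
      by (rule mult_left_mono) simp
    also have "\<dots> = exp (- (1/4) * (norm x)\<^sup>2)" by (simp flip: exp_add)
    finally show "norm (gauss x * norm x) \<le> norm ((1 / sqrt (2 * pi)) ^ DIM('a) * exp (- (1/4) * (norm x)\<^sup>2))"
      unfolding gauss_eq by (simp add: abs_mult mult.assoc mult_left_mono)
  qed
qed measurable

text \<open>In each coordinate this is the characteristic function of the standard normal law. Read
  from right to left it resolves a Gaussian multiplier into plane waves.\<close>

lemma gauss_fourier:
  fixes x :: "'a::euclidean_space"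
  shows "(LINT y|lborel. complex_of_real (gauss y) * exp (\<i> * of_real (y \<bullet> x))) = of_real (exp (- (norm x)\<^sup>2 / 2))"
proof -
  have int: "integrable lborel (\<lambda>y. of_real (std_normal_density y) * exp (\<i> * of_real (y * s)))" for s
  proof (rule Bochner_Integration.integrable_bound)
    show "integrable lborel std_normal_density"
      using integrable_normal_moment[of 1 0 0] by simp
  qed (auto simp: norm_mult)
  have val: "(LINT y|lborel. of_real (std_normal_density y) * exp (\<i> * of_real (y * s))) = complex_of_real (exp (- s\<^sup>2 / 2))" for s
  proof -
    have "complex_of_real (exp (- s\<^sup>2 / 2)) = char std_normal_distribution s"
      by (simp add: char_std_normal_distribution)
    also have "\<dots> = (LINT y|lborel. std_normal_density y *\<^sub>R iexp (s * y))"
      unfolding char_def by (subst integral_density) auto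
    finally show ?thesis by (simp add: scaleR_conv_of_real mult.commute)
  qed
  have "complex_of_real (gauss y) * exp (\<i> * of_real (y \<bullet> x)) =
     (\<Prod>b\<in>Basis. of_real (std_normal_density (y \<bullet> b)) * exp (\<i> * of_real ((y \<bullet> b) * (x \<bullet> b))))" for y :: 'a
    unfolding gauss_def prod.distrib of_real_prod euclidean_inner[of y x]
    by (simp add: exp_sum sum_distrib_left)
  then have "(LINT y|lborel. complex_of_real (gauss y) * exp (\<i> * of_real (y \<bullet> x))) =
     (\<Prod>b\<in>Basis. (LINT s|lborel. of_real (std_normal_density s) * exp (\<i> * of_real (s * (x \<bullet> b)))))"
    by (simp only: integral_lborel_prod[OF int])
  also have "\<dots> = (\<Prod>b\<in>Basis. complex_of_real (exp (- (x \<bullet> b)\<^sup>2 / 2)))"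
    by (simp only: val)
  also have "\<dots> = of_real (exp (- (norm x)\<^sup>2 / 2))"
    by (simp add: norm_power2_Basis sum_negf sum_divide_distrib flip: exp_sum of_real_prod)
  finally show ?thesis .
qed

section \<open>Thin sets and Gaussian averages\<close>

text \<open>Supplies the hypothesis \<open>small\<close> of \<open>thin_larger_balls\<close>. If
  \<open>r\<close> is below half of 1 + |y|, then 1 + |z| is at least (1 + |y|)/2 throughout the
  ball; otherwise the weight is at most 1 \<le> 2 r. The sum \<open>2 + 2 powr \<beta>\<close>
  covers both cases.\<close>

lemma scale_powr_le:
  fixes y z :: "'a::real_normed_vector"
  assumes K: "0 < K" and b: "0 < \<beta>" and r: "(1 + norm y) powr (- \<beta>) \<le> r" and z: "z \<in> ball y r"
  shows "K * (1 + norm z) powr (- \<beta>) \<le> K * (2 + 2 powr \<beta>) * r"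
proof -
  have r0: "0 < r" using z by (metis ball_eq_empty empty_iff not_less)
  have "(1 + norm z) powr (- \<beta>) \<le> (2 + 2 powr \<beta>) * r"
  proof (cases "r \<ge> (1 + norm y) / 2")
    case True
    have "(1 + norm z) powr (- \<beta>) \<le> 1"
      using b powr_mono2'[of "-\<beta>" 1 "1 + norm z"] by simp
    also have "1 \<le> 2 * r"
    proof -
      have "1 + norm y \<le> 2 * r" using True by simp
      moreover have "0 \<le> norm y" by simp
      ultimately show ?thesis by linarith
    qed
    also have "\<dots> \<le> (2 + 2 powr \<beta>) * r" using r0 by (intro mult_right_mono) auto
    finally show ?thesis .
  next
    case False
    have "norm y \<le> norm z + dist y z"
      using norm_triangle_sub[of y z] by (simp add: dist_norm)
    then have *: "(1 + norm y) / 2 \<le> 1 + norm z" using False z by simp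
    have "(1 + norm z) powr (- \<beta>) \<le> ((1 + norm y) / 2) powr (- \<beta>)"
      using * b by (intro powr_mono2') (auto intro: add_pos_nonneg)
    also have "\<dots> = 2 powr \<beta> * (1 + norm y) powr (- \<beta>)"
      by (simp add: powr_divide powr_minus divide_simps)
    also have "\<dots> \<le> 2 powr \<beta> * r" using r by simp
    also have "\<dots> \<le> (2 + 2 powr \<beta>) * r" using r0 by (intro mult_right_mono) auto
    finally show ?thesis .
  qed
  then show ?thesis using K by (simp add: mult.assoc)
qed

lemma emeasure_ball_scale:
  fixes x y :: "'a::euclidean_space"
  assumes "0 \<le> c" "0 \<le> r"
  shows "emeasure lborel (ball x (c * r)) = ennreal (c ^ DIM('a)) * emeasure lborel (ball y r)"
  using assms by (simp add: emeasure_ball power_mult_distrib ennreal_mult'[symmetric] mult_ac)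

text \<open>Vitali covering: balls of one fifth of the given radii, centred in the large ball, can
  be picked disjoint so that the full balls cover it. In each full ball \<open>E\<close> has share
  at most \<epsilon>, shrinking by 5 costs 5^d, and the small balls fit disjointly into the ball of
  radius (1 + A) r.\<close>

lemma thin_larger_balls:
  fixes E :: "'a::euclidean_space set"
  assumes E: "E \<in> sets borel" and eps: "0 \<le> \<epsilon>" and A: "0 < A" and r: "0 < r"
    and pos: "\<And>z. 0 < \<rho> z"
    and small: "\<And>z. z \<in> ball y r \<Longrightarrow> \<rho> z \<le> A * r"
    and thin: "\<And>z. emeasure lborel (E \<inter> ball z (\<rho> z)) \<le> ennreal \<epsilon> * emeasure lborel (ball z (\<rho> z))"
  shows "emeasure lborel (E \<inter> ball y r) \<le> ennreal (\<epsilon> * (5 * (1 + A)) ^ DIM('a)) * emeasure lborel (ball y r)"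
proof -
  have S: "ball y r \<subseteq> (\<Union>z\<in>ball y r. ball z (\<rho> z / 5))"
    using pos by (auto intro!: bexI)
  obtain C where C: "countable C" "C \<subseteq> ball y r"
     "pairwise (\<lambda>i j. disjnt (ball i (\<rho> i / 5)) (ball j (\<rho> j / 5))) C"
     "ball y r \<subseteq> (\<Union>i\<in>C. ball i (5 * (\<rho> i / 5)))"
  proof (rule Vitali_covering_lemma_balls[OF S])
    fix z assume "z \<in> ball y r"
    then have "\<rho> z \<le> A * r" by (rule small)
    then show "0 < \<rho> z / 5 \<and> \<rho> z / 5 \<le> A * r" using pos[of z] by simp
  qed
  define J where "J X i = (\<Union>z\<in>{z\<in>C. to_nat_on C z = i}. X z)" for X :: "'a \<Rightarrow> 'a set" and i
  have J: "J X (to_nat_on C z) = X z" if "z \<in> C" for X z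
    using that C(1) by (auto simp: J_def to_nat_on_inj)
  have J0: "J X i = {}" if "i \<notin> to_nat_on C ` C" for X i
    using that by (auto simp: J_def)
  have UJ: "(\<Union>i. J X i) = (\<Union>z\<in>C. X z)" for X by (auto simp: J_def)
  have sJ: "J X i \<in> sets lborel" if "\<And>z. X z \<in> sets borel" for X i
    using that by (cases "i \<in> to_nat_on C ` C") (auto simp: J J0)
  let ?B = "\<lambda>z. ball z (\<rho> z / 5)" and ?X = "\<lambda>z. E \<inter> ball z (\<rho> z)"
  have "emeasure lborel (E \<inter> ball y r) \<le> emeasure lborel (\<Union>i. J ?X i)"
    using C(4) E by (intro emeasure_mono) (auto simp: UJ intro!: sets.countable_UN' C(1))
  also have "\<dots> \<le> (\<Sum>i. emeasure lborel (J ?X i))"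
    by (rule emeasure_subadditive_countably) (use E sJ[of ?X] in auto)
  also have "\<dots> \<le> (\<Sum>i. ennreal (\<epsilon> * 5 ^ DIM('a)) * emeasure lborel (J ?B i))"
  proof (rule suminf_le)
    fix i
    show "emeasure lborel (J ?X i) \<le> ennreal (\<epsilon> * 5 ^ DIM('a)) * emeasure lborel (J ?B i)"
    proof (cases "i \<in> to_nat_on C ` C")
      case True
      then obtain z where z: "z \<in> C" "i = to_nat_on C z" by auto
      have "emeasure lborel (ball z (\<rho> z)) = ennreal (5 ^ DIM('a)) * emeasure lborel (?B z)"
        using emeasure_ball_scale[of 5 "\<rho> z / 5" z z] pos[of z] by simp
      then show ?thesis using thin[of z] z eps by (simp add: J ennreal_mult' mult.assoc)
    qed (simp add: J0)
  qed auto
  also have "\<dots> = ennreal (\<epsilon> * 5 ^ DIM('a)) * (\<Sum>i. emeasure lborel (J ?B i))"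
    by simp
  also have "(\<Sum>i. emeasure lborel (J ?B i)) = emeasure lborel (\<Union>i. J ?B i)"
  proof (rule suminf_emeasure)
    show "disjoint_family (J ?B)"
      unfolding disjoint_family_on_def
    proof safe
      fix m n x assume "m \<noteq> n" "x \<in> J ?B m" "x \<in> J ?B n"
      then obtain z w where "z \<in> C" "w \<in> C" "z \<noteq> w" "x \<in> ?B z" "x \<in> ?B w"
        unfolding J_def by blast
      then show "x \<in> {}" using C(3) unfolding pairwise_def disjnt_def by blast
    qed
  qed (use sJ[of ?B] in auto)
  also have "emeasure lborel (\<Union>i. J ?B i) \<le> emeasure lborel (ball y ((1 + A) * r))"
  proof (rule emeasure_mono)
    show "(\<Union>i. J ?B i) \<subseteq> ball y ((1 + A) * r)"
      unfolding UJ
    proof safe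
      fix z x assume z: "z \<in> C" and x: "x \<in> ?B z"
      have "dist y x \<le> dist y z + dist z x" by (rule dist_triangle)
      moreover have "dist y z < r" using z C(2) by auto
      moreover have "dist z x < A * r"
        using x small[of z] z C(2) pos[of z] by auto
      ultimately show "x \<in> ball y ((1 + A) * r)" by (simp add: algebra_simps)
    qed
  qed simp
  also have "emeasure lborel (ball y ((1 + A) * r)) = ennreal ((1 + A) ^ DIM('a)) * emeasure lborel (ball y r)"
    using A r by (intro emeasure_ball_scale) auto
  finally have *: "emeasure lborel (E \<inter> ball y r) \<le>
      ennreal (\<epsilon> * 5 ^ DIM('a)) * (ennreal ((1 + A) ^ DIM('a)) * emeasure lborel (ball y r))"
    by (simp add: mult_left_mono)
  have "ennreal (\<epsilon> * (5 * (1 + A)) ^ DIM('a)) = ennreal (\<epsilon> * 5 ^ DIM('a)) * ennreal ((1 + A) ^ DIM('a))"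
    using eps A unfolding power_mult_distrib by (simp add: ennreal_mult'[symmetric] mult.assoc)
  with * show ?thesis by (simp add: mult.assoc)
qed

section \<open>Gaussian cutoffs and their increments\<close>

definition cutoff :: "real \<Rightarrow> nat \<Rightarrow> 'a::real_normed_vector \<Rightarrow> real" where
  "cutoff p n y = exp (- (norm y / p ^ n)\<^sup>2)"

text \<open>Increments of the cutoffs, concentrated around |y| ~ p^n. Index 0 carries the whole
  first cutoff, so that partial sums telescope to \<open>cutoff p N\<close> without
  remainder.\<close>

fun shell :: "real \<Rightarrow> nat \<Rightarrow> 'a::real_normed_vector \<Rightarrow> real" where
  "shell p 0 y = cutoff p 0 y"
| "shell p (Suc n) y = cutoff p (Suc n) y - cutoff p n y"

lemma cutoff_bounds: "0 \<le> cutoff p n y" "cutoff p n y \<le> 1"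
  by (auto simp: cutoff_def)

lemma cutoff_measurable [measurable]: "cutoff p n \<in> borel_measurable borel"
  unfolding cutoff_def[abs_def] by measurable

lemma shell_measurable [measurable]: "shell p n \<in> borel_measurable borel"
  by (cases n) (auto simp: shell.simps[abs_def])

lemma sum_shell: "(\<Sum>n\<le>N. shell p n y) = cutoff p N y"
  by (induction N) auto

lemma shell_nonneg: "1 \<le> p \<Longrightarrow> 0 \<le> shell p n y"
proof (cases n)
  case (Suc m)
  assume p: "1 \<le> p"
  have "norm y / p ^ Suc m \<le> norm y / p ^ m"
    using p by (intro divide_left_mono) auto
  then have "(norm y / p ^ Suc m)\<^sup>2 \<le> (norm y / p ^ m)\<^sup>2"
    using p by (intro power_mono) auto
  then show ?thesis by (simp add: Suc cutoff_def)
qed (simp add: cutoff_bounds)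

lemma shell_le_cutoff: "shell p n y \<le> cutoff p n y"
  by (cases n) (auto simp: cutoff_bounds)

lemma shell_le_1: "shell p n y \<le> 1"
  using shell_le_cutoff cutoff_bounds(2) order_trans by blast

lemma exp_neg_power2_lipschitz: "\<bar>exp (- u\<^sup>2) - exp (- v\<^sup>2)\<bar> \<le> \<bar>u - v\<bar>" for u v :: real
proof -
  have "norm (exp (- u\<^sup>2) - exp (- v\<^sup>2)) \<le> 1 * norm (u - v)"
  proof (rule field_differentiable_bound[of UNIV "\<lambda>u. exp (- u\<^sup>2)" "\<lambda>u. - (2 * u) * exp (- u\<^sup>2)"])
    fix z :: real
    show "((\<lambda>u. exp (- u\<^sup>2)) has_field_derivative - (2 * z) * exp (- z\<^sup>2)) (at z within UNIV)"
      by (auto intro!: derivative_eq_intros)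
    have "2 * \<bar>z\<bar> \<le> 1 + z\<^sup>2"
      using sum_squares_bound[of 1 "\<bar>z\<bar>"] by simp
    also have "\<dots> \<le> exp (z\<^sup>2)" by (rule exp_ge_add_one_self)
    finally have "2 * \<bar>z\<bar> * exp (- z\<^sup>2) \<le> exp (z\<^sup>2) * exp (- z\<^sup>2)"
      by (rule mult_right_mono) simp
    then show "norm (- (2 * z) * exp (- z\<^sup>2)) \<le> 1"
      by (simp add: abs_mult flip: exp_add)
  qed auto
  then show ?thesis by simp
qed

lemma cutoff_lipschitz:
  assumes "0 < p"
  shows "\<bar>cutoff p n (x - z) - cutoff p n x\<bar> \<le> norm z / p ^ n"
proof -
  have "\<bar>cutoff p n (x - z) - cutoff p n x\<bar> \<le> \<bar>norm (x - z) / p ^ n - norm x / p ^ n\<bar>"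
    unfolding cutoff_def by (rule exp_neg_power2_lipschitz)
  also have "\<dots> = \<bar>norm (x - z) - norm x\<bar> / p ^ n"
    using assms by (simp add: diff_divide_distrib[symmetric])
  also have "\<bar>norm (x - z) - norm x\<bar> \<le> norm z"
    using norm_triangle_ineq3[of "x - z" x] by simp
  finally show ?thesis using assms by (simp add: divide_right_mono)
qed

text \<open>The inner cutoff of the pair has Lipschitz constant p / p^n, whence the factor p. The
  loss decays geometrically in \<open>n\<close> and is therefore summable over the shells.\<close>

lemma shell_lipschitz:
  assumes "1 \<le> p"
  shows "shell p n (x - z) \<le> shell p n x + 2 * p * norm z / p ^ n"
proof (cases n)
  case 0
  have "norm z * 1 \<le> norm z * (2 * p)" using assms by (intro mult_left_mono) auto
  then show ?thesis using 0 assms cutoff_lipschitz[of p 0 x z] by (simp add: mult_ac)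
next
  case (Suc m)
  have "norm z / p ^ Suc m \<le> norm z / p ^ m"
    using assms by (intro divide_left_mono) auto
  moreover have "2 * p * norm z / p ^ Suc m = norm z / p ^ m + norm z / p ^ m"
    using assms by simp
  ultimately show ?thesis
    using assms Suc cutoff_lipschitz[of p "Suc m" x z] cutoff_lipschitz[of p m x z] by simp
qed

text \<open>The sum telescopes to a difference of cutoffs, at most 1 - exp (-u^2) \<le> u^2 with u =
  |y| / p^k. So a point gives quadratically small weight to the shells far outside it.\<close>

lemma sum_shell_tail:
  assumes "1 \<le> p" "k \<le> N"
  shows "(\<Sum>n\<in>{Suc k..N}. shell p n y) \<le> (norm y / p ^ k)\<^sup>2"
proof -
  have "(\<Sum>n\<le>N. shell p n y) = (\<Sum>n\<le>k. shell p n y) + (\<Sum>n\<in>{Suc k..N}. shell p n y)"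
    using assms(2) by (subst sum.union_disjoint[symmetric]) (auto intro!: sum.cong)
  then have "(\<Sum>n\<in>{Suc k..N}. shell p n y) = cutoff p N y - cutoff p k y"
    by (simp add: sum_shell)
  also have "\<dots> \<le> 1 - cutoff p k y" by (simp add: cutoff_bounds)
  also have "\<dots> \<le> (norm y / p ^ k)\<^sup>2"
    using exp_ge_add_one_self[of "- (norm y / p ^ k)\<^sup>2"] by (simp add: cutoff_def)
  finally show ?thesis .
qed

definition gauss_moment :: "'a::euclidean_space itself \<Rightarrow> real" where
  "gauss_moment _ = (LINT x|lborel. gauss (x::'a) * norm x)"

lemma gauss_moment_nonneg: "0 \<le> gauss_moment TYPE('a::euclidean_space)"
  unfolding gauss_moment_def by (intro integral_nonneg_AE) auto

lemma nn_integral_gauss_moment: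
  "(\<integral>\<^sup>+ x. ennreal (gauss (x::'a::euclidean_space) * norm x) \<partial>lborel) = gauss_moment TYPE('a)"
  unfolding gauss_moment_def by (intro nn_integral_eq_integral gauss_moment_integrable) auto

text \<open>Row sums for Schur's test; no thin set is involved. Averaging raises the n-th shell by
  at most its Lipschitz constant times the mean displacement, and these errors form a geometric
  series on top of the sum of the shells at \<open>x\<close>, which is at most 1.\<close>

lemma shell_row_bound:
  fixes x :: "'a::euclidean_space"
  assumes p: "1 < p" and lam: "\<And>n. 0 \<le> lam n" "\<And>n. lam n \<le> L"
  shows "(\<Sum>n\<le>N. \<integral>\<^sup>+ \<eta>. ennreal (gauss \<eta> * shell p n (x - lam n *\<^sub>R \<eta>)) \<partial>lborel)
     \<le> ennreal (1 + 2 * p * L * gauss_moment TYPE('a) / (1 - 1 / p))"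
proof -
  let ?m = "gauss_moment TYPE('a)"
  have L: "0 \<le> L" using lam order_trans by blast
  have "(\<integral>\<^sup>+ \<eta>. ennreal (gauss \<eta> * shell p n (x - lam n *\<^sub>R \<eta>)) \<partial>lborel) \<le> ennreal (shell p n x + 2 * p * L * ?m * (1 / p) ^ n)" for n
  proof -
    have "(\<integral>\<^sup>+ \<eta>. ennreal (gauss \<eta> * shell p n (x - lam n *\<^sub>R \<eta>)) \<partial>lborel)
       \<le> (\<integral>\<^sup>+ (\<eta>::'a). ennreal (shell p n x) * ennreal (gauss \<eta>) + ennreal (2 * p * L * (1 / p) ^ n) * ennreal (gauss \<eta> * norm \<eta>) \<partial>lborel)"
    proof (rule nn_integral_mono)
      fix \<eta> :: 'a
      have "2 * p * norm (lam n *\<^sub>R \<eta>) / p ^ n \<le> 2 * p * (L * norm \<eta>) / p ^ n"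
        using p lam by (intro divide_right_mono mult_left_mono) (auto intro!: mult_right_mono)
      then have "shell p n (x - lam n *\<^sub>R \<eta>) \<le> shell p n x + 2 * p * (L * norm \<eta>) / p ^ n"
        using shell_lipschitz[of p n x "lam n *\<^sub>R \<eta>"] p by linarith
      then have "gauss \<eta> * shell p n (x - lam n *\<^sub>R \<eta>) \<le> gauss \<eta> * (shell p n x + 2 * p * (L * norm \<eta>) / p ^ n)"
        by (intro mult_left_mono) auto
      also have "\<dots> = shell p n x * gauss \<eta> + 2 * p * L * (1 / p) ^ n * (gauss \<eta> * norm \<eta>)"
        by (simp add: algebra_simps power_one_over)
      finally have "ennreal (gauss \<eta> * shell p n (x - lam n *\<^sub>R \<eta>)) \<le> ennreal (shell p n x * gauss \<eta> + 2 * p * L * (1 / p) ^ n * (gauss \<eta> * norm \<eta>))"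
        by (rule ennreal_leI)
      also have "\<dots> = ennreal (shell p n x) * ennreal (gauss \<eta>) + ennreal (2 * p * L * (1 / p) ^ n) * ennreal (gauss \<eta> * norm \<eta>)"
        using p L by (subst ennreal_plus) (auto simp: shell_nonneg ennreal_mult')
      finally show "ennreal (gauss \<eta> * shell p n (x - lam n *\<^sub>R \<eta>)) \<le>
        ennreal (shell p n x) * ennreal (gauss \<eta>) + ennreal (2 * p * L * (1 / p) ^ n) * ennreal (gauss \<eta> * norm \<eta>)" .
    qed
    also have "\<dots> = ennreal (shell p n x) + ennreal (2 * p * L * (1 / p) ^ n) * ennreal ?m"
      by (subst nn_integral_add) (auto simp: nn_integral_cmult nn_integral_gauss nn_integral_gauss_moment)
    also have "\<dots> = ennreal (shell p n x + 2 * p * L * ?m * (1 / p) ^ n)"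
      using p L gauss_moment_nonneg[where 'a='a]
      by (subst ennreal_plus) (auto simp: shell_nonneg ennreal_mult'[symmetric] mult_ac)
    finally show ?thesis .
  qed
  then have "(\<Sum>n\<le>N. \<integral>\<^sup>+ \<eta>. ennreal (gauss \<eta> * shell p n (x - lam n *\<^sub>R \<eta>)) \<partial>lborel)
     \<le> (\<Sum>n\<le>N. ennreal (shell p n x + 2 * p * L * ?m * (1 / p) ^ n))"
    by (rule sum_mono)
  also have "\<dots> = ennreal (\<Sum>n\<le>N. shell p n x + 2 * p * L * ?m * (1 / p) ^ n)"
    using p L gauss_moment_nonneg[where 'a='a] by (intro sum_ennreal) (auto simp: shell_nonneg)
  also have "\<dots> \<le> ennreal (1 + 2 * p * L * ?m / (1 - 1 / p))"
  proof (rule ennreal_leI)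
    have "(\<Sum>n\<le>N. (1 / p) ^ n) \<le> (\<Sum>n. (1 / p) ^ n)"
      using p by (intro sum_le_suminf summable_geometric) auto
    also have "\<dots> = 1 / (1 - 1 / p)" using p by (intro suminf_geometric) auto
    finally have "2 * p * L * ?m * (\<Sum>n\<le>N. (1 / p) ^ n) \<le> 2 * p * L * ?m * (1 / (1 - 1 / p))"
      using p L gauss_moment_nonneg[where 'a='a] by (intro mult_left_mono) auto
    then show "(\<Sum>n\<le>N. shell p n x + 2 * p * L * ?m * (1 / p) ^ n) \<le> 1 + 2 * p * L * ?m / (1 - 1 / p)"
      using cutoff_bounds(2)[of p N x] by (simp add: sum.distrib sum_shell sum_distrib_left)
  qed
  finally show ?thesis .
qed

lemma nn_integral_lborel_affine:
  fixes f :: "'a::euclidean_space \<Rightarrow> ennreal"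
  assumes [measurable]: "f \<in> borel_measurable borel" and c: "c \<noteq> 0"
  shows "(\<integral>\<^sup>+x. f x \<partial>lborel) = ennreal (\<bar>c\<bar> ^ DIM('a)) * (\<integral>\<^sup>+x. f (t + c *\<^sub>R x) \<partial>lborel)"
  by (subst lborel_affine[OF c, of t]) (simp add: nn_integral_density nn_integral_distr nn_integral_cmult ennreal_power)

text \<open>Split at |\<eta>| = R. Inside, the density is at most 1 and the rescaled measure of
  \<open>E\<close> in the ball of radius \<open>l * R\<close> remains; outside, Markov's inequality
  with the first moment applies.\<close>

lemma gauss_thin_bound:
  fixes E :: "'a::euclidean_space set"
  assumes E [measurable]: "E \<in> sets borel" and l: "0 < l" and R: "0 < R" and eps: "0 \<le> \<epsilon>"
    and thin: "emeasure lborel (E \<inter> ball y (l * R)) \<le> ennreal \<epsilon> * emeasure lborel (ball y (l * R))"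
  shows "(\<integral>\<^sup>+ \<eta>. ennreal (gauss \<eta>) * indicator E (y + l *\<^sub>R \<eta>) \<partial>lborel)
    \<le> ennreal (\<epsilon> * (unit_ball_vol (real DIM('a)) * R ^ DIM('a)) + gauss_moment TYPE('a) / R)"
proof -
  let ?X = "\<integral>\<^sup>+ \<eta>. indicator (E \<inter> ball y (l * R)) (y + l *\<^sub>R \<eta>) \<partial>lborel"
  let ?v = "unit_ball_vol (real DIM('a))"
  have "emeasure lborel (E \<inter> ball y (l * R)) = (\<integral>\<^sup>+ x. indicator (E \<inter> ball y (l * R)) x \<partial>lborel)"
    by simp
  also have "\<dots> = ennreal (\<bar>l\<bar> ^ DIM('a)) * ?X"
    using l E by (intro nn_integral_lborel_affine borel_measurable_indicator sets.Int) auto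
  finally have "ennreal (l ^ DIM('a)) * ?X = emeasure lborel (E \<inter> ball y (l * R))"
    using l by simp
  also have "\<dots> \<le> ennreal \<epsilon> * ennreal (?v * (l * R) ^ DIM('a))"
    using thin l R by (simp add: emeasure_ball)
  also have "\<dots> = ennreal (l ^ DIM('a)) * ennreal (\<epsilon> * (?v * R ^ DIM('a)))"
    using l R eps by (simp add: ennreal_mult'[symmetric] power_mult_distrib mult_ac)
  finally have X: "?X \<le> ennreal (\<epsilon> * (?v * R ^ DIM('a)))"
    using l by (subst (asm) ennreal_mult_le_mult_iff) auto
  have "(\<integral>\<^sup>+ \<eta>. ennreal (gauss \<eta>) * indicator E (y + l *\<^sub>R \<eta>) \<partial>lborel)
    \<le> (\<integral>\<^sup>+ \<eta>. indicator (E \<inter> ball y (l * R)) (y + l *\<^sub>R \<eta>) + ennreal (1 / R) * ennreal (gauss \<eta> * norm \<eta>) \<partial>lborel)"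
  proof (rule nn_integral_mono)
    fix \<eta> :: 'a
    show "ennreal (gauss \<eta>) * indicator E (y + l *\<^sub>R \<eta>) \<le> indicator (E \<inter> ball y (l * R)) (y + l *\<^sub>R \<eta>) + ennreal (1 / R) * ennreal (gauss \<eta> * norm \<eta>)"
    proof (cases "norm \<eta> < R")
      case True
      then have "y + l *\<^sub>R \<eta> \<in> ball y (l * R)" using l by (simp add: dist_norm)
      moreover have "ennreal (gauss \<eta>) \<le> 1" using gauss_le_1[of \<eta>] by simp
      ultimately show ?thesis by (auto simp: indicator_def intro: add_increasing2)
    next
      case False
      then have "gauss \<eta> * 1 \<le> gauss \<eta> * (norm \<eta> / R)" using R by (intro mult_left_mono) auto
      then have "ennreal (gauss \<eta>) \<le> ennreal (1 / R) * ennreal (gauss \<eta> * norm \<eta>)"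
        using R by (simp add: ennreal_mult'[symmetric] mult_ac)
      then show ?thesis by (auto simp: indicator_def intro: add_increasing)
    qed
  qed
  also have "\<dots> = ?X + ennreal (1 / R) * ennreal (gauss_moment TYPE('a))"
  proof -
    have [measurable]: "E \<inter> ball y (l * R) \<in> sets borel" using E by auto
    have "(\<lambda>\<eta>::'a. indicator (E \<inter> ball y (l * R)) (y + l *\<^sub>R \<eta>) :: ennreal) \<in> borel_measurable borel"
      by measurable
    then show ?thesis
      by (subst nn_integral_add) (auto simp: nn_integral_cmult nn_integral_gauss_moment)
  qed
  also have "\<dots> \<le> ennreal (\<epsilon> * (?v * R ^ DIM('a))) + ennreal (gauss_moment TYPE('a) / R)"
    using X R gauss_moment_nonneg[where 'a='a] by (intro add_mono) (auto simp: ennreal_mult'[symmetric])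
  also have "\<dots> = ennreal (\<epsilon> * (?v * R ^ DIM('a)) + gauss_moment TYPE('a) / R)"
    using R eps gauss_moment_nonneg[where 'a='a] by (subst ennreal_plus) auto
  finally show ?thesis .
qed

text \<open>Column sums for Schur's test, where thinness enters. Shells with p^n at most M (1 + |y|)
  average over balls large enough for \<open>E\<close> to be thin in them, and their weights sum to
  at most 1. The other shells lie far outside \<open>y\<close>, and their total weight is small by
  \<open>sum_shell_tail\<close>.\<close>

lemma shell_column_bound:
  fixes p \<beta> L \<delta> :: real
  assumes p: "1 < p" and b: "0 < \<beta>" and L: "0 < L" and d: "0 < \<delta>"
  obtains \<epsilon> where "0 < \<epsilon>"
    "\<And>(E::'a::euclidean_space set) N y. E \<in> sets borel \<Longrightarrow>
       (\<And>y r. (1 + norm y) powr (- \<beta>) \<le> r \<Longrightarrow> emeasure lborel (E \<inter> ball y r) \<le> ennreal \<epsilon> * emeasure lborel (ball y r)) \<Longrightarrow>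
       (\<Sum>n\<le>N. ennreal (shell p n y) * (\<integral>\<^sup>+ \<eta>. ennreal (gauss \<eta>) * indicator E (y + (L / (p powr \<beta>) ^ n) *\<^sub>R \<eta>) \<partial>lborel)) \<le> ennreal \<delta>"
proof -
  let ?m = "gauss_moment TYPE('a)" and ?v = "unit_ball_vol (real DIM('a))"
  \<comment> \<open>Three contributions get \<delta>/3 each: \<open>M\<close> controls the far
    shells through (p/M)^2, \<open>R\<close> the Gaussian tail, and \<open>\<epsilon>\<close> the
    part of \<open>E\<close> inside the balls. The other bound on \<open>R\<close>, M powr \<beta>
    \<le> L R, makes the balls of the near shells reach the critical radius.\<close>
  define M where "M = max 1 (p * sqrt (3 / \<delta>))"
  define R where "R = max (M powr \<beta> / L) (3 * ?m / \<delta> + 1)"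
  define \<epsilon> where "\<epsilon> = \<delta> / (3 * (?v * R ^ DIM('a)))"
  have M: "1 \<le> M" "(p / M)\<^sup>2 \<le> \<delta> / 3"
  proof -
    show M1: "1 \<le> M" by (simp add: M_def)
    have "p * sqrt (3 / \<delta>) \<le> M" by (simp add: M_def)
    then have "(p * sqrt (3 / \<delta>))\<^sup>2 \<le> M\<^sup>2" using p d by (intro power_mono) auto
    then have "p\<^sup>2 * (3 / \<delta>) \<le> M\<^sup>2" using d by (simp add: power_mult_distrib)
    then show "(p / M)\<^sup>2 \<le> \<delta> / 3" using M1 d by (simp add: power_divide field_simps)
  qed
  have R: "0 < R" "M powr \<beta> \<le> L * R" "?m / R \<le> \<delta> / 3"
  proof -
    have *: "3 * ?m / \<delta> + 1 \<le> R" by (simp add: R_def)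
    have "0 \<le> 3 * ?m / \<delta>" using d gauss_moment_nonneg[where 'a='a] by simp
    with * show R0: "0 < R" by linarith
    have "M powr \<beta> / L \<le> R" by (simp add: R_def)
    then show "M powr \<beta> \<le> L * R" using L by (simp add: field_simps)
    have "3 * ?m / \<delta> \<le> R" using * by simp
    then show "?m / R \<le> \<delta> / 3" using R0 d by (simp add: field_simps)
  qed
  have v: "0 < ?v * R ^ DIM('a)" using R by simp
  have eps: "0 < \<epsilon>" "\<epsilon> * (?v * R ^ DIM('a)) = \<delta> / 3"
  proof -
    have *: "\<delta> / (3 * X) * X = \<delta> / 3" if "0 < X" for X using that by simp
    show "0 < \<epsilon>" using d v by (simp add: \<epsilon>_def)
    show "\<epsilon> * (?v * R ^ DIM('a)) = \<delta> / 3" unfolding \<epsilon>_def by (rule *[OF v])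
  qed
  have main: "(\<Sum>n\<le>N. ennreal (shell p n y) * (\<integral>\<^sup>+ \<eta>. ennreal (gauss \<eta>) * indicator E (y + (L / (p powr \<beta>) ^ n) *\<^sub>R \<eta>) \<partial>lborel)) \<le> ennreal \<delta>"
    if E [measurable]: "E \<in> sets borel"
    and thin: "\<And>y r. (1 + norm y) powr (- \<beta>) \<le> r \<Longrightarrow> emeasure lborel (E \<inter> ball y r) \<le> ennreal \<epsilon> * emeasure lborel (ball y r)"
    for E :: "'a set" and N y
  proof -
    \<comment> \<open>The far shells, as seen from \<open>y\<close>. Shells inside |y| need no
      separate treatment: their averaging scale only exceeds the critical one.\<close>
    define B where "B = {n. M * (1 + norm y) < p ^ n}"
    let ?I = "\<lambda>n. \<integral>\<^sup>+ \<eta>. ennreal (gauss \<eta>) * indicator E (y + (L / (p powr \<beta>) ^ n) *\<^sub>R \<eta>) \<partial>lborel"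
    have good: "?I n \<le> ennreal (2 * \<delta> / 3)" if "n \<notin> B" for n
    proof -
      have le: "p ^ n \<le> M * (1 + norm y)" using that by (simp add: B_def)
      have "(p powr \<beta>) ^ n = (p ^ n) powr \<beta>"
        using p by (simp add: powr_powr powr_realpow[symmetric] mult.commute)
      also have "\<dots> \<le> (M * (1 + norm y)) powr \<beta>" using p le b by (intro powr_mono2) auto
      also have "\<dots> = M powr \<beta> * (1 + norm y) powr \<beta>" using M by (simp add: powr_mult)
      also have "\<dots> \<le> L * R * (1 + norm y) powr \<beta>" using R by (intro mult_right_mono) auto
      finally have q: "(p powr \<beta>) ^ n \<le> L * R * (1 + norm y) powr \<beta>" .
      have q0: "0 < (p powr \<beta>) ^ n" using p by simp
      have y0: "0 < (1 + norm y) powr \<beta>" using add_pos_nonneg[OF zero_less_one norm_ge_zero[of y]] by auto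
      have "(1 + norm y) powr (- \<beta>) \<le> (L / (p powr \<beta>) ^ n) * R"
      proof -
        have "1 / Y \<le> L / Q * R" if "0 < Y" "0 < Q" "Q \<le> L * R * Y" for Y Q
          using that by (simp add: field_simps)
        from this[OF y0 q0 q] show ?thesis by (simp add: powr_minus_divide)
      qed
      from gauss_thin_bound[OF E _ R(1) _ thin[OF this]]
      have "?I n \<le> ennreal (\<epsilon> * (?v * R ^ DIM('a)) + ?m / R)"
        using L q0 less_imp_le[OF eps(1)] by simp
      also have "\<dots> \<le> ennreal (2 * \<delta> / 3)" using R eps by (intro ennreal_leI) simp
      finally show ?thesis .
    qed
    have bad: "?I n \<le> 1" for n
    proof -
      have "?I n \<le> (\<integral>\<^sup>+ (\<eta>::'a). ennreal (gauss \<eta>) \<partial>lborel)"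
        by (intro nn_integral_mono) (auto simp: indicator_def)
      then show ?thesis by (simp add: nn_integral_gauss)
    qed
    have tail: "(\<Sum>n\<in>{..N} \<inter> B. shell p n y) \<le> \<delta> / 3"
    proof (cases "{..N} \<inter> B = {}")
      case False
      then obtain n0 where n0: "n0 \<in> B" "n0 \<le> N" by auto
      define n1 where "n1 = (LEAST n. n \<in> B)"
      have n1: "n1 \<in> B" "n1 \<le> n0" unfolding n1_def using n0 by (auto intro: LeastI Least_le)
      \<comment> \<open>Hence the first far index is a successor \<open>Suc k\<close>. The tail
        estimate uses the radius p^k of the last near shell, which is where the factor p in (p/M)^2
        comes from.\<close>
      have "0 \<notin> B"
      proof -
        have "1 * 1 \<le> M * (1 + norm y)" using M by (intro mult_mono) auto
        then show ?thesis by (simp add: B_def)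
      qed
      then obtain k where k: "n1 = Suc k" using n1 by (cases n1) auto
      have sub: "{..N} \<inter> B \<subseteq> {Suc k..N}"
        using Least_le[of "\<lambda>n. n \<in> B"] by (auto simp: n1_def k[symmetric])
      have "(\<Sum>n\<in>{..N} \<inter> B. shell p n y) \<le> (\<Sum>n\<in>{Suc k..N}. shell p n y)"
        using sub p by (intro sum_mono2) (auto simp: shell_nonneg)
      also have "\<dots> \<le> (norm y / p ^ k)\<^sup>2" using p n0 n1 k by (intro sum_shell_tail) auto
      also have "\<dots> \<le> (p / M)\<^sup>2"
      proof (rule power_mono)
        have "M * (1 + norm y) < p * p ^ k" using n1 by (simp add: B_def k)
        moreover have "M * norm y \<le> M * (1 + norm y)" using M by simp
        ultimately have "M * norm y \<le> p * p ^ k" by linarith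
        then show "norm y / p ^ k \<le> p / M" using p M by (simp add: field_simps)
      qed (use p in auto)
      finally show ?thesis using M by simp
    qed (use d in simp)
    have "(\<Sum>n\<le>N. ennreal (shell p n y) * ?I n) =
       (\<Sum>n\<in>{..N} - B. ennreal (shell p n y) * ?I n) + (\<Sum>n\<in>{..N} \<inter> B. ennreal (shell p n y) * ?I n)"
      by (subst add.commute, rule sum.Int_Diff) simp
    also have "\<dots> \<le> (\<Sum>n\<in>{..N} - B. ennreal (shell p n y) * ennreal (2 * \<delta> / 3)) + (\<Sum>n\<in>{..N} \<inter> B. ennreal (shell p n y) * 1)"
      by (intro add_mono sum_mono mult_left_mono good bad) auto
    also have "\<dots> \<le> (\<Sum>n\<in>{..N}. ennreal (shell p n y) * ennreal (2 * \<delta> / 3)) + (\<Sum>n\<in>{..N} \<inter> B. ennreal (shell p n y))"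
      by (intro add_mono sum_mono2) auto
    also have "\<dots> = ennreal (cutoff p N y) * ennreal (2 * \<delta> / 3) + ennreal (\<Sum>n\<in>{..N} \<inter> B. shell p n y)"
      using p by (simp add: sum_distrib_right[symmetric] sum_ennreal shell_nonneg sum_shell)
    also have "\<dots> \<le> 1 * ennreal (2 * \<delta> / 3) + ennreal (\<delta> / 3)"
      using cutoff_bounds(2)[of p N y] tail by (intro add_mono mult_right_mono ennreal_leI) auto
    also have "\<dots> = ennreal \<delta>" using d by (simp add: ennreal_plus[symmetric] del: ennreal_plus)
    finally show ?thesis .
  qed
  show thesis by (rule that[OF eps(1) main])
qed

lemma nn_integral_lborel_translate:
  fixes f :: "'a::euclidean_space \<Rightarrow> ennreal"
  assumes [measurable]: "f \<in> borel_measurable borel"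
  shows "(\<integral>\<^sup>+x. f (x + c) \<partial>lborel) = (\<integral>\<^sup>+x. f x \<partial>lborel)"
  by (subst (2) lborel_distr_plus[of c, symmetric]) (simp add: nn_integral_distr add.commute)

lemma weighted_young:
  fixes a b \<theta> :: real
  assumes "0 < \<theta>"
  shows "a * b \<le> \<theta> * a\<^sup>2 + b\<^sup>2 / \<theta>"
proof -
  have "0 \<le> (\<theta> * a - b / 2)\<^sup>2 / \<theta>" using assms by simp
  also have "\<dots> = \<theta> * a\<^sup>2 - a * b + b\<^sup>2 / (4 * \<theta>)"
    using assms by (simp add: power2_eq_square field_simps)
  finally have "a * b \<le> \<theta> * a\<^sup>2 + b\<^sup>2 / (4 * \<theta>)" by simp
  also have "b\<^sup>2 / (4 * \<theta>) \<le> b\<^sup>2 / \<theta>" using assms by (intro divide_left_mono) auto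
  finally show ?thesis by simp
qed

text \<open>
  Young's inequality with the large constant \<open>1/\<theta>\<close> placed on the output variable off \<open>E\<close>,
  and on the input variable over \<open>E\<close>, where the smallness \<open>\<delta>\<close> of the column sums absorbs it.
\<close>

lemma averaged_form_bound:
  fixes F :: "'a::euclidean_space \<Rightarrow> real" and W :: "'i \<Rightarrow> 'a \<Rightarrow> real" and lam :: "'i \<Rightarrow> real"
  assumes F [measurable]: "F \<in> borel_measurable borel" and F0: "\<And>x. 0 \<le> F x"
    and W [measurable]: "\<And>n. W n \<in> borel_measurable borel" and W0: "\<And>n x. 0 \<le> W n x"
    and E [measurable]: "E \<in> sets borel" and I: "finite I"
    and \<theta>: "0 < \<theta>" and C: "0 \<le> C" and \<delta>: "0 \<le> \<delta>"
    and total: "\<And>y. (\<Sum>n\<in>I. W n y) \<le> 1"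
    and row: "\<And>x. (\<Sum>n\<in>I. \<integral>\<^sup>+ \<eta>. ennreal (gauss \<eta> * W n (x - lam n *\<^sub>R \<eta>)) \<partial>lborel) \<le> ennreal C"
    and col: "\<And>y. (\<Sum>n\<in>I. ennreal (W n y) * (\<integral>\<^sup>+ \<eta>. ennreal (gauss \<eta>) * indicator E (y + lam n *\<^sub>R \<eta>) \<partial>lborel)) \<le> ennreal \<delta>"
  shows "(\<Sum>n\<in>I. \<integral>\<^sup>+ x. \<integral>\<^sup>+ \<eta>. ennreal (gauss \<eta> * (F x * (W n (x - lam n *\<^sub>R \<eta>) * F (x - lam n *\<^sub>R \<eta>)))) \<partial>lborel \<partial>lborel)
     \<le> ennreal (\<theta> * (C + 1) + \<delta> / \<theta>) * (\<integral>\<^sup>+ x. ennreal ((F x)\<^sup>2) \<partial>lborel)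
       + ennreal (C / \<theta>) * (\<integral>\<^sup>+ x. ennreal ((F x)\<^sup>2) * indicator (- E) x \<partial>lborel)"
proof -
  \<comment> \<open>\<open>A\<close> depends on the output point alone and is summed by rows;
    \<open>H\<close> carries the value at the input point, sees the output point only through the
    indicator of \<open>E\<close>, and is summed by columns.\<close>
  define A where "A x = ennreal (\<theta> * (F x)\<^sup>2) + ennreal ((F x)\<^sup>2 / \<theta>) * indicator (- E) x" for x
  define H where "H x y = ennreal (\<theta> * (F y)\<^sup>2) + ennreal ((F y)\<^sup>2 / \<theta>) * indicator E x" for x y
  have [measurable]: "A \<in> borel_measurable borel" unfolding A_def by measurable
  have [measurable]: "(\<lambda>z. H (f z) (g z)) \<in> borel_measurable M" if [measurable]: "f \<in> borel_measurable M" "g \<in> borel_measurable M"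
    for f g and M :: "'b measure" unfolding H_def by measurable
  let ?J = "\<lambda>n y. \<integral>\<^sup>+ \<eta>. ennreal (gauss \<eta>) * indicator E (y + lam n *\<^sub>R \<eta>) \<partial>lborel"
  let ?TA = "\<lambda>n. \<integral>\<^sup>+ x. \<integral>\<^sup>+ \<eta>. ennreal (gauss \<eta> * W n (x - lam n *\<^sub>R \<eta>)) * A x \<partial>lborel \<partial>lborel"
  let ?TH = "\<lambda>n. \<integral>\<^sup>+ x. \<integral>\<^sup>+ \<eta>. ennreal (gauss \<eta> * W n (x - lam n *\<^sub>R \<eta>)) * H x (x - lam n *\<^sub>R \<eta>) \<partial>lborel \<partial>lborel"
  let ?N = "\<integral>\<^sup>+ x. ennreal ((F x)\<^sup>2) \<partial>lborel" and ?NE = "\<integral>\<^sup>+ x. ennreal ((F x)\<^sup>2) * indicator (- E) x \<partial>lborel"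
  have pw: "ennreal (gauss \<eta> * (F x * (W n y * F y))) \<le> ennreal (gauss \<eta> * W n y) * A x + ennreal (gauss \<eta> * W n y) * H x y"
    for \<eta> x y :: 'a and n
  proof -
    have "ennreal (F x * F y) \<le> A x + H x y"
    proof (cases "x \<in> E")
      case True
      have "ennreal (F x * F y) \<le> ennreal (\<theta> * (F x)\<^sup>2 + (F y)\<^sup>2 / \<theta>)"
        by (intro ennreal_leI weighted_young \<theta>)
      also have "\<dots> \<le> A x + H x y" using True \<theta>
        by (simp add: A_def H_def ennreal_plus add_left_mono)
      finally show ?thesis .
    next
      case False
      have "ennreal (F x * F y) \<le> ennreal ((F x)\<^sup>2 / \<theta> + \<theta> * (F y)\<^sup>2)"
        using weighted_young[OF \<theta>, of "F y" "F x"] by (intro ennreal_leI) (simp add: mult.commute add.commute)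
      also have "\<dots> \<le> A x + H x y" using False \<theta>
        by (simp add: A_def H_def ennreal_plus add_right_mono)
      finally show ?thesis .
    qed
    then have "ennreal (gauss \<eta> * W n y) * ennreal (F x * F y) \<le> ennreal (gauss \<eta> * W n y) * (A x + H x y)"
      by (rule mult_left_mono) simp
    also have "ennreal (gauss \<eta> * W n y) * ennreal (F x * F y) = ennreal (gauss \<eta> * (F x * (W n y * F y)))"
      by (simp add: ennreal_mult'[symmetric] W0 F0 mult_ac)
    finally show ?thesis by (simp add: distrib_left)
  qed
  have T1: "(\<Sum>n\<in>I. ?TA n) \<le> ennreal C * (\<integral>\<^sup>+ x. A x \<partial>lborel)"
  proof -
    have "(\<Sum>n\<in>I. ?TA n) =
      (\<integral>\<^sup>+ x. (\<Sum>n\<in>I. \<integral>\<^sup>+ \<eta>. ennreal (gauss \<eta> * W n (x - lam n *\<^sub>R \<eta>)) \<partial>lborel) * A x \<partial>lborel)"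
      by (simp add: nn_integral_multc sum_distrib_right nn_integral_sum)
    also have "\<dots> \<le> (\<integral>\<^sup>+ x. ennreal C * A x \<partial>lborel)"
      by (intro nn_integral_mono mult_right_mono row) auto
    finally show ?thesis by (simp add: nn_integral_cmult)
  qed
  have T2: "?TH n =
     (\<integral>\<^sup>+ y. ennreal (\<theta> * (F y)\<^sup>2) * ennreal (W n y) + ennreal ((F y)\<^sup>2 / \<theta>) * (ennreal (W n y) * ?J n y) \<partial>lborel)" for n
  proof -
    \<comment> \<open>Fubini and a translation make the input point \<open>y\<close> the outer
      variable. The output point becomes \<open>y + lam n *\<^sub>R \<eta>\<close>, which is the
      form of \<open>col\<close>.\<close>
    have "?TH n =
      (\<integral>\<^sup>+ \<eta>. \<integral>\<^sup>+ x. ennreal (gauss \<eta> * W n (x - lam n *\<^sub>R \<eta>)) * H x (x - lam n *\<^sub>R \<eta>) \<partial>lborel \<partial>lborel)"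
      by (rule lborel_pair.Fubini') measurable
    also have "\<dots> = (\<integral>\<^sup>+ \<eta>. \<integral>\<^sup>+ y. ennreal (gauss \<eta> * W n y) * H (y + lam n *\<^sub>R \<eta>) y \<partial>lborel \<partial>lborel)"
    proof (rule nn_integral_cong)
      fix \<eta> :: 'a
      show "(\<integral>\<^sup>+ x. ennreal (gauss \<eta> * W n (x - lam n *\<^sub>R \<eta>)) * H x (x - lam n *\<^sub>R \<eta>) \<partial>lborel) =
        (\<integral>\<^sup>+ y. ennreal (gauss \<eta> * W n y) * H (y + lam n *\<^sub>R \<eta>) y \<partial>lborel)"
        using nn_integral_lborel_translate[of "\<lambda>x. ennreal (gauss \<eta> * W n (x - lam n *\<^sub>R \<eta>)) * H x (x - lam n *\<^sub>R \<eta>)" "lam n *\<^sub>R \<eta>"]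
        by simp
    qed
    also have "\<dots> = (\<integral>\<^sup>+ y. \<integral>\<^sup>+ \<eta>. ennreal (gauss \<eta> * W n y) * H (y + lam n *\<^sub>R \<eta>) y \<partial>lborel \<partial>lborel)"
      by (rule lborel_pair.Fubini'[symmetric]) measurable
    also have "\<dots> = (\<integral>\<^sup>+ y. ennreal (\<theta> * (F y)\<^sup>2) * ennreal (W n y) + ennreal ((F y)\<^sup>2 / \<theta>) * (ennreal (W n y) * ?J n y) \<partial>lborel)"
    proof (rule nn_integral_cong)
      fix y :: 'a
      have "(\<integral>\<^sup>+ \<eta>. ennreal (gauss \<eta> * W n y) * H (y + lam n *\<^sub>R \<eta>) y \<partial>lborel) =
        (\<integral>\<^sup>+ \<eta>. ennreal (\<theta> * (F y)\<^sup>2) * ennreal (W n y) * ennreal (gauss \<eta>) +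
           ennreal ((F y)\<^sup>2 / \<theta>) * ennreal (W n y) * (ennreal (gauss \<eta>) * indicator E (y + lam n *\<^sub>R \<eta>)) \<partial>lborel)"
        by (intro nn_integral_cong) (simp add: H_def distrib_left ennreal_mult' W0 mult_ac)
      also have "\<dots> = ennreal (\<theta> * (F y)\<^sup>2) * ennreal (W n y) + ennreal ((F y)\<^sup>2 / \<theta>) * ennreal (W n y) * ?J n y"
        by (subst nn_integral_add) (auto simp: nn_integral_cmult nn_integral_gauss)
      finally show "(\<integral>\<^sup>+ \<eta>. ennreal (gauss \<eta> * W n y) * H (y + lam n *\<^sub>R \<eta>) y \<partial>lborel) =
        ennreal (\<theta> * (F y)\<^sup>2) * ennreal (W n y) + ennreal ((F y)\<^sup>2 / \<theta>) * (ennreal (W n y) * ?J n y)"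
        by (simp add: mult.assoc)
    qed
    finally show ?thesis .
  qed
  have "(\<Sum>n\<in>I. ?TH n)
    = (\<integral>\<^sup>+ y. ennreal (\<theta> * (F y)\<^sup>2) * (\<Sum>n\<in>I. ennreal (W n y)) + ennreal ((F y)\<^sup>2 / \<theta>) * (\<Sum>n\<in>I. ennreal (W n y) * ?J n y) \<partial>lborel)"
    unfolding T2 by (subst nn_integral_sum[symmetric]) (auto simp: sum.distrib sum_distrib_left)
  also have "\<dots> \<le> (\<integral>\<^sup>+ y. ennreal (\<theta> * (F y)\<^sup>2) * 1 + ennreal ((F y)\<^sup>2 / \<theta>) * ennreal \<delta> \<partial>lborel)"
  proof (intro nn_integral_mono add_mono mult_left_mono col)
    fix y
    have "(\<Sum>n\<in>I. ennreal (W n y)) = ennreal (\<Sum>n\<in>I. W n y)" by (rule sum_ennreal) (rule W0)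
    also have "\<dots> \<le> ennreal 1" by (intro ennreal_leI total)
    finally show "(\<Sum>n\<in>I. ennreal (W n y)) \<le> 1" by simp
  qed auto
  also have "\<dots> = (\<integral>\<^sup>+ y. ennreal (\<theta> + \<delta> / \<theta>) * ennreal ((F y)\<^sup>2) \<partial>lborel)"
    using \<theta> \<delta> by (intro nn_integral_cong)
      (simp add: ennreal_mult'[symmetric] ennreal_plus[symmetric] distrib_right mult_ac del: ennreal_plus)
  also have "\<dots> = ennreal (\<theta> + \<delta> / \<theta>) * ?N"
    by (rule nn_integral_cmult) measurable
  finally have T3: "(\<Sum>n\<in>I. ?TH n)
     \<le> ennreal (\<theta> + \<delta> / \<theta>) * ?N" .
  have AI: "(\<integral>\<^sup>+ x. A x \<partial>lborel) = ennreal \<theta> * ?N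
      + ennreal (1 / \<theta>) * ?NE"
  proof -
    have "A x = ennreal \<theta> * ennreal ((F x)\<^sup>2) + ennreal (1 / \<theta>) * (ennreal ((F x)\<^sup>2) * indicator (- E) x)" for x
      using \<theta> by (simp add: A_def ennreal_mult'[symmetric] mult.assoc[symmetric])
    then show ?thesis by (simp add: nn_integral_add nn_integral_cmult)
  qed
  have "(\<Sum>n\<in>I. \<integral>\<^sup>+ x. \<integral>\<^sup>+ \<eta>. ennreal (gauss \<eta> * (F x * (W n (x - lam n *\<^sub>R \<eta>) * F (x - lam n *\<^sub>R \<eta>)))) \<partial>lborel \<partial>lborel)
    \<le> (\<Sum>n\<in>I. \<integral>\<^sup>+ x. \<integral>\<^sup>+ \<eta>. ennreal (gauss \<eta> * W n (x - lam n *\<^sub>R \<eta>)) * A x + ennreal (gauss \<eta> * W n (x - lam n *\<^sub>R \<eta>)) * H x (x - lam n *\<^sub>R \<eta>) \<partial>lborel \<partial>lborel)"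
    by (intro sum_mono nn_integral_mono pw)
  also have "\<dots> = (\<Sum>n\<in>I. ?TA n)
     + (\<Sum>n\<in>I. ?TH n)"
    by (simp add: nn_integral_add sum.distrib)
  also have "\<dots> \<le> ennreal C * (\<integral>\<^sup>+ x. A x \<partial>lborel) + ennreal (\<theta> + \<delta> / \<theta>) * ?N"
    by (intro add_mono T1 T3)
  also have "\<dots> = (ennreal C * ennreal \<theta> + ennreal (\<theta> + \<delta> / \<theta>)) * ?N
       + ennreal C * ennreal (1 / \<theta>) * ?NE"
    unfolding AI by (simp add: distrib_left distrib_right mult.assoc add_ac)
  also have "ennreal C * ennreal \<theta> + ennreal (\<theta> + \<delta> / \<theta>) = ennreal (\<theta> * (C + 1) + \<delta> / \<theta>)"
    using \<theta> C \<delta> by (simp add: ennreal_mult'[symmetric] ennreal_plus[symmetric] algebra_simps del: ennreal_plus)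
  also have "ennreal C * ennreal (1 / \<theta>) = ennreal (C / \<theta>)"
    using \<theta> C by (simp add: ennreal_mult'[symmetric])
  finally show ?thesis .
qed

section \<open>Evolution of Gaussian packets\<close>

lemma L2I_dominated:
  assumes "f \<in> borel_measurable borel" "integrable lborel (\<lambda>x. (G x)\<^sup>2)" "\<And>x. cmod (f x) \<le> G x"
  shows "f \<in> L2"
proof -
  have [measurable]: "f \<in> borel_measurable borel" by fact
  have "integrable lborel (\<lambda>x. (cmod (f x))\<^sup>2)"
    by (rule Bochner_Integration.integrable_bound[OF assms(2)])
       (auto intro!: power_mono assms(3))
  then show ?thesis
    by (auto simp: L2_def integrable_completion measurable_completion)
qed

lemma L2norm_lborel:
  assumes [measurable]: "f \<in> borel_measurable borel"
  shows "L2norm f = sqrt (LINT x|lborel. (cmod (f x))\<^sup>2)"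
  unfolding L2norm_def by (subst integral_completion) auto

text \<open>Upgrades a pointwise time derivative to one in L2: by the mean value inequality
  difference quotients near \<open>s\<close> are bounded by \<open>G\<close>, so dominated
  convergence applies with majorant \<open>4 * (G x)\<^sup>2\<close>.\<close>

lemma L2_has_derivative_dominated:
  fixes \<psi> D :: "real \<Rightarrow> 'a::euclidean_space \<Rightarrow> complex"
  assumes meas [measurable]: "\<And>s. \<psi> s \<in> borel_measurable borel" "\<And>s. D s \<in> borel_measurable borel"
    and der: "\<And>r x. \<bar>r - s\<bar> \<le> 1 \<Longrightarrow> ((\<lambda>s. \<psi> s x) has_vector_derivative D r x) (at r)"
    and bnd: "\<And>r x. \<bar>r - s\<bar> \<le> 1 \<Longrightarrow> cmod (D r x) \<le> G x"
    and G: "integrable lborel (\<lambda>x. (G x)\<^sup>2)"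
  shows "((\<lambda>h. L2norm (\<lambda>x. (\<psi> (s + h) x - \<psi> s x) / of_real h - D s x)) \<longlongrightarrow> 0) (at 0)"
proof -
  define q where "q h x = (\<psi> (s + h) x - \<psi> s x) / of_real h - D s x" for h x
  have [measurable]: "q h \<in> borel_measurable borel" for h unfolding q_def by measurable
  have quot: "cmod (\<psi> (s + h) x - \<psi> s x) \<le> \<bar>h\<bar> * G x" if "\<bar>h\<bar> \<le> 1" for h x
  proof -
    have "cmod (\<psi> (s + h) x - \<psi> s x) \<le> G x * norm ((s + h) - s)"
    proof (rule differentiable_bound[where f'="\<lambda>r u. u *\<^sub>R D r x" and S="{s - 1..s + 1}"])
      fix r assume "r \<in> {s - 1..s + 1}"
      then have r: "\<bar>r - s\<bar> \<le> 1" by auto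
      show "((\<lambda>s. \<psi> s x) has_derivative (\<lambda>u. u *\<^sub>R D r x)) (at r within {s - 1..s + 1})"
        using der[OF r] by (auto simp: has_vector_derivative_def intro: has_derivative_at_withinI)
      have "0 \<le> G x" using bnd[OF r, of x] norm_ge_zero order_trans by blast
      then show "onorm (\<lambda>u. u *\<^sub>R D r x) \<le> G x"
        by (intro onorm_le) (use bnd[OF r, of x] in \<open>simp add: mult.commute[of "G x"] mult_left_mono\<close>)
    qed (use that in auto)
    then show ?thesis by (simp add: mult.commute)
  qed
  have qb: "cmod (q h x) \<le> 2 * G x" if "\<bar>h\<bar> \<le> 1" "h \<noteq> 0" for h x
  proof -
    have "cmod (q h x) \<le> cmod ((\<psi> (s + h) x - \<psi> s x) / of_real h) + cmod (D s x)"
      unfolding q_def by (rule norm_triangle_ineq4)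
    also have "cmod ((\<psi> (s + h) x - \<psi> s x) / of_real h) \<le> G x"
      using quot[OF that(1), of x] that(2) by (simp add: norm_divide field_simps)
    also have "cmod (D s x) \<le> G x" by (rule bnd) simp
    finally show ?thesis by simp
  qed
  have lim: "((\<lambda>h. q h x) \<longlongrightarrow> 0) (at 0)" for x
  proof -
    have "((\<lambda>s. \<psi> s x) has_vector_derivative D s x) (at s)" by (rule der) simp
    then have *: "((\<lambda>h. norm (\<psi> (s + h) x - \<psi> s x - h *\<^sub>R D s x) / norm h) \<longlongrightarrow> 0) (at 0)"
      by (simp add: has_vector_derivative_def has_derivative_at)
    show ?thesis
    proof (rule Lim_null_comparison[OF _ *])
      have "norm (q h x) \<le> norm (\<psi> (s + h) x - \<psi> s x - h *\<^sub>R D s x) / norm h" if "h \<noteq> 0" for h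
      proof -
        have "q h x = (\<psi> (s + h) x - \<psi> s x - h *\<^sub>R D s x) / of_real h"
          using that by (simp add: q_def diff_divide_distrib scaleR_conv_of_real)
        then show ?thesis by (simp add: norm_divide)
      qed
      then show "\<forall>\<^sub>F h in at 0. norm (q h x) \<le> norm (\<psi> (s + h) x - \<psi> s x - h *\<^sub>R D s x) / norm h"
        by (simp add: eventually_at_filter)
    qed
  qed
  have "((\<lambda>h. LINT x|lborel. (cmod (q h x))\<^sup>2) \<longlongrightarrow> 0) (at 0)"
    unfolding tendsto_at_iff_sequentially comp_def
  proof (intro allI impI)
    fix X :: "nat \<Rightarrow> real" assume X: "\<forall>i. X i \<in> UNIV - {0}" "X \<longlonglongrightarrow> 0"
    from X(2) have "eventually (\<lambda>i. dist (X i) 0 < 1) sequentially"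
      by (rule tendstoD) simp
    \<comment> \<open>Dropping an initial segment leaves only steps below 1, the window in which
      \<open>D\<close> is bounded.\<close>
    then obtain N where N: "\<And>i. i \<ge> N \<Longrightarrow> \<bar>X i\<bar> < 1"
      by (auto simp: eventually_sequentially)
    have "(\<lambda>i. LINT x|lborel. (cmod (q (X (i + N)) x))\<^sup>2) \<longlonglongrightarrow> (LINT x::'a|lborel. 0)"
    proof (rule integral_dominated_convergence)
      show "integrable lborel (\<lambda>x. 4 * (G x)\<^sup>2)" using G by simp
      show "AE x in lborel. (\<lambda>i. (cmod (q (X (i + N)) x))\<^sup>2) \<longlonglongrightarrow> 0"
      proof (intro AE_I2)
        fix x
        have "(\<lambda>i. q (X i) x) \<longlonglongrightarrow> 0"
          using lim[of x, unfolded tendsto_at_iff_sequentially comp_def] X by blast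
        then have "(\<lambda>i. q (X (i + N)) x) \<longlonglongrightarrow> 0" by (rule LIMSEQ_ignore_initial_segment)
        then have "(\<lambda>i. (cmod (q (X (i + N)) x))\<^sup>2) \<longlonglongrightarrow> (cmod 0)\<^sup>2"
          by (intro tendsto_intros)
        then show "(\<lambda>i. (cmod (q (X (i + N)) x))\<^sup>2) \<longlonglongrightarrow> 0" by simp
      qed
      show "AE x in lborel. norm ((cmod (q (X (i + N)) x))\<^sup>2) \<le> 4 * (G x)\<^sup>2" for i
      proof (intro AE_I2)
        fix x
        have "cmod (q (X (i + N)) x) \<le> 2 * G x"
          using N[of "i + N"] X(1) by (intro qb) auto
        then have "(cmod (q (X (i + N)) x))\<^sup>2 \<le> (2 * G x)\<^sup>2" by (intro power_mono) auto
        then show "norm ((cmod (q (X (i + N)) x))\<^sup>2) \<le> 4 * (G x)\<^sup>2" by (simp add: power_mult_distrib)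
      qed
    qed auto
    then show "(\<lambda>i. LINT x|lborel. (cmod (q (X i) x))\<^sup>2) \<longlonglongrightarrow> 0"
      by (simp add: LIMSEQ_offset)
  qed
  then have "((\<lambda>h. sqrt (LINT x|lborel. (cmod (q h x))\<^sup>2)) \<longlongrightarrow> sqrt 0) (at 0)"
    by (rule tendsto_real_sqrt)
  then show ?thesis by (simp add: L2norm_lborel q_def[abs_def, symmetric] q_def[symmetric])
qed

lemma L2_laplacian_L2: "(f, g) \<in> L2_laplacian \<Longrightarrow> f \<in> L2" "(f, g) \<in> L2_laplacian \<Longrightarrow> g \<in> L2"
  by (auto simp: L2_laplacian_def)

text \<open>The curve U (-s) (\<psi> s) stays constant. Instead of differentiating it in L2, the
  proof differentiates its scalar distance \<open>n s\<close> from \<psi> 0. Over a step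
  \<open>h\<close> this changes by at most |h| times the errors of two difference quotients with the
  same limit, one along \<psi> and one along the group orbit through \<psi> s.\<close>

lemma schroedinger_evolution_unique:
  fixes \<psi> \<zeta> :: "real \<Rightarrow> 'a::euclidean_space \<Rightarrow> complex"
  assumes S: "schroedinger_group U"
    and lap: "\<And>s. (\<psi> s, \<zeta> s) \<in> L2_laplacian"
    and der: "\<And>s. ((\<lambda>h. L2norm (\<lambda>x. (\<psi> (s + h) x - \<psi> s x) / of_real h - \<i> * \<zeta> s x)) \<longlongrightarrow> 0) (at 0)"
  shows "AE x in lebesgue. U t (\<psi> 0) x = \<psi> t x"
proof -
  have U: "unitary_group U" using S by (simp add: schroedinger_group_def)
  note UL = unitary_group_L2[OF U] and UN = unitary_group_L2norm_diff[OF U]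
  have L: "\<psi> s \<in> L2" "\<zeta> s \<in> L2" for s using lap[of s] by (auto simp: L2_laplacian_L2)
  have gen: "((\<lambda>h. L2norm (\<lambda>x. (U h (\<psi> s) x - \<psi> s x) / of_real h - \<i> * \<zeta> s x)) \<longlongrightarrow> 0) (at 0)" for s
  proof -
    have "(\<psi> s, \<lambda>x. \<i> * \<zeta> s x) \<in> generator U"
      using S lap[of s] by (auto simp: schroedinger_group_def)
    then show ?thesis by (simp add: generator_def)
  qed
  let ?d = "\<lambda>s h x. (\<psi> (s + h) x - \<psi> s x) / of_real h - \<i> * \<zeta> s x" and ?u = "\<lambda>s h x. (U h (\<psi> s) x - \<psi> s x) / of_real h - \<i> * \<zeta> s x"
  define n where "n s = L2norm (\<lambda>x. U (- s) (\<psi> s) x - \<psi> 0 x)" for s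
  define e where "e s h = L2norm (\<lambda>x. ?d s h x)
      + L2norm (\<lambda>x. ?u s h x)" for s h
  have incr: "\<bar>n (s + h) - n s\<bar> \<le> \<bar>h\<bar> * e s h" if h: "h \<noteq> 0" for s h
  proof -
    let ?a = "U (- (s + h)) (\<psi> (s + h))" and ?b = "U (- s) (\<psi> s)"
    have ab: "?a \<in> L2" "?b \<in> L2" using UL L by auto
    have tri: "n (s + h) \<le> n s + L2norm (\<lambda>x. ?a x - ?b x)" "n s \<le> n (s + h) + L2norm (\<lambda>x. ?a x - ?b x)"
    proof -
      have "n (s + h) \<le> n s + L2norm (\<lambda>x. (?a x - \<psi> 0 x) - (?b x - \<psi> 0 x))"
        unfolding n_def by (intro L2norm_triangle_diff L2_diff ab L)
      then show "n (s + h) \<le> n s + L2norm (\<lambda>x. ?a x - ?b x)" by simp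
      have "n s \<le> n (s + h) + L2norm (\<lambda>x. (?b x - \<psi> 0 x) - (?a x - \<psi> 0 x))"
        unfolding n_def by (intro L2norm_triangle_diff L2_diff ab L)
      then show "n s \<le> n (s + h) + L2norm (\<lambda>x. ?a x - ?b x)" by (simp add: L2norm_diff_commute)
    qed
    \<comment> \<open>By the group law both vectors now carry the same isometry
      \<open>U (- (s + h))\<close>, which drops out of the norm.\<close>
    have "AE x in lebesgue. ?b x = U (- (s + h)) (U h (\<psi> s)) x"
      using unitary_group_add[OF U L(1)[of s], of "- (s + h)" h] by simp
    then have "L2norm (\<lambda>x. ?a x - ?b x) = L2norm (\<lambda>x. ?a x - U (- (s + h)) (U h (\<psi> s)) x)"
      by (intro L2norm_cong_AE L2_measurable L2_diff ab UL L) auto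
    also have "\<dots> = L2norm (\<lambda>x. \<psi> (s + h) x - U h (\<psi> s) x)" by (intro UN L UL)
    also have "\<dots> = L2norm (\<lambda>x. of_real h * (?d s h x
        - ?u s h x))"
    proof -
      have "of_real h * (((a - p) / of_real h - c) - ((b - p) / of_real h - c)) = a - b" for a b p c :: complex
        using h by (simp add: algebra_simps diff_divide_distrib)
      then show ?thesis by (simp only:)
    qed
    also have "\<dots> = \<bar>h\<bar> * L2norm (\<lambda>x. ?d s h x
        - ?u s h x)"
      by (subst L2norm_cmult) simp
    also have "\<dots> \<le> \<bar>h\<bar> * e s h"
    proof (rule mult_left_mono)
      have q: "(\<lambda>x. (f x - \<psi> s x) / of_real h - \<i> * \<zeta> s x) \<in> L2" if "f \<in> L2" for f
        using L2_diff[OF L2_cmult[OF L2_diff[OF that L(1)[of s]], of "1 / of_real h"] L2_cmult[OF L(2)[of s], of \<i>]]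
        by simp
      have "L2norm (\<lambda>x. ?d s h x
        - ?u s h x)
        \<le> e s h"
        unfolding e_def by (intro L2norm_diff_le q L UL)
      then show "L2norm (\<lambda>x. ?d s h x
        - ?u s h x) \<le> e s h" .
    qed simp
    finally show ?thesis using tri by linarith
  qed
  have elim: "((\<lambda>h. e s h) \<longlongrightarrow> 0) (at 0)" for s
    unfolding e_def using tendsto_add[OF der[of s] gen[of s]] by simp
  have D0: "DERIV n s :> 0" for s
    unfolding DERIV_def
  proof (rule Lim_null_comparison[OF _ elim[of s]])
    show "\<forall>\<^sub>F h in at 0. norm ((n (s + h) - n s) / h) \<le> e s h"
      unfolding eventually_at_filter
      by (rule eventuallyI) (use incr[of _ s] in \<open>auto simp: field_simps\<close>)
  qed
  have "n t = n 0" by (rule DERIV_isconst_all) (use D0 in blast)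
  also have "n 0 = L2norm (\<lambda>x::'a. 0)"
    unfolding n_def
  proof (rule L2norm_cong_AE)
    have "AE x in lebesgue. U 0 (\<psi> 0) x = \<psi> 0 x"
      using U L(1)[of 0] by (simp add: unitary_group_def)
    then show "AE x in lebesgue. U (- 0) (\<psi> 0) x - \<psi> 0 x = 0" by simp
  qed (auto intro!: L2_measurable L2_diff UL L)
  also have "\<dots> = 0" by (simp add: L2norm_def)
  finally have "AE x in lebesgue. U (- t) (\<psi> t) x - \<psi> 0 x = 0"
    unfolding n_def by (intro L2norm_eq_0_AE L2_diff UL L)
  then have "AE x in lebesgue. U (- t) (\<psi> t) x = \<psi> 0 x" by simp
  then have "AE x in lebesgue. U t (U (- t) (\<psi> t)) x = U t (\<psi> 0) x"
    by (intro unitary_group_cong_AE[OF U] UL L)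
  with unitary_group_inverse(2)[OF U L(1)[of t], of t] show ?thesis
    by eventually_elim simp
qed

section \<open>Integration by parts against test functions\<close>

lemma lborel_integral_translate:
  fixes f :: "'a::euclidean_space \<Rightarrow> 'b::{banach,second_countable_topology}"
  assumes [measurable]: "f \<in> borel_measurable borel"
  shows "(LINT x|lborel. f (x + c)) = (LINT x|lborel. f x)"
  by (subst (2) lborel_distr_plus[of c, symmetric]) (simp add: integral_distr add.commute)

lemma lborel_integrable_translate:
  fixes f :: "'a::euclidean_space \<Rightarrow> 'b::{banach,second_countable_topology}"
  assumes "integrable lborel f"
  shows "integrable lborel (\<lambda>x. f (x + c))"
proof -
  have [measurable]: "f \<in> borel_measurable borel" using borel_measurable_integrable[OF assms] by simp
  have "integrable (distr lborel borel ((+) c)) f" using assms by (simp add: lborel_distr_plus)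
  then show ?thesis by (simp add: integrable_distr_eq add.commute)
qed

lemma integrable_continuous_compact_support:
  fixes f :: "'a::euclidean_space \<Rightarrow> 'b::{banach,second_countable_topology}"
  assumes "continuous_on UNIV f" "compact K" "\<And>x. x \<notin> K \<Longrightarrow> f x = 0"
  shows "integrable lborel f"
proof -
  have "integrable lborel (\<lambda>x. indicator K x *\<^sub>R f x)"
    using borel_integrable_compact[OF assms(2) continuous_on_subset[OF assms(1)]]
    by (simp add: set_integrable_def)
  also have "(\<lambda>x. indicator K x *\<^sub>R f x) = f"
    using assms(3) by (auto simp: indicator_def fun_eq_iff)
  finally show ?thesis .
qed

text \<open>Translation invariance makes the integral of each difference quotient of
  \<open>F\<close> vanish, and dominated convergence passes to the derivative.\<close>

lemma integral_directional_derivative_eq_0: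
  fixes F F' :: "'a::euclidean_space \<Rightarrow> complex" and b :: 'a
  assumes F: "continuous_on UNIV F" and F': "continuous_on UNIV F'" and K: "compact K"
    and F0: "\<And>x. x \<notin> K \<Longrightarrow> F x = 0" and F'0: "\<And>x. x \<notin> K \<Longrightarrow> F' x = 0"
    and der: "\<And>x s. ((\<lambda>s. F (x + s *\<^sub>R b)) has_vector_derivative F' (x + s *\<^sub>R b)) (at s)"
  shows "(LINT x|lborel. F' x) = 0"
proof -
  have [measurable]: "F \<in> borel_measurable borel" "F' \<in> borel_measurable borel"
    using F F' by (auto intro: borel_measurable_continuous_onI)
  have "bounded (F' ` K)"
    by (intro compact_imp_bounded compact_continuous_image continuous_on_subset[OF F'] K) auto
  then obtain B0 where B0: "\<And>x. x \<in> K \<Longrightarrow> norm (F' x) \<le> B0" by (auto simp: bounded_iff)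
  define B where "B = max 0 B0"
  have B: "norm (F' x) \<le> B" for x
    by (cases "x \<in> K") (auto simp: B_def F'0 le_max_iff_disj B0)
  have B0: "0 \<le> B" by (simp add: B_def)
  \<comment> \<open>Contains the supports of all difference quotients with step between 0 and 1, so
    a constant on this compact set is a majorant.\<close>
  define K' where "K' = (\<lambda>(x, s). x - s *\<^sub>R b) ` (K \<times> {0..1::real})"
  have K': "compact K'"
    unfolding K'_def by (intro compact_continuous_image compact_Times K)
      (auto simp: case_prod_unfold intro!: continuous_intros)
  have supp: "F (x + s *\<^sub>R b) = 0" if "x \<notin> K'" "s \<in> {0..1}" for x s
  proof (rule F0, rule notI)
    assume "x + s *\<^sub>R b \<in> K"
    then have "(\<lambda>(x, s). x - s *\<^sub>R b) (x + s *\<^sub>R b, s) \<in> K'"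
      unfolding K'_def using that(2) by (intro imageI) auto
    then show False using that(1) by simp
  qed
  define h where "h n = 1 / real (Suc n)" for n
  have h: "0 < h n" "h n \<le> 1" for n by (auto simp: h_def)
  define q where "q n x = (1 / h n) *\<^sub>R (F (x + h n *\<^sub>R b) - F x)" for n x
  have "(\<lambda>n. LINT x|lborel. q n x) \<longlonglongrightarrow> (LINT x|lborel. F' x)"
  proof (rule integral_dominated_convergence)
    show "integrable lborel (\<lambda>x. B * indicator K' x)"
      using K' by (intro integrable_mult_right integrable_real_indicator)
        (auto simp: borel_compact emeasure_compact_finite[unfolded infinity_ennreal_def])
    show "AE x in lborel. (\<lambda>n. q n x) \<longlonglongrightarrow> F' x"
    proof (intro AE_I2)
      fix x
      have "((\<lambda>s. F (x + s *\<^sub>R b)) has_vector_derivative F' x) (at 0)"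
        using der[of x 0] by simp
      then have *: "((\<lambda>s. norm (F (x + s *\<^sub>R b) - F x - s *\<^sub>R F' x) / norm s) \<longlongrightarrow> 0) (at 0)"
        by (simp add: has_vector_derivative_def has_derivative_at)
      have "h \<longlonglongrightarrow> 0" unfolding h_def by (rule lim_inverse_n'[THEN LIMSEQ_Suc])
      then have "(\<lambda>n. norm (F (x + h n *\<^sub>R b) - F x - h n *\<^sub>R F' x) / norm (h n)) \<longlonglongrightarrow> 0"
        using *[unfolded tendsto_at_iff_sequentially comp_def, rule_format, of h] h(1)
        by (simp add: less_imp_neq[symmetric])
      moreover have "norm (F (x + h n *\<^sub>R b) - F x - h n *\<^sub>R F' x) / norm (h n) = norm (q n x - F' x)" for n
      proof -
        have "q n x - F' x = (1 / h n) *\<^sub>R (F (x + h n *\<^sub>R b) - F x - h n *\<^sub>R F' x)"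
          using h(1)[of n] by (simp add: q_def scaleR_diff_right)
        then show ?thesis using h(1)[of n] by simp
      qed
      ultimately have "(\<lambda>n. norm (q n x - F' x)) \<longlonglongrightarrow> 0" by simp
      then show "(\<lambda>n. q n x) \<longlonglongrightarrow> F' x"
        by (simp add: tendsto_norm_zero_iff LIM_zero_iff)
    qed
    show "AE x in lborel. norm (q n x) \<le> B * indicator K' x" for n
    proof (intro AE_I2)
      fix x
      show "norm (q n x) \<le> B * indicator K' x"
      proof (cases "x \<in> K'")
        case True
        have "norm (F (x + h n *\<^sub>R b) - F (x + 0 *\<^sub>R b)) \<le> B * norm (h n - 0)"
        proof (rule differentiable_bound[where f'="\<lambda>r u. u *\<^sub>R F' (x + r *\<^sub>R b)" and S=UNIV])
          fix r :: real
          show "((\<lambda>s. F (x + s *\<^sub>R b)) has_derivative (\<lambda>u. u *\<^sub>R F' (x + r *\<^sub>R b))) (at r within UNIV)"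
            using der[of x r] by (simp add: has_vector_derivative_def)
          show "onorm (\<lambda>u. u *\<^sub>R F' (x + r *\<^sub>R b)) \<le> B"
            by (intro onorm_le) (simp add: mult.commute[of B] mult_left_mono B)
        qed auto
        then show ?thesis using True h(1)[of n] by (simp add: q_def divide_le_eq mult.commute)
      next
        case False
        then show ?thesis using supp[OF False, of "h n"] supp[OF False, of 0] h[of n] by (simp add: q_def)
      qed
    qed
  qed (auto simp: q_def)
  moreover have "(LINT x|lborel. q n x) = 0" for n
  proof -
    have i: "integrable lborel F" by (rule integrable_continuous_compact_support[OF F K F0])
    show ?thesis
      unfolding q_def
      using i lborel_integrable_translate[OF i, of "h n *\<^sub>R b"] lborel_integral_translate[of F "h n *\<^sub>R b"]
      by (simp del: scaleR_right_diff_distrib)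
  qed
  ultimately show ?thesis by (simp add: LIMSEQ_const_iff)
qed

lemma test_function_iter_deriv_continuous:
  "\<phi> \<in> test_functions \<Longrightarrow> continuous_on UNIV (iter_deriv vs \<phi>)"
  by (auto simp: test_functions_def intro: differentiable_imp_continuous_on)

lemma test_function_directional_derivative:
  fixes b :: "'a::euclidean_space"
  assumes "\<phi> \<in> test_functions"
  shows "((\<lambda>s. iter_deriv vs \<phi> (x + s *\<^sub>R b)) has_vector_derivative iter_deriv (b # vs) \<phi> (x + s *\<^sub>R b)) (at s)"
proof -
  have "iter_deriv vs \<phi> differentiable (at (x + s *\<^sub>R b))"
    using assms by (auto simp: test_functions_def differentiable_on_def)
  then have D: "(iter_deriv vs \<phi> has_derivative frechet_derivative (iter_deriv vs \<phi>) (at (x + s *\<^sub>R b))) (at (x + s *\<^sub>R b))"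
    by (simp add: frechet_derivative_works)
  have "((\<lambda>s. x + s *\<^sub>R b) has_derivative (\<lambda>u. u *\<^sub>R b)) (at s)"
    by (auto intro!: derivative_eq_intros)
  from has_derivative_compose[OF this D]
  have "((\<lambda>s. iter_deriv vs \<phi> (x + s *\<^sub>R b)) has_derivative (\<lambda>u. frechet_derivative (iter_deriv vs \<phi>) (at (x + s *\<^sub>R b)) (u *\<^sub>R b))) (at s)"
    by simp
  then show ?thesis
    using linear_cmul[OF has_derivative_linear[OF D]] by (simp add: has_vector_derivative_def)
qed

text \<open>The complement of the closed support is open, so vanishing there is inherited by each
  further derivative.\<close>

lemma test_function_support:
  fixes \<phi> :: "'a::euclidean_space \<Rightarrow> complex"
  assumes "\<phi> \<in> test_functions" "x \<notin> closure {x. \<phi> x \<noteq> 0}"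
  shows "iter_deriv vs \<phi> x = 0"
  using assms(2)
proof (induction vs arbitrary: x)
  case Nil
  have "{x. \<phi> x \<noteq> 0} \<subseteq> closure {x. \<phi> x \<noteq> 0}" by (rule closure_subset)
  with Nil have "x \<notin> {x. \<phi> x \<noteq> 0}" by blast
  then show ?case by simp
next
  case (Cons v vs)
  let ?S = "- closure {x. \<phi> x \<noteq> 0}"
  have "open ?S" by (rule open_Compl[OF closed_closure])
  have "((\<lambda>_. 0) has_derivative (\<lambda>_. 0)) (at x)" by (rule has_derivative_const)
  then have "(iter_deriv vs \<phi> has_derivative (\<lambda>_. 0)) (at x)"
  proof (rule has_derivative_transform_within_open[OF _ \<open>open ?S\<close>])
    show "x \<in> ?S" using Cons.prems by blast
    show "0 = iter_deriv vs \<phi> z" if "z \<in> ?S" for z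
      by (rule Cons.IH[symmetric]) (use that in blast)
  qed
  then have "frechet_derivative (iter_deriv vs \<phi>) (at x) = (\<lambda>_. 0)"
    by (rule frechet_derivative_at[symmetric])
  then show ?case by simp
qed

text \<open>Green's identity, one coordinate at a time:
  \<open>f x * iter_deriv [b, b] \<phi> x - f2 b x * \<phi> x\<close> is the derivative along
  \<open>b\<close> of \<open>f x * iter_deriv [b] \<phi> x - f1 b x * \<phi> x\<close>, which has
  compact support.\<close>

lemma L2_laplacianI:
  fixes f :: "'a::euclidean_space \<Rightarrow> complex" and f1 f2 :: "'a \<Rightarrow> 'a \<Rightarrow> complex"
  assumes L: "f \<in> L2" "g \<in> L2"
    and c: "continuous_on UNIV f" "\<And>b. b \<in> Basis \<Longrightarrow> continuous_on UNIV (f1 b)" "\<And>b. b \<in> Basis \<Longrightarrow> continuous_on UNIV (f2 b)"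
    and d1: "\<And>b x s. b \<in> Basis \<Longrightarrow> ((\<lambda>s. f (x + s *\<^sub>R b)) has_vector_derivative f1 b (x + s *\<^sub>R b)) (at s)"
    and d2: "\<And>b x s. b \<in> Basis \<Longrightarrow> ((\<lambda>s. f1 b (x + s *\<^sub>R b)) has_vector_derivative f2 b (x + s *\<^sub>R b)) (at s)"
    and g: "\<And>x. g x = (\<Sum>b\<in>Basis. f2 b x)"
  shows "(f, g) \<in> L2_laplacian"
proof -
  have "(LINT x|lebesgue. g x * \<phi> x) = (LINT x|lebesgue. f x * laplacian \<phi> x)" if \<phi>: "\<phi> \<in> test_functions" for \<phi>
  proof -
    let ?K = "closure {x. \<phi> x \<noteq> 0}"
    have K: "compact ?K" using \<phi> by (simp add: test_functions_def)
    note cont = test_function_iter_deriv_continuous[OF \<phi>]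
    have cont0: "continuous_on UNIV \<phi>" using cont[of "[]"] by simp
    note supp = test_function_support[OF \<phi>]
    have supp0: "\<phi> x = 0" if "x \<notin> ?K" for x using supp[OF that, of "[]"] by simp
    have i1: "integrable lborel (\<lambda>x. f x * iter_deriv [b, b] \<phi> x)" for b
    proof (rule integrable_continuous_compact_support[OF _ K])
      show "continuous_on UNIV (\<lambda>x. f x * iter_deriv [b, b] \<phi> x)"
        by (intro continuous_on_mult cont c)
      show "f x * iter_deriv [b, b] \<phi> x = 0" if "x \<notin> ?K" for x
        unfolding supp[OF that] by simp
    qed
    have i2: "integrable lborel (\<lambda>x. f2 b x * \<phi> x)" if "b \<in> Basis" for b
    proof (rule integrable_continuous_compact_support[OF _ K])
      show "continuous_on UNIV (\<lambda>x. f2 b x * \<phi> x)"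
        by (intro continuous_on_mult cont0 c that)
      show "f2 b x * \<phi> x = 0" if "x \<notin> ?K" for x
        unfolding supp0[OF that] by simp
    qed
    have Z: "(LINT x|lborel. f x * iter_deriv [b, b] \<phi> x - f2 b x * \<phi> x) = 0" if b: "b \<in> Basis" for b
    proof (rule integral_directional_derivative_eq_0[where F="\<lambda>x. f x * iter_deriv [b] \<phi> x - f1 b x * \<phi> x" and K="?K" and b=b])
      fix x s
      have "((\<lambda>s. f (x + s *\<^sub>R b) * iter_deriv [b] \<phi> (x + s *\<^sub>R b) - f1 b (x + s *\<^sub>R b) * iter_deriv [] \<phi> (x + s *\<^sub>R b))
        has_vector_derivative
        (f (x + s *\<^sub>R b) * iter_deriv [b, b] \<phi> (x + s *\<^sub>R b) + f1 b (x + s *\<^sub>R b) * iter_deriv [b] \<phi> (x + s *\<^sub>R b))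
         - (f1 b (x + s *\<^sub>R b) * iter_deriv [b] \<phi> (x + s *\<^sub>R b) + f2 b (x + s *\<^sub>R b) * iter_deriv [] \<phi> (x + s *\<^sub>R b))) (at s)"
        by (intro has_vector_derivative_diff has_vector_derivative_mult d1 d2 b test_function_directional_derivative \<phi>)
      then show "((\<lambda>s. f (x + s *\<^sub>R b) * iter_deriv [b] \<phi> (x + s *\<^sub>R b) - f1 b (x + s *\<^sub>R b) * \<phi> (x + s *\<^sub>R b))
        has_vector_derivative
        f (x + s *\<^sub>R b) * iter_deriv [b, b] \<phi> (x + s *\<^sub>R b) - f2 b (x + s *\<^sub>R b) * \<phi> (x + s *\<^sub>R b)) (at s)"
        by (simp del: iter_deriv.simps(2))
    next
      show "continuous_on UNIV (\<lambda>x. f x * iter_deriv [b] \<phi> x - f1 b x * \<phi> x)"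
        "continuous_on UNIV (\<lambda>x. f x * iter_deriv [b, b] \<phi> x - f2 b x * \<phi> x)"
        by (intro continuous_on_mult continuous_on_diff cont cont0 c b)+
      show "f x * iter_deriv [b] \<phi> x - f1 b x * \<phi> x = 0"
        "f x * iter_deriv [b, b] \<phi> x - f2 b x * \<phi> x = 0" if "x \<notin> ?K" for x
        unfolding supp[OF that] supp0[OF that] by simp_all
    qed (rule K)
    have eq: "(LINT x|lborel. f x * iter_deriv [b, b] \<phi> x) = (LINT x|lborel. f2 b x * \<phi> x)" if b: "b \<in> Basis" for b
      using Z[OF b] i1[of b] i2[OF b] by (simp del: iter_deriv.simps)
    have cg: "continuous_on UNIV g" unfolding g[abs_def] by (intro continuous_intros c)
    have cl: "continuous_on UNIV (laplacian \<phi>)"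
      unfolding laplacian_def[abs_def] by (intro continuous_intros cont)
    have "(LINT x|lebesgue. g x * \<phi> x) = (LINT x|lborel. g x * \<phi> x)"
      by (intro integral_completion, unfold measurable_lborel2, intro borel_measurable_continuous_onI continuous_on_mult cg cont0)
    also have "\<dots> = (\<Sum>b\<in>Basis. (LINT x|lborel. f2 b x * \<phi> x))"
      using i2 by (simp add: g sum_distrib_right)
    also have "\<dots> = (\<Sum>b\<in>Basis. (LINT x|lborel. f x * iter_deriv [b, b] \<phi> x))"
      by (intro sum.cong refl eq[symmetric])
    also have "\<dots> = (LINT x|lborel. f x * laplacian \<phi> x)"
      using i1 by (simp add: laplacian_def sum_distrib_left del: iter_deriv.simps)
    also have "\<dots> = (LINT x|lebesgue. f x * laplacian \<phi> x)"
      by (intro integral_completion[symmetric], unfold measurable_lborel2, intro borel_measurable_continuous_onI continuous_on_mult cl c)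
    finally show ?thesis .
  qed
  then show ?thesis using L by (auto simp: L2_laplacian_def)
qed

text \<open>
  With \<open>r = x + 2 s \<eta> - y\<close> the exponent is \<open>- B \<bar>r\<bar>\<^sup>2 - i \<langle>\<eta>, x\<rangle> - i s \<bar>\<eta>\<bar>\<^sup>2 + L\<close>, where
  \<open>B = c / (1 + 4 i c \<tau>)\<close>, \<open>L = - (d/2) Ln (1 + 4 i c \<tau>)\<close> and \<open>\<tau> = s - t\<close>: the Gaussian
  \<open>exp (- c \<bar>x - y\<bar>\<^sup>2)\<close> at time \<open>t\<close>, evolved by the free flow after a Galilean boost by \<open>\<eta>\<close>.
  The square \<open>\<bar>r\<bar>\<^sup>2\<close> is expanded to make sense for complex time \<open>z\<close>.
\<close>

definition packet_width :: "real \<Rightarrow> real \<Rightarrow> complex \<Rightarrow> complex" where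
  "packet_width c t z = of_real c / (1 + 4 * \<i> * of_real c * (z - of_real t))"

definition packet_exponent :: "real \<Rightarrow> 'a::euclidean_space \<Rightarrow> 'a \<Rightarrow> real \<Rightarrow> complex \<Rightarrow> 'a \<Rightarrow> complex" where
  "packet_exponent c y \<eta> t z x =
     - packet_width c t z * (of_real ((norm (x - y))\<^sup>2) + 4 * z * of_real (\<eta> \<bullet> (x - y)) + 4 * z\<^sup>2 * of_real ((norm \<eta>)\<^sup>2))
     - \<i> * of_real (\<eta> \<bullet> x) - \<i> * z * of_real ((norm \<eta>)\<^sup>2)
     - of_nat DIM('a) / 2 * Ln (1 + 4 * \<i> * of_real c * (z - of_real t))"

definition packet :: "real \<Rightarrow> 'a::euclidean_space \<Rightarrow> 'a \<Rightarrow> real \<Rightarrow> real \<Rightarrow> 'a \<Rightarrow> complex" where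
  "packet c y \<eta> t s x = exp (packet_exponent c y \<eta> t (of_real s) x)"

abbreviation packet_center :: "'a::euclidean_space \<Rightarrow> 'a \<Rightarrow> real \<Rightarrow> 'a \<Rightarrow> 'a" where
  "packet_center y \<eta> s x \<equiv> x + (2 * s) *\<^sub>R \<eta> - y"

text \<open>The factor by which the Laplacian multiplies the packet. The free equation says that the
  time derivative multiplies it by \<i> times the same factor.\<close>

definition packet_symbol :: "real \<Rightarrow> 'a::euclidean_space \<Rightarrow> 'a \<Rightarrow> real \<Rightarrow> real \<Rightarrow> 'a \<Rightarrow> complex" where
  "packet_symbol c y \<eta> t s x =
     (let B = packet_width c t (of_real s); r = packet_center y \<eta> s x in
      4 * B\<^sup>2 * of_real ((norm r)\<^sup>2) + 4 * \<i> * B * of_real (\<eta> \<bullet> r) - of_real ((norm \<eta>)\<^sup>2) - 2 * of_nat DIM('a) * B)"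

lemma packet_center_norm:
  "(norm (packet_center y \<eta> s x))\<^sup>2 = (norm (x - y))\<^sup>2 + 4 * s * (\<eta> \<bullet> (x - y)) + 4 * s\<^sup>2 * (norm \<eta>)\<^sup>2"
  unfolding power2_norm_eq_inner
  by (simp add: inner_simps inner_commute power2_eq_square algebra_simps)

lemma packet_exponent_real:
  "packet_exponent c y \<eta> t (of_real s) x =
     - packet_width c t (of_real s) * of_real ((norm (packet_center y \<eta> s x))\<^sup>2)
     - \<i> * of_real (\<eta> \<bullet> x) - \<i> * of_real s * of_real ((norm \<eta>)\<^sup>2)
     - of_nat DIM('a) / 2 * Ln (1 + 4 * \<i> * of_real c * (of_real s - of_real t))"
  for x :: "'a::euclidean_space"
  unfolding packet_exponent_def packet_center_norm by simp

lemma packet_base_eq: "1 + 4 * \<i> * of_real c * (of_real s - of_real t) = Complex 1 (4 * c * (s - t))"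
  by (simp add: complex_eq_iff)

text \<open>Computed in complex time, where the rules for field derivatives apply, then restricted
  to real times. The width solves the Riccati equation B' = -4 i B^2, and the logarithm contributes
  -2 i d B, the last term of the symbol times \<i>.\<close>

lemma packet_time_derivative:
  fixes x :: "'a::euclidean_space"
  shows "((\<lambda>s. packet c y \<eta> t s x) has_vector_derivative \<i> * (packet_symbol c y \<eta> t s x * packet c y \<eta> t s x)) (at s)"
proof -
  let ?w = "1 + 4 * \<i> * complex_of_real c * (of_real s - of_real t)"
  let ?B = "packet_width c t (of_real s)"
  \<comment> \<open>Q is omitted\<close>
  let ?Q = "of_real ((norm (x - y))\<^sup>2) + 4 * of_real s * of_real (\<eta> \<bullet> (x - y)) + 4 * (of_real s)\<^sup>2 * of_real ((norm \<eta>)\<^sup>2) :: complex"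
  have w: "Re ?w = 1" by simp
  have w0: "?w \<noteq> 0" using w by (metis zero_complex.simps(1) zero_neq_one)
  have wn: "?w \<notin> \<real>\<^sub>\<le>\<^sub>0" using w by (auto simp: complex_nonpos_Reals_iff)
  have dB: "((\<lambda>z. packet_width c t z) has_field_derivative - (4 * \<i> * ?B\<^sup>2)) (at (of_real s))"
    unfolding packet_width_def using w0
    by (auto intro!: derivative_eq_intros simp: power2_eq_square field_simps)
  have dL: "((\<lambda>z. Ln (1 + 4 * \<i> * of_real c * (z - of_real t))) has_field_derivative 4 * \<i> * ?B) (at (of_real s))"
    unfolding packet_width_def using wn w0
    by (auto intro!: derivative_eq_intros simp: field_simps)
  have "((\<lambda>z. packet_exponent c y \<eta> t z x) has_field_derivative
     - (- (4 * \<i> * ?B\<^sup>2) * ?Q + ?B * (4 * of_real (\<eta> \<bullet> (x - y)) + 8 * of_real s * of_real ((norm \<eta>)\<^sup>2)))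
     - \<i> * of_real ((norm \<eta>)\<^sup>2) - of_nat DIM('a) / 2 * (4 * \<i> * ?B)) (at (of_real s))"
    unfolding packet_exponent_def
    by (rule derivative_eq_intros dB dL refl | simp add: algebra_simps)+
  also have "- (- (4 * \<i> * ?B\<^sup>2) * ?Q + ?B * (4 * of_real (\<eta> \<bullet> (x - y)) + 8 * of_real s * of_real ((norm \<eta>)\<^sup>2)))
     - \<i> * of_real ((norm \<eta>)\<^sup>2) - of_nat DIM('a) / 2 * (4 * \<i> * ?B) = \<i> * packet_symbol c y \<eta> t s x"
  proof -
    have Q: "?Q = of_real ((norm (packet_center y \<eta> s x))\<^sup>2)"
      unfolding packet_center_norm by simp
    have eq: "\<eta> \<bullet> packet_center y \<eta> s x = \<eta> \<bullet> (x - y) + 2 * s * (norm \<eta>)\<^sup>2"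
      unfolding power2_norm_eq_inner by (simp add: inner_simps algebra_simps)
    then show ?thesis
      unfolding Q packet_symbol_def Let_def eq by (simp add: algebra_simps power2_eq_square)
  qed
  finally have "((\<lambda>z. exp (packet_exponent c y \<eta> t z x)) has_field_derivative
     exp (packet_exponent c y \<eta> t (of_real s) x) * (\<i> * packet_symbol c y \<eta> t s x)) (at (of_real s))"
    by (rule DERIV_fun_exp)
  from has_vector_derivative_real_field[OF this] show ?thesis
    by (simp add: packet_def[abs_def] mult_ac)
qed

text \<open>The logarithmic derivative of the packet in direction \<open>b\<close>, affine in
  \<open>x\<close>.\<close>

definition packet_slope :: "real \<Rightarrow> 'a::euclidean_space \<Rightarrow> 'a \<Rightarrow> real \<Rightarrow> real \<Rightarrow> 'a \<Rightarrow> 'a \<Rightarrow> complex" where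
  "packet_slope c y \<eta> t s b x =
     - 2 * packet_width c t (of_real s) * of_real (packet_center y \<eta> s x \<bullet> b) - \<i> * of_real (\<eta> \<bullet> b)"

text \<open>Along the line through \<open>x\<close> the exponent is a quadratic polynomial in the
  parameter, so it extends to complex values and is differentiated there.\<close>

lemma packet_space_derivative:
  fixes x b :: "'a::euclidean_space"
  assumes b: "norm b = 1"
  shows "((\<lambda>u. packet c y \<eta> t s (x + u *\<^sub>R b)) has_vector_derivative
      packet_slope c y \<eta> t s b (x + u *\<^sub>R b) * packet c y \<eta> t s (x + u *\<^sub>R b)) (at u)"
    and "((\<lambda>u. packet_slope c y \<eta> t s b (x + u *\<^sub>R b)) has_vector_derivative - 2 * packet_width c t (of_real s)) (at u)"
proof -
  let ?B = "packet_width c t (of_real s)" and ?r = "packet_center y \<eta> s x"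
  let ?k1 = "\<i> * of_real s * of_real ((norm \<eta>)\<^sup>2)"
    and ?k2 = "of_nat DIM('a) / 2 * Ln (1 + 4 * \<i> * of_real c * (of_real s - of_real t))"
  have bb: "b \<bullet> b = 1" using b by (simp add: power2_norm_eq_inner[symmetric])
  have r: "(norm (packet_center y \<eta> s (x + v *\<^sub>R b)))\<^sup>2 = (norm ?r)\<^sup>2 + 2 * v * (?r \<bullet> b) + v\<^sup>2"
      "packet_center y \<eta> s (x + v *\<^sub>R b) \<bullet> b = ?r \<bullet> b + v" for v
    unfolding power2_norm_eq_inner
    by (simp_all add: inner_simps inner_commute power2_eq_square algebra_simps bb)
  have e: "packet c y \<eta> t s (x + v *\<^sub>R b) = exp (- ?B * (of_real ((norm ?r)\<^sup>2) + 2 * of_real v * of_real (?r \<bullet> b) + (of_real v)\<^sup>2)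
     - \<i> * (of_real (\<eta> \<bullet> x) + of_real v * of_real (\<eta> \<bullet> b)) - ?k1 - ?k2)" for v
    unfolding packet_def packet_exponent_real r by (simp add: inner_simps)
  have sl: "packet_slope c y \<eta> t s b (x + v *\<^sub>R b) = - 2 * ?B * (of_real (?r \<bullet> b) + of_real v) - \<i> * of_real (\<eta> \<bullet> b)" for v
    unfolding packet_slope_def r by simp
  have "((\<lambda>z. exp (- ?B * (of_real ((norm ?r)\<^sup>2) + 2 * z * of_real (?r \<bullet> b) + z\<^sup>2)
     - \<i> * (of_real (\<eta> \<bullet> x) + z * of_real (\<eta> \<bullet> b)) - ?k1 - ?k2)) has_field_derivative
     packet c y \<eta> t s (x + u *\<^sub>R b) * packet_slope c y \<eta> t s b (x + u *\<^sub>R b)) (at (of_real u))"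
    unfolding e sl by (rule derivative_eq_intros refl | simp add: algebra_simps)+
  from has_vector_derivative_real_field[OF this]
  show "((\<lambda>u. packet c y \<eta> t s (x + u *\<^sub>R b)) has_vector_derivative
      packet_slope c y \<eta> t s b (x + u *\<^sub>R b) * packet c y \<eta> t s (x + u *\<^sub>R b)) (at u)"
    unfolding e by (simp add: mult.commute)
  have "((\<lambda>z. - 2 * ?B * (of_real (?r \<bullet> b) + z) - \<i> * of_real (\<eta> \<bullet> b)) has_field_derivative - 2 * ?B) (at (of_real u))"
    by (auto intro!: derivative_eq_intros)
  from has_vector_derivative_real_field[OF this]
  show "((\<lambda>u. packet_slope c y \<eta> t s b (x + u *\<^sub>R b)) has_vector_derivative - 2 * ?B) (at u)"
    unfolding sl .
qed

text \<open>A function with logarithmic derivative \<sigma> has second derivative \<sigma>^2 +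
  \<sigma>' times itself, and here \<sigma>' is minus twice the width in every coordinate
  direction.\<close>

lemma packet_symbol_eq_sum:
  fixes x :: "'a::euclidean_space"
  shows "packet_symbol c y \<eta> t s x = (\<Sum>b\<in>Basis. (packet_slope c y \<eta> t s b x)\<^sup>2 - 2 * packet_width c t (of_real s))"
proof -
  let ?B = "packet_width c t (of_real s)" and ?r = "packet_center y \<eta> s x"
  have "(packet_slope c y \<eta> t s b x)\<^sup>2 = 4 * ?B\<^sup>2 * of_real ((?r \<bullet> b)\<^sup>2) + 4 * \<i> * ?B * of_real ((\<eta> \<bullet> b) * (?r \<bullet> b)) - of_real ((\<eta> \<bullet> b)\<^sup>2)" for b
    unfolding packet_slope_def by (simp add: power2_eq_square algebra_simps)
  then have "(\<Sum>b\<in>Basis. (packet_slope c y \<eta> t s b x)\<^sup>2 - 2 * ?B) =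
     4 * ?B\<^sup>2 * of_real (\<Sum>b\<in>Basis. (?r \<bullet> b)\<^sup>2) + 4 * \<i> * ?B * of_real (\<Sum>b\<in>Basis. (\<eta> \<bullet> b) * (?r \<bullet> b))
     - of_real (\<Sum>b\<in>Basis. (\<eta> \<bullet> b)\<^sup>2) - 2 * of_nat DIM('a) * ?B"
    by (simp only: sum.distrib sum_subtractf sum_distrib_left of_real_sum sum_constant) simp
  then show ?thesis
    unfolding packet_symbol_def Let_def norm_power2_Basis euclidean_inner[of \<eta> ?r] by simp
qed

lemma packet_continuous: "continuous_on UNIV (packet c y \<eta> t s)"
  unfolding packet_def[abs_def] packet_exponent_def by (intro continuous_intros)

lemma packet_slope_continuous: "continuous_on UNIV (packet_slope c y \<eta> t s b)"
  unfolding packet_slope_def[abs_def] by (intro continuous_intros)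

lemma packet_symbol_continuous: "continuous_on UNIV (packet_symbol c y \<eta> t s)"
  unfolding packet_symbol_def[abs_def] Let_def by (intro continuous_intros)

lemma packet_measurable: "packet c y \<eta> t s \<in> borel_measurable borel"
  by (rule borel_measurable_continuous_onI[OF packet_continuous])

lemma packet_symbol_measurable:
  "(\<lambda>x. packet_symbol c y \<eta> t s x * packet c y \<eta> t s x) \<in> borel_measurable borel"
  by (intro borel_measurable_continuous_onI continuous_on_mult packet_continuous packet_symbol_continuous)

text \<open>One Gaussian majorant for all times in a window around \<open>s0\<close>, valid for the
  packet and, up to the factor \<i>, for its time derivative, as
  \<open>L2_has_derivative_dominated\<close> requires.\<close>

lemma packet_bound:
  fixes c t s0 :: real and y \<eta> :: "'a::euclidean_space"
  assumes c: "0 < c"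
  obtains C a where "0 < a" "0 \<le> C"
    "\<And>s x. \<bar>s - s0\<bar> \<le> 1 \<Longrightarrow> cmod (packet c y \<eta> t s x) \<le> C * exp (- a * (norm x)\<^sup>2)"
    "\<And>s x. \<bar>s - s0\<bar> \<le> 1 \<Longrightarrow> cmod (packet_symbol c y \<eta> t s x * packet c y \<eta> t s x) \<le> C * exp (- a * (norm x)\<^sup>2)"
proof -
  \<comment> \<open>On the window \<open>\<beta>\<close> bounds the real part of the width from
    below, \<open>R\<close> bounds the distance from \<open>x\<close> to
    \<open>packet_center y \<eta> s x\<close>, and \<open>A\<close> bounds the symbol by A (1 +
    r^2), where r is the length of that vector. Absorbing 1 + r^2 halves the exponent \<beta>, and
    replacing r by |x| halves it again.\<close>
  define \<beta> where "\<beta> = c / (1 + 16 * c\<^sup>2 * (\<bar>s0 - t\<bar> + 1)\<^sup>2)"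
  define R where "R = norm y + 2 * (\<bar>s0\<bar> + 1) * norm \<eta>"
  define A where "A = 4 * c\<^sup>2 + 4 * c * norm \<eta> + (norm \<eta>)\<^sup>2 + 2 * real DIM('a) * c"
  define C where "C = max 1 A * (1 + 2 / \<beta>) * exp (\<beta> * R\<^sup>2 / 2)"
  let ?n = "\<lambda>s x. norm (packet_center y \<eta> s x)" and ?p = "packet c y \<eta> t" and ?\<sigma> = "packet_symbol c y \<eta> t"
  have \<beta>: "0 < \<beta>" unfolding \<beta>_def using c by (intro divide_pos_pos add_pos_nonneg) auto
  have A0: "0 \<le> A" using c by (simp add: A_def)
  have mod: "cmod (?p s x) \<le> exp (- \<beta> * (?n s x)\<^sup>2)"
    and width: "cmod (packet_width c t (of_real s)) \<le> c"
    if s: "\<bar>s - s0\<bar> \<le> 1" for s x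
  proof -
    let ?w = "1 + 4 * \<i> * complex_of_real c * (of_real s - of_real t)"
    have w: "?w = Complex 1 (4 * c * (s - t))" by (rule packet_base_eq)
    have nw: "1 \<le> cmod ?w" using complex_Re_le_cmod[of ?w] unfolding w by simp
    have "cmod (packet_width c t (of_real s)) = c / cmod ?w"
      using c by (simp add: packet_width_def norm_divide)
    also have "\<dots> \<le> c / 1" using nw c by (intro divide_left_mono) auto
    finally show "cmod (packet_width c t (of_real s)) \<le> c" by simp
    have "Re (packet_width c t (of_real s)) = c / (1 + 16 * c\<^sup>2 * (s - t)\<^sup>2)"
      unfolding packet_width_def w by (simp add: Re_divide power_mult_distrib)
    also have "\<beta> \<le> \<dots>"
      unfolding \<beta>_def
    proof (intro divide_left_mono add_left_mono mult_left_mono)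
      have "\<bar>s - t\<bar> \<le> \<bar>s0 - t\<bar> + 1" using s by linarith
      then have "\<bar>s - t\<bar>\<^sup>2 \<le> (\<bar>s0 - t\<bar> + 1)\<^sup>2" by (intro power_mono) auto
      then show "(s - t)\<^sup>2 \<le> (\<bar>s0 - t\<bar> + 1)\<^sup>2" by simp
    qed (use c in \<open>auto intro!: mult_pos_pos add_pos_nonneg\<close>)
    finally have reB: "\<beta> \<le> Re (packet_width c t (of_real s))" .
    have w0: "?w \<noteq> 0" using nw by auto
    have "Re (of_nat DIM('a) / 2 * Ln ?w) = DIM('a) / 2 * ln (cmod ?w)"
      using w0 by (simp add: Re_Ln)
    also have "0 \<le> \<dots>" using nw by simp
    finally have reL: "0 \<le> Re (of_nat DIM('a) / 2 * Ln ?w)" .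
    have "Re (packet_exponent c y \<eta> t (of_real s) x) =
       - Re (packet_width c t (of_real s)) * (?n s x)\<^sup>2 - Re (of_nat DIM('a) / 2 * Ln ?w)"
      unfolding packet_exponent_real by simp
    also have "\<dots> \<le> - \<beta> * (?n s x)\<^sup>2"
      using reL mult_right_mono[OF reB, of "(?n s x)\<^sup>2"] by simp
    finally show "cmod (?p s x) \<le> exp (- \<beta> * (?n s x)\<^sup>2)"
      unfolding packet_def norm_exp_eq_Re by simp
  qed
  have decay: "(1 + (?n s x)\<^sup>2) * exp (- \<beta> * (?n s x)\<^sup>2)
      \<le> (1 + 2 / \<beta>) * exp (\<beta> * R\<^sup>2 / 2) * exp (- (\<beta> / 4) * (norm x)\<^sup>2)"
    if s: "\<bar>s - s0\<bar> \<le> 1" for s x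
  proof -
    let ?r = "?n s x"
    have "1 \<le> exp (\<beta> * ?r\<^sup>2 / 2)" using \<beta> by simp
    moreover have "\<beta> * ?r\<^sup>2 / 2 \<le> exp (\<beta> * ?r\<^sup>2 / 2)"
      using exp_ge_add_one_self[of "\<beta> * ?r\<^sup>2 / 2"] by linarith
    then have "?r\<^sup>2 \<le> (2 / \<beta>) * exp (\<beta> * ?r\<^sup>2 / 2)"
      using \<beta> by (simp add: field_simps)
    ultimately have "1 + ?r\<^sup>2 \<le> exp (\<beta> * ?r\<^sup>2 / 2) + (2 / \<beta>) * exp (\<beta> * ?r\<^sup>2 / 2)"
      by (rule add_mono)
    also have "\<dots> = (1 + 2 / \<beta>) * exp (\<beta> * ?r\<^sup>2 / 2)"
      by (simp add: distrib_right)
    finally have "(1 + ?r\<^sup>2) * exp (- \<beta> * ?r\<^sup>2) \<le> (1 + 2 / \<beta>) * exp (\<beta> * ?r\<^sup>2 / 2) * exp (- \<beta> * ?r\<^sup>2)"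
      by (rule mult_right_mono) simp
    also have "\<dots> = (1 + 2 / \<beta>) * exp (- (\<beta> * ?r\<^sup>2 / 2))"
      by (simp add: mult.assoc flip: exp_add)
    also have "\<dots> \<le> (1 + 2 / \<beta>) * exp (\<beta> * R\<^sup>2 / 2 + - (\<beta> / 4) * (norm x)\<^sup>2)"
    proof -
      have "norm x = norm (packet_center y \<eta> s x + (y - (2 * s) *\<^sub>R \<eta>))" by simp
      also have "\<dots> \<le> ?r + norm (y - (2 * s) *\<^sub>R \<eta>)" by (rule norm_triangle_ineq)
      also have "norm (y - (2 * s) *\<^sub>R \<eta>) \<le> norm y + norm ((2 * s) *\<^sub>R \<eta>)" by (rule norm_triangle_ineq4)
      also have "\<dots> \<le> R"
      proof -
        have "\<bar>s\<bar> * norm \<eta> \<le> (\<bar>s0\<bar> + 1) * norm \<eta>" using s by (intro mult_right_mono) auto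
        then have "norm y + 2 * (\<bar>s\<bar> * norm \<eta>) \<le> norm y + 2 * ((\<bar>s0\<bar> + 1) * norm \<eta>)" by simp
        also have "\<dots> = R" by (simp add: R_def)
        finally show ?thesis by (simp add: abs_mult)
      qed
      finally have "(norm x)\<^sup>2 \<le> (?r + R)\<^sup>2" by (intro power_mono) auto
      also have "\<dots> \<le> 2 * ?r\<^sup>2 + 2 * R\<^sup>2"
        using sum_squares_bound[of ?r R] by (simp add: power2_sum)
      finally have "\<beta> / 4 * (norm x)\<^sup>2 \<le> \<beta> / 4 * (2 * ?r\<^sup>2 + 2 * R\<^sup>2)"
        using \<beta> by (intro mult_left_mono) auto
      moreover have "- (\<beta> * u / 2) \<le> \<beta> * v / 2 + - (\<beta> / 4) * w"
        if "\<beta> / 4 * w \<le> \<beta> / 4 * (2 * u + 2 * v)" for u v w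
        using that by (simp add: field_simps)
      ultimately have "- (\<beta> * ?r\<^sup>2 / 2) \<le> \<beta> * R\<^sup>2 / 2 + - (\<beta> / 4) * (norm x)\<^sup>2" by blast
      then show ?thesis using \<beta> by (intro mult_left_mono) auto
    qed
    finally show ?thesis unfolding exp_add by (simp add: mult.assoc)
  qed
  have C0: "0 \<le> C" using \<beta> by (simp add: C_def)
  have b1: "cmod (?p s x) \<le> C * exp (- (\<beta> / 4) * (norm x)\<^sup>2)" if s: "\<bar>s - s0\<bar> \<le> 1" for s x
  proof -
    let ?r = "?n s x"
    have "cmod (?p s x) \<le> 1 * exp (- \<beta> * ?r\<^sup>2)" using mod[OF s] by simp
    also have "\<dots> \<le> (1 + ?r\<^sup>2) * exp (- \<beta> * ?r\<^sup>2)" by (intro mult_right_mono) auto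
    also have "\<dots> \<le> 1 * ((1 + 2 / \<beta>) * exp (\<beta> * R\<^sup>2 / 2) * exp (- (\<beta> / 4) * (norm x)\<^sup>2))"
      using decay[OF s] by simp
    also have "\<dots> \<le> max 1 A * ((1 + 2 / \<beta>) * exp (\<beta> * R\<^sup>2 / 2) * exp (- (\<beta> / 4) * (norm x)\<^sup>2))"
      using \<beta> by (intro mult_right_mono) auto
    finally show ?thesis by (simp add: C_def mult.assoc)
  qed
  have b2: "cmod (?\<sigma> s x * ?p s x) \<le> C * exp (- (\<beta> / 4) * (norm x)\<^sup>2)" if s: "\<bar>s - s0\<bar> \<le> 1" for s x
  proof -
    let ?r = "?n s x" and ?B = "packet_width c t (of_real s)"
    note B = width[OF s]
    have "cmod (?\<sigma> s x) \<le> cmod (4 * ?B\<^sup>2 * of_real (?r\<^sup>2)) + cmod (4 * \<i> * ?B * of_real (\<eta> \<bullet> packet_center y \<eta> s x))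
       + cmod (of_real ((norm \<eta>)\<^sup>2) :: complex) + cmod (2 * of_nat DIM('a) * ?B)"
    proof -
      have "cmod (a + b - c - d) \<le> cmod a + cmod b + cmod c + cmod d" for a b c d
        using norm_triangle_ineq4[of "a + b - c" d] norm_triangle_ineq4[of "a + b" c] norm_triangle_ineq[of a b]
        by linarith
      then show ?thesis unfolding packet_symbol_def Let_def .
    qed
    also have "\<dots> = 4 * (cmod ?B)\<^sup>2 * ?r\<^sup>2 + 4 * cmod ?B * \<bar>\<eta> \<bullet> packet_center y \<eta> s x\<bar> + (norm \<eta>)\<^sup>2 + 2 * real DIM('a) * cmod ?B"
      by (simp add: norm_mult norm_power)
    also have "\<dots> \<le> 4 * c\<^sup>2 * (1 + ?r\<^sup>2) + 4 * c * (norm \<eta> * (1 + ?r\<^sup>2)) + (norm \<eta>)\<^sup>2 * (1 + ?r\<^sup>2) + 2 * real DIM('a) * c * (1 + ?r\<^sup>2)"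
    proof (intro add_mono)
      have r1: "?r \<le> 1 + ?r\<^sup>2"
      proof -
        have "2 * ?r \<le> 1 + ?r\<^sup>2" using sum_squares_bound[of 1 ?r] by simp
        moreover have "0 \<le> ?r" by (rule norm_ge_zero)
        ultimately show ?thesis by linarith
      qed
      have "\<bar>\<eta> \<bullet> packet_center y \<eta> s x\<bar> \<le> norm \<eta> * ?r" by (rule Cauchy_Schwarz_ineq2)
      also have "\<dots> \<le> norm \<eta> * (1 + ?r\<^sup>2)" using r1 by (intro mult_left_mono) auto
      finally show "4 * cmod ?B * \<bar>\<eta> \<bullet> packet_center y \<eta> s x\<bar> \<le> 4 * c * (norm \<eta> * (1 + ?r\<^sup>2))"
        using B c by (intro mult_mono) auto
      show "4 * (cmod ?B)\<^sup>2 * ?r\<^sup>2 \<le> 4 * c\<^sup>2 * (1 + ?r\<^sup>2)"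
        using B by (intro mult_mono power_mono) auto
      show "(norm \<eta>)\<^sup>2 \<le> (norm \<eta>)\<^sup>2 * (1 + ?r\<^sup>2)"
        using mult_left_mono[of 1 "1 + ?r\<^sup>2" "(norm \<eta>)\<^sup>2"] by simp
      have "2 * real DIM('a) * cmod ?B * 1 \<le> 2 * real DIM('a) * c * (1 + ?r\<^sup>2)"
        using B c by (intro mult_mono) auto
      then show "2 * real DIM('a) * cmod ?B \<le> 2 * real DIM('a) * c * (1 + ?r\<^sup>2)" by simp
    qed
    also have "\<dots> = A * (1 + ?r\<^sup>2)" by (simp add: A_def algebra_simps)
    finally have "cmod (?\<sigma> s x * ?p s x) \<le> A * (1 + ?r\<^sup>2) * exp (- \<beta> * ?r\<^sup>2)"
      unfolding norm_mult using mod[OF s] A0 by (intro mult_mono) auto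
    also have "\<dots> = A * ((1 + ?r\<^sup>2) * exp (- \<beta> * ?r\<^sup>2))" by simp
    also have "\<dots> \<le> max 1 A * ((1 + 2 / \<beta>) * exp (\<beta> * R\<^sup>2 / 2) * exp (- (\<beta> / 4) * (norm x)\<^sup>2))"
      by (rule mult_mono[OF max.cobounded2 decay[OF s]]) (use \<beta> in auto)
    finally show ?thesis by (simp add: C_def mult.assoc)
  qed
  show thesis by (rule that[OF _ C0 b1 b2]) (use \<beta> in auto)
qed

lemma packet_L2:
  fixes y \<eta> :: "'a::euclidean_space"
  assumes "0 < c"
  shows "packet c y \<eta> t s \<in> L2" "(\<lambda>x. packet_symbol c y \<eta> t s x * packet c y \<eta> t s x) \<in> L2"
proof -
  obtain C a where Ca: "0 < a" "0 \<le> C"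
    "\<And>r x. \<bar>r - s\<bar> \<le> 1 \<Longrightarrow> cmod (packet c y \<eta> t r x) \<le> C * exp (- a * (norm x)\<^sup>2)"
    "\<And>r x. \<bar>r - s\<bar> \<le> 1 \<Longrightarrow> cmod (packet_symbol c y \<eta> t r x * packet c y \<eta> t r x) \<le> C * exp (- a * (norm x)\<^sup>2)"
    by (rule packet_bound[OF assms, of s y \<eta> t]; rule that; assumption)
  have "(C * exp (- a * (norm x)\<^sup>2))\<^sup>2 = C\<^sup>2 * exp (- (2 * a) * (norm x)\<^sup>2)" for x :: 'a
    by (simp add: power_mult_distrib exp_double[symmetric] mult.assoc)
  then have G: "integrable lborel (\<lambda>x::'a. (C * exp (- a * (norm x)\<^sup>2))\<^sup>2)"
    using integrable_exp_norm_power2[where 'a='a and a="2 * a"] Ca(1) by simp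
  show "packet c y \<eta> t s \<in> L2"
  proof (rule L2I_dominated[OF _ G])
    show "cmod (packet c y \<eta> t s x) \<le> C * exp (- a * (norm x)\<^sup>2)" for x by (rule Ca(3)) simp
  qed (rule packet_measurable)
  show "(\<lambda>x. packet_symbol c y \<eta> t s x * packet c y \<eta> t s x) \<in> L2"
  proof (rule L2I_dominated[OF _ G])
    show "cmod (packet_symbol c y \<eta> t s x * packet c y \<eta> t s x) \<le> C * exp (- a * (norm x)\<^sup>2)" for x
      by (rule Ca(4)) simp
  qed (rule packet_symbol_measurable)
qed

lemma packet_laplacian:
  fixes y \<eta> :: "'a::euclidean_space"
  assumes "0 < c"
  shows "(packet c y \<eta> t s, \<lambda>x. packet_symbol c y \<eta> t s x * packet c y \<eta> t s x) \<in> L2_laplacian"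
proof (rule L2_laplacianI[where ?f1.0="\<lambda>b x. packet_slope c y \<eta> t s b x * packet c y \<eta> t s x"
      and ?f2.0="\<lambda>b x. ((packet_slope c y \<eta> t s b x)\<^sup>2 - 2 * packet_width c t (of_real s)) * packet c y \<eta> t s x"])
  fix b x :: 'a and u assume "b \<in> Basis"
  then have b: "norm b = 1" by simp
  note d = packet_space_derivative[OF b, where u=u and x=x and c=c and y=y and \<eta>=\<eta> and t=t and s=s]
  show "((\<lambda>u. packet c y \<eta> t s (x + u *\<^sub>R b)) has_vector_derivative
      packet_slope c y \<eta> t s b (x + u *\<^sub>R b) * packet c y \<eta> t s (x + u *\<^sub>R b)) (at u)" by (rule d(1))
  show "((\<lambda>u. packet_slope c y \<eta> t s b (x + u *\<^sub>R b) * packet c y \<eta> t s (x + u *\<^sub>R b)) has_vector_derivative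
      ((packet_slope c y \<eta> t s b (x + u *\<^sub>R b))\<^sup>2 - 2 * packet_width c t (of_real s)) * packet c y \<eta> t s (x + u *\<^sub>R b)) (at u)"
    by (rule has_vector_derivative_eq_rhs[OF has_vector_derivative_mult[OF d(2,1)]])
       (simp add: algebra_simps power2_eq_square)
next
  show "packet_symbol c y \<eta> t s x * packet c y \<eta> t s x =
    (\<Sum>b\<in>Basis. ((packet_slope c y \<eta> t s b x)\<^sup>2 - 2 * packet_width c t (of_real s)) * packet c y \<eta> t s x)" for x
    by (simp add: packet_symbol_eq_sum sum_distrib_right)
next
  show "continuous_on UNIV (\<lambda>x. packet_slope c y \<eta> t s b x * packet c y \<eta> t s x)"
    "continuous_on UNIV (\<lambda>x. ((packet_slope c y \<eta> t s b x)\<^sup>2 - 2 * packet_width c t (of_real s)) * packet c y \<eta> t s x)" for b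
    by (intro continuous_on_mult continuous_on_diff continuous_on_power continuous_on_const
        packet_continuous packet_slope_continuous)+
next
  show "packet c y \<eta> t s \<in> L2" by (rule packet_L2[OF assms])
next
  show "(\<lambda>x. packet_symbol c y \<eta> t s x * packet c y \<eta> t s x) \<in> L2" by (rule packet_L2[OF assms])
next
  show "continuous_on UNIV (packet c y \<eta> t s)" by (rule packet_continuous)
qed



text \<open>The packet parameter \<open>t\<close> is the time at which the width is real, so the
  flow is run to the very moment when the packet is a plain Gaussian times a plane wave.\<close>

lemma packet_evolution:
  fixes y \<eta> :: "'a::euclidean_space"
  assumes "schroedinger_group U" "0 < c"
  shows "AE x in lebesgue. U t (packet c y \<eta> t 0) x = packet c y \<eta> t t x"
proof (rule schroedinger_evolution_unique[OF assms(1), where \<psi>="packet c y \<eta> t" and \<zeta>="\<lambda>s x. packet_symbol c y \<eta> t s x * packet c y \<eta> t s x"])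
  fix s
  show "(packet c y \<eta> t s, \<lambda>x. packet_symbol c y \<eta> t s x * packet c y \<eta> t s x) \<in> L2_laplacian"
    by (rule packet_laplacian[OF assms(2)])
  obtain C a where Ca: "0 < a" "0 \<le> C"
    "\<And>r x. \<bar>r - s\<bar> \<le> 1 \<Longrightarrow> cmod (packet c y \<eta> t r x) \<le> C * exp (- a * (norm x)\<^sup>2)"
    "\<And>r x. \<bar>r - s\<bar> \<le> 1 \<Longrightarrow> cmod (packet_symbol c y \<eta> t r x * packet c y \<eta> t r x) \<le> C * exp (- a * (norm x)\<^sup>2)"
    by (rule packet_bound[OF assms(2), of s y \<eta> t]; rule that; assumption)
  have "(C * exp (- a * (norm x)\<^sup>2))\<^sup>2 = C\<^sup>2 * exp (- (2 * a) * (norm x)\<^sup>2)" for x :: 'a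
    by (simp add: power_mult_distrib exp_double[symmetric] mult.assoc)
  then have G: "integrable lborel (\<lambda>x::'a. (C * exp (- a * (norm x)\<^sup>2))\<^sup>2)"
    using integrable_exp_norm_power2[where 'a='a and a="2 * a"] Ca(1) by simp
  show "((\<lambda>h. L2norm (\<lambda>x. (packet c y \<eta> t (s + h) x - packet c y \<eta> t s x) / of_real h - \<i> * (packet_symbol c y \<eta> t s x * packet c y \<eta> t s x))) \<longlongrightarrow> 0) (at 0)"
  proof (rule L2_has_derivative_dominated[OF _ _ packet_time_derivative _ G])
    show "cmod (\<i> * (packet_symbol c y \<eta> t r x * packet c y \<eta> t r x)) \<le> C * exp (- a * (norm x)\<^sup>2)"
      if "\<bar>r - s\<bar> \<le> 1" for r x
      using Ca(4)[OF that, of x] by (simp add: norm_mult)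
  next
    show "(\<lambda>x. \<i> * (packet_symbol c y \<eta> t r x * packet c y \<eta> t r x)) \<in> borel_measurable borel" for r
      by (intro borel_measurable_times borel_measurable_const packet_symbol_measurable)
  qed (rule packet_measurable)
qed

section \<open>Conjugated Gaussian multipliers\<close>

lemma lborel_integral_affine:
  fixes f :: "'a::euclidean_space \<Rightarrow> 'b::{banach,second_countable_topology}"
  assumes [measurable]: "f \<in> borel_measurable borel" and c: "c \<noteq> 0"
  shows "(LINT x|lborel. f x) = (\<bar>c\<bar> ^ DIM('a)) *\<^sub>R (LINT x|lborel. f (t + c *\<^sub>R x))"
  by (subst lborel_affine[OF c, of t]) (simp add: integral_density integral_distr)

text \<open>Fubini and translations are applied on \<open>lborel\<close>, whereas elements of
  \<open>L2\<close> are only Lebesgue measurable.\<close>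

lemma borel_representative:
  fixes f :: "'a::euclidean_space \<Rightarrow> complex"
  assumes "f \<in> borel_measurable lebesgue"
  obtains f' where "f' \<in> borel_measurable borel" "AE x in lebesgue. f x = f' x"
proof -
  have "(\<lambda>x. Re (f x)) \<in> borel_measurable lebesgue" "(\<lambda>x. Im (f x)) \<in> borel_measurable lebesgue"
    using assms by measurable
  from this[THEN completion_ex_borel_measurable_real] obtain r i where
    [measurable]: "r \<in> borel_measurable borel" "i \<in> borel_measurable borel"
    and ae: "AE x in lborel. Re (f x) = r x" "AE x in lborel. Im (f x) = i x"
    by auto
  have "AE x in lborel. f x = Complex (r x) (i x)"
    using ae by eventually_elim (simp add: complex_eq_iff)
  moreover have "(\<lambda>x. Complex (r x) (i x)) \<in> borel_measurable borel"
    unfolding Complex_eq by measurable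
  ultimately show thesis by (intro that AE_completion)
qed

text \<open>Completing the square; it turns a product of two Gaussians into a multiple of a single
  one.\<close>

lemma Gaussian_combine:
  fixes x y :: "'a::real_inner" and a b :: real
  assumes "a + b \<noteq> 0"
  shows "a * (norm x)\<^sup>2 + b * (norm (x - y))\<^sup>2 =
     (a + b) * (norm (x - (b / (a + b)) *\<^sub>R y))\<^sup>2 + a * b / (a + b) * (norm y)\<^sup>2"
proof -
  define s where "s = b / (a + b)"
  have ts: "(a + b) * s = b" using assms by (simp add: s_def)
  have "(a + b) * (norm (x - s *\<^sub>R y))\<^sup>2 = (a + b) * (x \<bullet> x) - 2 * ((a + b) * s) * (x \<bullet> y) + ((a + b) * s) * s * (y \<bullet> y)"
    unfolding power2_norm_eq_inner by (simp add: inner_simps inner_commute algebra_simps)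
  moreover have "b * s * (y \<bullet> y) + a * s * (y \<bullet> y) = b * (y \<bullet> y)"
    using arg_cong[OF ts, of "\<lambda>u. u * (y \<bullet> y)"] by (simp add: algebra_simps)
  moreover have "a * b / (a + b) = a * s" by (simp add: s_def)
  moreover have "a * s * (x \<bullet> y) + b * s * (x \<bullet> y) = b * (x \<bullet> y)"
    using arg_cong[OF ts, of "\<lambda>u. u * (x \<bullet> y)"] by (simp add: algebra_simps)
  ultimately show ?thesis
    unfolding ts s_def[symmetric] power2_norm_eq_inner by (simp add: inner_simps inner_commute algebra_simps)
qed

section \<open>Functions are determined by their pairings with Gaussians\<close>

lemma integral_gauss_translate_tendsto:
  fixes B :: "'a::euclidean_space \<Rightarrow> complex"
  assumes [measurable]: "B \<in> borel_measurable borel" and bnd: "\<And>v. cmod (B v) \<le> K" and cont: "isCont B 0"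
  shows "(\<lambda>n. LINT \<eta>|lborel. of_real (gauss \<eta>) * B ((1 / real (Suc n)) *\<^sub>R \<eta>)) \<longlonglongrightarrow> B 0"
proof -
  have "(\<lambda>n. LINT \<eta>|lborel. of_real (gauss \<eta>) * B ((1 / real (Suc n)) *\<^sub>R \<eta>)) \<longlonglongrightarrow> (LINT \<eta>::'a|lborel. of_real (gauss \<eta>) * B 0)"
  proof (rule integral_dominated_convergence)
    show "integrable lborel (\<lambda>\<eta>::'a. K * gauss \<eta>)" by simp
    show "AE \<eta> in lborel. (\<lambda>n. of_real (gauss \<eta>) * B ((1 / real (Suc n)) *\<^sub>R \<eta>)) \<longlonglongrightarrow> of_real (gauss \<eta>) * B 0"
    proof (intro AE_I2)
      fix \<eta> :: 'a
      have "(\<lambda>n. 1 / real (Suc n)) \<longlonglongrightarrow> 0" by (rule lim_inverse_n'[THEN LIMSEQ_Suc])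
      then have "(\<lambda>n. (1 / real (Suc n)) *\<^sub>R \<eta>) \<longlonglongrightarrow> 0 *\<^sub>R \<eta>" by (intro tendsto_intros)
      then have "(\<lambda>n. B ((1 / real (Suc n)) *\<^sub>R \<eta>)) \<longlonglongrightarrow> B 0"
        by (intro isCont_tendsto_compose[OF cont]) simp
      then show "(\<lambda>n. of_real (gauss \<eta>) * B ((1 / real (Suc n)) *\<^sub>R \<eta>)) \<longlonglongrightarrow> of_real (gauss \<eta>) * B 0"
        by (intro tendsto_intros)
    qed
    show "AE \<eta>::'a in lborel. norm (of_real (gauss \<eta>) * B ((1 / real (Suc n)) *\<^sub>R \<eta>)) \<le> K * gauss \<eta>" for n
      by (intro AE_I2) (simp add: norm_mult mult.commute[of K] mult_left_mono bnd)
  qed measurable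
  also have "(LINT \<eta>::'a|lborel. complex_of_real (gauss \<eta>) * B 0) = B 0"
    by (simp add: gauss_integral)
  finally show ?thesis .
qed

text \<open>\<open>k\<close> need not be continuous, so the approximate identity is applied to its
  correlation \<open>B\<close> with \<phi>, which is continuous at 0. By Fubini the Gaussian
  averages of \<open>B\<close> around 0 vanish along with those of \<open>k\<close>, hence
  \<open>B 0 = 0\<close>.\<close>

lemma gaussians_separate_continuous:
  fixes k :: "'a::euclidean_space \<Rightarrow> complex" and \<phi> :: "'a \<Rightarrow> real"
  assumes k: "integrable lborel k"
    and zero: "\<And>l z. 0 < l \<Longrightarrow> (LINT \<eta>|lborel. of_real (gauss \<eta>) * k (z + l *\<^sub>R \<eta>)) = 0"
    and \<phi>: "continuous_on UNIV \<phi>" "\<And>x. \<bar>\<phi> x\<bar> \<le> 1"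
  shows "(LINT x|lborel. k x * of_real (\<phi> x)) = 0"
proof -
  have [measurable]: "k \<in> borel_measurable borel" using borel_measurable_integrable[OF k] by simp
  have [measurable]: "\<phi> \<in> borel_measurable borel" using \<phi>(1) by (rule borel_measurable_continuous_onI)
  have phi1: "cmod (k x * of_real (\<phi> z)) \<le> cmod (k x)" for x z
    using \<phi>(2)[of z] by (simp add: norm_mult mult_left_le)
  have ik: "integrable lborel (\<lambda>z. k (z + v) * of_real (\<phi> z))" for v
    by (rule Bochner_Integration.integrable_bound[OF lborel_integrable_translate[OF k, of v]]) (auto simp: phi1)
  define B where "B v = (LINT z|lborel. k (z + v) * of_real (\<phi> z))" for v
  have [measurable]: "B \<in> borel_measurable borel" unfolding B_def by measurable
  have Beq: "B v = (LINT x|lborel. k x * of_real (\<phi> (x - v)))" for v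
    using lborel_integral_translate[of "\<lambda>x. k x * of_real (\<phi> (x - v))" v] by (simp add: B_def)
  have Bb: "cmod (B v) \<le> (LINT x|lborel. cmod (k x))" for v
  proof -
    have "cmod (B v) \<le> (LINT x|lborel. cmod (k x * of_real (\<phi> (x - v))))"
      unfolding Beq by (rule integral_norm_bound)
    also have "\<dots> \<le> (LINT x|lborel. cmod (k x))"
    proof (rule integral_mono)
      show "integrable lborel (\<lambda>x. cmod (k x * of_real (\<phi> (x - v))))"
        by (rule Bochner_Integration.integrable_bound[OF k]) (auto simp: phi1 simp del: norm_mult)
    qed (use k phi1 in auto)
    finally show ?thesis .
  qed
  have cont: "isCont B 0"
    unfolding isCont_def tendsto_at_iff_sequentially comp_def Beq
  proof (intro allI impI)
    fix X :: "nat \<Rightarrow> 'a" assume X: "X \<longlonglongrightarrow> 0"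
    show "(\<lambda>i. LINT x|lborel. k x * of_real (\<phi> (x - X i))) \<longlonglongrightarrow> (LINT x|lborel. k x * of_real (\<phi> (x - 0)))"
    proof (rule integral_dominated_convergence)
      show "integrable lborel (\<lambda>x. cmod (k x))" using k by simp
      show "AE x in lborel. (\<lambda>i. k x * of_real (\<phi> (x - X i))) \<longlonglongrightarrow> k x * of_real (\<phi> (x - 0))"
      proof (intro AE_I2 tendsto_intros)
        fix x
        have "isCont \<phi> (x - 0)" using \<phi>(1) by (simp add: continuous_on_eq_continuous_at)
        moreover have "(\<lambda>i. x - X i) \<longlonglongrightarrow> x - 0" using X by (intro tendsto_intros)
        ultimately show "(\<lambda>i. \<phi> (x - X i)) \<longlonglongrightarrow> \<phi> (x - 0)" by (rule isCont_tendsto_compose)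
      qed
    qed (auto simp: phi1 simp del: norm_mult)
  qed
  have J: "(LINT \<eta>|lborel. of_real (gauss \<eta>) * B (l *\<^sub>R \<eta>)) = 0" if l: "0 < l" for l
  proof -
    let ?f = "\<lambda>(\<eta>, z). of_real (gauss \<eta>) * (k (z + l *\<^sub>R \<eta>) * of_real (\<phi> z))"
    have int: "integrable (lborel \<Otimes>\<^sub>M lborel) ?f"
    proof (rule lborel_pair.Fubini_integrable)
      show "integrable lborel (\<lambda>\<eta>::'a. LINT z|lborel. norm (?f (\<eta>, z)))"
      proof (rule Bochner_Integration.integrable_bound)
        show "integrable lborel (\<lambda>\<eta>::'a. gauss \<eta> * (LINT x|lborel. cmod (k x)))" by simp
        show "AE \<eta>::'a in lborel. norm (LINT z|lborel. norm (?f (\<eta>, z))) \<le> norm (gauss \<eta> * (LINT x|lborel. cmod (k x)))"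
        proof (intro AE_I2)
          fix \<eta> :: 'a
          have "(LINT z|lborel. norm (?f (\<eta>, z))) = gauss \<eta> * (LINT z|lborel. cmod (k (z + l *\<^sub>R \<eta>) * of_real (\<phi> z)))"
            by (simp add: norm_mult)
          also have "\<dots> \<le> gauss \<eta> * (LINT z|lborel. cmod (k (z + l *\<^sub>R \<eta>)))"
            using ik[of "l *\<^sub>R \<eta>"] lborel_integrable_translate[OF k, of "l *\<^sub>R \<eta>"]
            by (intro mult_left_mono integral_mono phi1) auto
          also have "(LINT z|lborel. cmod (k (z + l *\<^sub>R \<eta>))) = (LINT x|lborel. cmod (k x))"
            by (rule lborel_integral_translate) measurable
          finally show "norm (LINT z|lborel. norm (?f (\<eta>, z))) \<le> norm (gauss \<eta> * (LINT x|lborel. cmod (k x)))"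
            by (simp add: integral_nonneg_AE)
        qed
      qed measurable
      show "AE \<eta>::'a in lborel. integrable lborel (\<lambda>z. ?f (\<eta>, z))"
        using ik by simp
    qed measurable
    have "(LINT \<eta>|lborel. of_real (gauss \<eta>) * B (l *\<^sub>R \<eta>)) = (LINT \<eta>|lborel. (LINT z|lborel. of_real (gauss \<eta>) * (k (z + l *\<^sub>R \<eta>) * of_real (\<phi> z))))"
      by (simp add: B_def)
    also have "\<dots> = (LINT z|lborel. (LINT \<eta>|lborel. of_real (gauss \<eta>) * (k (z + l *\<^sub>R \<eta>) * of_real (\<phi> z))))"
      by (rule lborel_pair.Fubini_integral[symmetric, OF int])
    also have "\<dots> = (LINT z|lborel. (LINT \<eta>|lborel. of_real (gauss \<eta>) * k (z + l *\<^sub>R \<eta>)) * of_real (\<phi> z))"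
      by (simp add: mult.assoc[symmetric] del: of_real_mult)
    also have "\<dots> = 0" by (simp add: zero[OF l])
    finally show ?thesis .
  qed
  have "B 0 = 0"
    using integral_gauss_translate_tendsto[of B, OF _ Bb cont] by (simp add: J LIMSEQ_const_iff)
  then show ?thesis by (simp add: B_def)
qed

text \<open>The continuous functions max 0 (1 - n infdist x C) decrease to the indicator of a
  nonempty closed set C, so \<open>k\<close> integrates to 0 over closed sets. These are stable
  under intersection and generate the Borel sets, and Dynkin's argument concludes.\<close>

lemma AE_zero_if_integral_continuous_zero:
  fixes k :: "'a::euclidean_space \<Rightarrow> complex"
  assumes k: "integrable lborel k"
    and zero: "\<And>\<phi>::'a \<Rightarrow> real. continuous_on UNIV \<phi> \<Longrightarrow> (\<And>x. \<bar>\<phi> x\<bar> \<le> 1) \<Longrightarrow> (LINT x|lborel. k x * of_real (\<phi> x)) = 0"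
  shows "AE x in lborel. k x = 0"
proof (rule sigma_finite_measure.density_zero[OF sigma_finite_lborel k])
  have [measurable]: "k \<in> borel_measurable borel" using borel_measurable_integrable[OF k] by simp
  have si: "set_integrable lborel A k" if "A \<in> sets borel" for A
    unfolding set_integrable_def using that k by (intro integrable_mult_indicator) auto
  have closed: "set_lebesgue_integral lborel C k = 0" if C: "closed C" for C
  proof (cases "C = {}")
    case False
    define \<phi> where "\<phi> n x = max 0 (1 - real n * infdist x C)" for n x
    have bnd: "\<bar>\<phi> n x\<bar> \<le> 1" for n x by (auto simp: \<phi>_def infdist_nonneg)
    have c: "continuous_on UNIV (\<phi> n)" for n
      unfolding \<phi>_def[abs_def] by (intro continuous_intros)
    have [measurable]: "\<phi> n \<in> borel_measurable borel" for n by (rule borel_measurable_continuous_onI[OF c])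
    have [measurable]: "C \<in> sets borel" using C by simp
    have "(\<lambda>n. LINT x|lborel. k x * of_real (\<phi> n x)) \<longlonglongrightarrow> (LINT x|lborel. indicat_real C x *\<^sub>R k x)"
    proof (rule integral_dominated_convergence)
      show "integrable lborel (\<lambda>x. cmod (k x))" using k by simp
      show "AE x in lborel. (\<lambda>n. k x * of_real (\<phi> n x)) \<longlonglongrightarrow> indicat_real C x *\<^sub>R k x"
      proof (intro AE_I2)
        fix x
        have "(\<lambda>n. \<phi> n x) \<longlonglongrightarrow> indicat_real C x"
        proof (cases "x \<in> C")
          case True
          then show ?thesis by (simp add: \<phi>_def)
        next
          case F: False
          then have d: "0 < infdist x C"
            using C False infdist_pos_not_in_closed by blast
          obtain N where N: "1 / infdist x C < real N" using reals_Archimedean2 by blast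
          have "\<phi> n x = 0" if "N \<le> n" for n
          proof -
            have "1 / infdist x C \<le> real n" using N that by linarith
            then show ?thesis using d by (simp add: \<phi>_def field_simps)
          qed
          then have "\<forall>\<^sub>F n in sequentially. \<phi> n x = 0" by (auto simp: eventually_sequentially)
          then show ?thesis using F by (simp add: tendsto_eventually)
        qed
        then have "(\<lambda>n. k x * of_real (\<phi> n x)) \<longlonglongrightarrow> k x * of_real (indicat_real C x)"
          by (intro tendsto_intros)
        then show "(\<lambda>n. k x * of_real (\<phi> n x)) \<longlonglongrightarrow> indicat_real C x *\<^sub>R k x"
          by (simp add: scaleR_conv_of_real mult.commute)
      qed
      show "AE x in lborel. norm (k x * of_real (\<phi> n x)) \<le> cmod (k x)" for n
        using bnd by (auto simp: norm_mult mult_left_le)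
    qed measurable
    then show ?thesis
      using zero[OF c bnd] by (simp add: set_lebesgue_integral_def LIMSEQ_const_iff)
  qed (simp add: set_lebesgue_integral_def)
  show "set_lebesgue_integral lborel A k = 0" if "A \<in> sets lborel" for A
  proof -
    have "Int_stable (Collect closed :: 'a set set)" by (auto simp: Int_stable_def)
    moreover have "(Collect closed :: 'a set set) \<subseteq> Pow UNIV" by simp
    moreover have "A \<in> sigma_sets UNIV (Collect closed)"
      using that by (simp add: borel_eq_closed)
    ultimately show ?thesis
    proof (induction rule: sigma_sets_induct_disjoint)
      case (basic A)
      then show ?case using closed by simp
    next
      case empty
      then show ?case by (simp add: set_lebesgue_integral_def)
    next
      case (compl A)
      then have A: "A \<in> sets borel" by (simp add: borel_eq_closed)
      have "set_lebesgue_integral lborel (A \<union> (UNIV - A)) k = set_lebesgue_integral lborel A k + set_lebesgue_integral lborel (UNIV - A) k"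
        using A by (intro set_integral_Un si) auto
      then show ?case using compl closed[OF closed_UNIV] by simp
    next
      case (union A)
      then have A: "A i \<in> sets borel" for i by (auto simp: borel_eq_closed)
      have "set_lebesgue_integral lborel (\<Union>i. A i) k = (\<Sum>i. set_lebesgue_integral lborel (A i) k)"
        using A union(1) by (intro lebesgue_integral_countable_add si) (auto simp: disjoint_family_on_def)
      then show ?case using union by simp
    qed
  qed
qed

text \<open>Only the Gaussian pairings of \<open>h\<close> are known to exist, so \<open>h\<close>
  is first damped by exp (-|x|^2) to become integrable. Gaussian averages of the damped function are
  again Gaussian pairings of \<open>h\<close>, by completing the square.\<close>

lemma gaussians_separate:
  fixes h :: "'a::euclidean_space \<Rightarrow> complex"
  assumes h [measurable]: "h \<in> borel_measurable borel"
    and int: "\<And>c y. 0 < c \<Longrightarrow> integrable lborel (\<lambda>x. h x * of_real (exp (- c * (norm (x - y))\<^sup>2)))"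
    and zero: "\<And>c y. 0 < c \<Longrightarrow> (LINT x|lborel. h x * of_real (exp (- c * (norm (x - y))\<^sup>2))) = 0"
  shows "AE x in lborel. h x = 0"
proof -
  define k where "k x = h x * of_real (exp (- (norm x)\<^sup>2))" for x
  have [measurable]: "k \<in> borel_measurable borel" unfolding k_def by measurable
  have ik: "integrable lborel k" using int[of 1 0] by (simp add: k_def[abs_def])
  have z: "(LINT \<eta>|lborel. of_real (gauss \<eta>) * k (z + l *\<^sub>R \<eta>)) = 0" if l: "0 < l" for l z
  proof -
    \<comment> \<open>The exponent of \<open>gauss\<close> rescaled by \<open>l\<close>, to be
      combined with the exponent 1 of the damping factor.\<close>
    define b where "b = 1 / (2 * l\<^sup>2)"
    have b: "0 < b" using l by (simp add: b_def)
    let ?K = "(1 / sqrt (2 * pi)) ^ DIM('a)" and ?y = "(b / (1 + b)) *\<^sub>R z"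
    let ?D = "?K * exp (- (b / (1 + b) * (norm z)\<^sup>2))"
    let ?f = "\<lambda>x. of_real (gauss ((1 / l) *\<^sub>R (x - z))) * k x"
    have f: "?f x = of_real ?D * (h x * of_real (exp (- (1 + b) * (norm (x - ?y))\<^sup>2)))" for x
    proof -
      have "(norm x)\<^sup>2 + b * (norm (x - z))\<^sup>2 = (1 + b) * (norm (x - ?y))\<^sup>2 + b / (1 + b) * (norm z)\<^sup>2"
        using Gaussian_combine[of 1 b x z] b by simp
      moreover have "(norm ((1 / l) *\<^sub>R (x - z)))\<^sup>2 / 2 = b * (norm (x - z))\<^sup>2"
        using l by (simp add: b_def power_divide)
      ultimately have "exp (- (norm ((1 / l) *\<^sub>R (x - z)))\<^sup>2 / 2) * exp (- (norm x)\<^sup>2) = exp (- (b / (1 + b) * (norm z)\<^sup>2)) * exp (- (1 + b) * (norm (x - ?y))\<^sup>2)"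
        unfolding exp_add[symmetric] by (simp add: algebra_simps)
      then have "gauss ((1 / l) *\<^sub>R (x - z)) * exp (- (norm x)\<^sup>2) = ?D * exp (- (1 + b) * (norm (x - ?y))\<^sup>2)"
        unfolding gauss_eq by (simp only: mult.assoc)
      then have "complex_of_real (gauss ((1 / l) *\<^sub>R (x - z)) * exp (- (norm x)\<^sup>2)) = of_real (?D * exp (- (1 + b) * (norm (x - ?y))\<^sup>2))"
        by (rule arg_cong)
      then show ?thesis unfolding k_def of_real_mult by (simp only: mult_ac)
    qed
    have "(LINT x|lborel. ?f x) = 0"
      unfolding f using zero[of "1 + b" ?y] b by simp
    moreover have "(LINT x|lborel. ?f x) = (\<bar>l\<bar> ^ DIM('a)) *\<^sub>R (LINT \<eta>|lborel. ?f (z + l *\<^sub>R \<eta>))"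
      using l by (intro lborel_integral_affine) auto
    ultimately show ?thesis using l by simp
  qed
  have "AE x in lborel. k x = 0"
    by (rule AE_zero_if_integral_continuous_zero[OF ik gaussians_separate_continuous[OF ik z]])
  then show ?thesis by (simp add: k_def)
qed

lemma borel_measurable_lebesgueI:
  "f \<in> borel_measurable borel \<Longrightarrow> f \<in> borel_measurable lebesgue"
  by (rule measurable_completion) simp

text \<open>Conjugated with the free flow over time \<open>t\<close>, multiplication by exp (i
  \<kappa> <\<eta>, x>) becomes translation by 2 t \<kappa> \<eta> followed by modulation; this is
  the Gaussian superposition of these operators.\<close>

definition boosted_average :: "real \<Rightarrow> real \<Rightarrow> ('a::euclidean_space \<Rightarrow> complex) \<Rightarrow> 'a \<Rightarrow> complex" where
  "boosted_average \<kappa> t f z = (LINT \<eta>|lborel. of_real (gauss \<eta>) *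
     (exp (\<i> * of_real (\<kappa> * (\<eta> \<bullet> z) - t * \<kappa>\<^sup>2 * (norm \<eta>)\<^sup>2)) * f (z - (2 * t * \<kappa>) *\<^sub>R \<eta>)))"

lemma boosted_average_measurable [measurable]:
  assumes [measurable]: "f \<in> borel_measurable borel"
  shows "boosted_average \<kappa> t f \<in> borel_measurable borel"
  unfolding boosted_average_def by measurable

lemma cmod_boosted_average_le:
  assumes [measurable]: "f \<in> borel_measurable borel"
  shows "ennreal (cmod (boosted_average \<kappa> t f z)) \<le>
     (\<integral>\<^sup>+ \<eta>. ennreal (gauss \<eta> * cmod (f (z - (2 * t * \<kappa>) *\<^sub>R \<eta>))) \<partial>lborel)"
proof (cases "integrable lborel (\<lambda>\<eta>. of_real (gauss \<eta>) *
     (exp (\<i> * of_real (\<kappa> * (\<eta> \<bullet> z) - t * \<kappa>\<^sup>2 * (norm \<eta>)\<^sup>2)) * f (z - (2 * t * \<kappa>) *\<^sub>R \<eta>)))")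
  case True
  from integral_norm_bound_ennreal[OF this] show ?thesis
    by (simp add: boosted_average_def norm_mult)
next
  \<comment> \<open>A Bochner integral that does not exist has the value 0, so the bound is
    trivial.\<close>
  case False
  then show ?thesis by (simp add: boosted_average_def not_integrable_integral_eq)
qed

text \<open>At time \<open>t\<close> the width equals \<open>c\<close> and the logarithm is that of
  1. For \<zeta> = 0 these are exactly the Gaussians of \<open>gaussians_separate\<close>.\<close>

lemma packet_final: "packet c y \<zeta> t t x =
    of_real (exp (- c * (norm (packet_center y \<zeta> t x))\<^sup>2)) * exp (- \<i> * of_real (\<zeta> \<bullet> x + t * (norm \<zeta>)\<^sup>2))"
  unfolding packet_def packet_exponent_real packet_width_def exp_of_real[symmetric] exp_add[symmetric]
  by (rule arg_cong[where f=exp]) (simp add: algebra_simps)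

lemma packet_initial: "packet c y \<zeta> t 0 x = exp (- \<i> * of_real (\<zeta> \<bullet> x)) * packet c y 0 t 0 x"
  unfolding packet_def packet_exponent_real exp_add[symmetric]
  by (rule arg_cong[where f=exp]) (simp add: algebra_simps)

lemma multiplier_L2:
  fixes f :: "'a::euclidean_space \<Rightarrow> complex"
  assumes "f \<in> L2"
  shows "(\<lambda>x. complex_of_real (exp (- \<kappa>\<^sup>2 * (norm x)\<^sup>2 / 2)) * f x) \<in> L2"
proof (rule L2_bdd_mult[OF assms, where B=1])
  have "(\<lambda>x::'a. complex_of_real (exp (- \<kappa>\<^sup>2 * (norm x)\<^sup>2 / 2))) \<in> borel_measurable lborel" by measurable
  then show "(\<lambda>x::'a. complex_of_real (exp (- \<kappa>\<^sup>2 * (norm x)\<^sup>2 / 2))) \<in> borel_measurable lebesgue"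
    by (rule measurable_completion)
qed auto

context
  fixes U :: "real \<Rightarrow> ('a::euclidean_space \<Rightarrow> complex) \<Rightarrow> 'a \<Rightarrow> complex"
  assumes S: "schroedinger_group U"
begin

lemma schroedinger_unitary: "unitary_group U"
  using S by (simp add: schroedinger_group_def)

text \<open>
  Superposing the plane waves \<open>exp (i \<kappa> \<langle>\<eta>, x\<rangle>)\<close> with Gaussian weights gives the multiplier; conjugated
  with the flow each of them becomes a modulated translation, which is checked on the packets.
\<close>

lemma conjugated_multiplier_pairing:
  fixes f :: "'a \<Rightarrow> complex"
  assumes f [measurable]: "f \<in> borel_measurable borel" and fL: "f \<in> L2" and c: "0 < c"
  shows "ip (U t (\<lambda>x. complex_of_real (exp (- \<kappa>\<^sup>2 * (norm x)\<^sup>2 / 2)) * U (- t) f x)) (packet c y 0 t t)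
     = (LINT \<eta>|lborel. of_real (gauss \<eta>) * ip f (packet c y (\<kappa> *\<^sub>R \<eta>) t t))"
proof -
  note U = schroedinger_unitary
  note UL = unitary_group_L2[OF U]
  let ?G = "\<lambda>x::'a. complex_of_real (exp (- \<kappa>\<^sup>2 * (norm x)\<^sup>2 / 2))"
  have uL: "U (- t) f \<in> L2" by (rule UL[OF fL])
  note pL = packet_L2(1)[OF c]
  obtain u where u [measurable]: "u \<in> borel_measurable borel" and uu: "AE x in lebesgue. U (- t) f x = u x"
    using borel_representative[OF L2_measurable[OF uL]] by blast
  have um: "u \<in> borel_measurable lebesgue"
    by (rule borel_measurable_lebesgueI[OF u])
  have u2: "u \<in> L2" by (rule L2_cong_AE[OF uL um uu])
  let ?e = "\<lambda>\<eta> x. complex_of_real (gauss \<eta>) * exp (\<i> * of_real (\<eta> \<bullet> (\<kappa> *\<^sub>R x)))" and ?q = "\<lambda>x. u x * cnj (packet c y 0 t 0 x)"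
  have GuL: "(\<lambda>x. ?G x * u x) \<in> L2" "(\<lambda>x. ?G x * U (- t) f x) \<in> L2"
    by (intro multiplier_L2 u2 uL)+
  have backward: "AE x in lebesgue. U (- t) (packet c y 0 t t) x = packet c y 0 t 0 x"
  proof -
    have "AE x in lebesgue. U (- t) (U t (packet c y 0 t 0)) x = U (- t) (packet c y 0 t t) x"
      by (intro unitary_group_cong_AE[OF U] UL pL packet_evolution[OF S c])
    with unitary_group_inverse(1)[OF U pL[of y 0 t 0], of t] show ?thesis
      by eventually_elim simp
  qed
  \<comment> \<open>The pairing is pulled back to time 0, where the Gaussian is a multiplier and its
    plane waves can be attached to the packet.\<close>
  have "ip (U t (\<lambda>x. ?G x * U (- t) f x)) (packet c y 0 t t) = ip (\<lambda>x. ?G x * U (- t) f x) (U (- t) (packet c y 0 t t))"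
    by (rule unitary_group_adjoint[OF U GuL(2) pL])
  also have "\<dots> = ip (\<lambda>x. ?G x * u x) (packet c y 0 t 0)"
    by (rule ip_cong_AE) (use uu backward GuL pL UL[OF pL] in \<open>auto intro!: L2_measurable\<close>)
  also have "\<dots> = (LINT x|lborel. ?G x * ?q x)"
    unfolding ip_def by (subst integral_completion) (auto simp: mult.assoc intro!: borel_measurable_times borel_measurable_cnj packet_measurable u)
  also have "\<dots> = (LINT x|lborel. (LINT \<eta>|lborel. ?e \<eta> x * ?q x))"
  proof (rule Bochner_Integration.integral_cong[OF refl])
    fix x :: 'a
    have "?G x = (LINT \<eta>|lborel. ?e \<eta> x)"
      unfolding gauss_fourier by (simp add: power_mult_distrib)
    then show "?G x * ?q x = (LINT \<eta>|lborel. ?e \<eta> x * ?q x)"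
      by (simp only: integral_mult_left_zero)
  qed
  also have "\<dots> = (LINT \<eta>|lborel. (LINT x|lborel. ?e \<eta> x * ?q x))"
  proof (rule lborel_pair.Fubini_integral)
    have [measurable]: "?q \<in> borel_measurable borel"
      by (intro borel_measurable_times borel_measurable_cnj packet_measurable u)
    have iup: "integrable lborel ?q"
      using L2_integrable_mult_cnj[OF u2 pL[of y 0 t 0]] by (subst (asm) integrable_completion) auto
    show "integrable (lborel \<Otimes>\<^sub>M lborel) (\<lambda>(\<eta>, x). ?e \<eta> x * ?q x)"
    proof (rule lborel_pair.Fubini_integrable)
      have "(\<lambda>z. complex_of_real (gauss (fst z)) * exp (\<i> * of_real (fst z \<bullet> (\<kappa> *\<^sub>R snd z))) * ?q (snd z))
        \<in> borel_measurable (borel \<Otimes>\<^sub>M borel)" by measurable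
      then show "(\<lambda>(\<eta>, x). ?e \<eta> x * ?q x)
        \<in> borel_measurable (lborel \<Otimes>\<^sub>M lborel)" by (simp add: case_prod_unfold)
      show "integrable lborel (\<lambda>\<eta>::'a. LINT x|lborel. norm (case (\<eta>, x) of (\<eta>, x) \<Rightarrow>
         ?e \<eta> x * ?q x))"
        by (simp add: norm_mult)
      show "AE \<eta>::'a in lborel. integrable lborel (\<lambda>x. case (\<eta>, x) of (\<eta>, x) \<Rightarrow>
         ?e \<eta> x * ?q x)"
      proof (intro AE_I2)
        fix \<eta> :: 'a
        have "(\<lambda>x. ?e \<eta> x * ?q x) \<in> borel_measurable borel"
          by measurable
        then show "integrable lborel (\<lambda>x. case (\<eta>, x) of (\<eta>, x) \<Rightarrow>
         ?e \<eta> x * ?q x)"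
          by (intro Bochner_Integration.integrable_bound[OF integrable_mult_right[OF iup, of "complex_of_real (gauss \<eta>)"]])
             (auto simp: norm_mult)
      qed
    qed
  qed
  also have "\<dots> = (LINT \<eta>|lborel. of_real (gauss \<eta>) * ip f (packet c y (\<kappa> *\<^sub>R \<eta>) t t))"
  proof (rule Bochner_Integration.integral_cong[OF refl])
    fix \<eta> :: 'a
    \<comment> \<open>Under the conjugation in the pairing the plane wave is the initial phase of
      the packet boosted by \<kappa> \<eta>, whose state at time \<open>t\<close> is again
      explicit.\<close>
    have "(LINT x|lborel. ?e \<eta> x * ?q x) =
      (LINT x|lborel. of_real (gauss \<eta>) * (u x * cnj (packet c y (\<kappa> *\<^sub>R \<eta>) t 0 x)))"
      by (subst packet_initial[of c y "\<kappa> *\<^sub>R \<eta>"]) (simp add: exp_cnj mult_ac)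
    also have "\<dots> = of_real (gauss \<eta>) * (LINT x|lborel. u x * cnj (packet c y (\<kappa> *\<^sub>R \<eta>) t 0 x))"
      by (rule integral_mult_right_zero)
    also have "(LINT x|lborel. u x * cnj (packet c y (\<kappa> *\<^sub>R \<eta>) t 0 x)) = ip u (packet c y (\<kappa> *\<^sub>R \<eta>) t 0)"
      unfolding ip_def by (subst integral_completion) (auto intro!: borel_measurable_times borel_measurable_cnj packet_measurable u)
    also have "\<dots> = ip (U t u) (U t (packet c y (\<kappa> *\<^sub>R \<eta>) t 0))"
      by (rule unitary_group_ip[OF U u2 pL, symmetric])
    also have "\<dots> = ip f (packet c y (\<kappa> *\<^sub>R \<eta>) t t)"
    proof (rule ip_cong_AE)
      have "AE x in lebesgue. U t (U (- t) f) x = U t u x"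
        by (rule unitary_group_cong_AE[OF U uL u2 uu])
      with unitary_group_inverse(2)[OF U fL, of t] show "AE x in lebesgue. U t u x = f x"
        by eventually_elim simp
      show "AE x in lebesgue. U t (packet c y (\<kappa> *\<^sub>R \<eta>) t 0) x = packet c y (\<kappa> *\<^sub>R \<eta>) t t x"
        by (rule packet_evolution[OF S c])
    qed (use fL u2 pL UL[OF pL] UL[OF u2] in \<open>auto intro!: L2_measurable\<close>)
    finally show "(LINT x|lborel. ?e \<eta> x * ?q x) =
      of_real (gauss \<eta>) * ip f (packet c y (\<kappa> *\<^sub>R \<eta>) t t)" .
  qed
  finally show ?thesis .
qed

end

text \<open>Fubini. Integrability on the product follows because the inner integral is bounded by
  the two squared norms uniformly in the translation, and the weight in \<eta> is
  integrable.\<close>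

lemma boosted_average_pairing:
  fixes f g :: "'a::euclidean_space \<Rightarrow> complex"
  assumes f [measurable]: "f \<in> borel_measurable borel" and fL: "f \<in> L2"
    and g [measurable]: "g \<in> borel_measurable borel" and gL: "g \<in> L2"
  shows "integrable lborel (\<lambda>z. boosted_average \<kappa> t f z * g z)"
    and "(LINT z|lborel. boosted_average \<kappa> t f z * g z) =
      (LINT \<eta>|lborel. of_real (gauss \<eta>) * (LINT z|lborel. exp (\<i> * of_real (\<kappa> * (\<eta> \<bullet> z) - t * \<kappa>\<^sup>2 * (norm \<eta>)\<^sup>2)) * f (z - (2 * t * \<kappa>) *\<^sub>R \<eta>) * g z))"
proof -
  let ?F = "\<lambda>\<eta> z. complex_of_real (gauss \<eta>) * (exp (\<i> * of_real (\<kappa> * (\<eta> \<bullet> z) - t * \<kappa>\<^sup>2 * (norm \<eta>)\<^sup>2)) * f (z - (2 * t * \<kappa>) *\<^sub>R \<eta>) * g z)"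
  have sq: "integrable lborel (\<lambda>x. (cmod (f x))\<^sup>2)" "integrable lborel (\<lambda>x. (cmod (g x))\<^sup>2)"
    using L2_integrable[OF fL] L2_integrable[OF gL] by (auto simp: integrable_completion)
  let ?M = "(LINT x|lborel. (cmod (f x))\<^sup>2) + (LINT x|lborel. (cmod (g x))\<^sup>2)"
  have sqt: "integrable lborel (\<lambda>z. (cmod (f (z - v)))\<^sup>2)" "(LINT z|lborel. (cmod (f (z - v)))\<^sup>2) = (LINT x|lborel. (cmod (f x))\<^sup>2)" for v
    using lborel_integrable_translate[OF sq(1), of "- v"] lborel_integral_translate[of "\<lambda>x. (cmod (f x))\<^sup>2" "- v"] by simp_all
  have pw: "cmod a * cmod b \<le> (cmod a)\<^sup>2 + (cmod b)\<^sup>2" for a b :: complex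
  proof -
    have "2 * (cmod a * cmod b) \<le> (cmod a)\<^sup>2 + (cmod b)\<^sup>2"
      using sum_squares_bound[of "cmod a" "cmod b"] by simp
    moreover have "0 \<le> cmod a * cmod b" by simp
    ultimately show ?thesis by linarith
  qed
  have i1: "integrable lborel (\<lambda>z. f (z - v) * g z)" for v
    by (rule Bochner_Integration.integrable_bound[OF Bochner_Integration.integrable_add[OF sqt(1)[of v] sq(2)]])
       (auto simp: norm_mult intro!: AE_I2 pw)
  have b1: "(LINT z|lborel. cmod (f (z - v)) * cmod (g z)) \<le> ?M" for v
  proof -
    have "(LINT z|lborel. cmod (f (z - v)) * cmod (g z)) \<le> (LINT z|lborel. (cmod (f (z - v)))\<^sup>2 + (cmod (g z))\<^sup>2)"
      using integrable_norm[OF i1[of v]] sqt(1)[of v] sq(2)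
      by (intro integral_mono pw) (auto simp: norm_mult)
    then show ?thesis using sqt[of v] sq(2) by simp
  qed
  have int: "integrable (lborel \<Otimes>\<^sub>M lborel) (\<lambda>(\<eta>, z). ?F \<eta> z)"
  proof (rule lborel_pair.Fubini_integrable)
    show "integrable lborel (\<lambda>\<eta>::'a. LINT z|lborel. norm (case (\<eta>, z) of (\<eta>, z) \<Rightarrow> ?F \<eta> z))"
    proof (rule Bochner_Integration.integrable_bound)
      show "integrable lborel (\<lambda>\<eta>::'a. gauss \<eta> * ?M)" by simp
      show "AE \<eta>::'a in lborel. norm (LINT z|lborel. norm (case (\<eta>, z) of (\<eta>, z) \<Rightarrow> ?F \<eta> z)) \<le> norm (gauss \<eta> * ?M)"
      proof (intro AE_I2)
        fix \<eta> :: 'a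
        have "(LINT z|lborel. norm (?F \<eta> z)) = gauss \<eta> * (LINT z|lborel. cmod (f (z - (2 * t * \<kappa>) *\<^sub>R \<eta>)) * cmod (g z))"
          by (simp add: norm_mult)
        also have "\<dots> \<le> gauss \<eta> * ?M" by (intro mult_left_mono b1) simp
        finally show "norm (LINT z|lborel. norm (case (\<eta>, z) of (\<eta>, z) \<Rightarrow> ?F \<eta> z)) \<le> norm (gauss \<eta> * ?M)"
          by (simp add: integral_nonneg_AE)
      qed
    qed measurable
    show "AE \<eta>::'a in lborel. integrable lborel (\<lambda>z. case (\<eta>, z) of (\<eta>, z) \<Rightarrow> ?F \<eta> z)"
    proof (intro AE_I2)
      fix \<eta> :: 'a
      show "integrable lborel (\<lambda>z. case (\<eta>, z) of (\<eta>, z) \<Rightarrow> ?F \<eta> z)"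
        by (rule Bochner_Integration.integrable_bound[OF integrable_mult_right[OF i1[of "(2 * t * \<kappa>) *\<^sub>R \<eta>"], of "complex_of_real (gauss \<eta>)"]])
           (auto simp: norm_mult)
    qed
  qed measurable
  have eq: "(LINT \<eta>|lborel. ?F \<eta> z) = boosted_average \<kappa> t f z * g z" for z
    unfolding boosted_average_def by (simp add: mult.assoc[symmetric])
  show "integrable lborel (\<lambda>z. boosted_average \<kappa> t f z * g z)"
    using lborel_pair.integrable_snd[OF int] by (simp only: eq)
  show "(LINT z|lborel. boosted_average \<kappa> t f z * g z) =
      (LINT \<eta>|lborel. of_real (gauss \<eta>) * (LINT z|lborel. exp (\<i> * of_real (\<kappa> * (\<eta> \<bullet> z) - t * \<kappa>\<^sup>2 * (norm \<eta>)\<^sup>2)) * f (z - (2 * t * \<kappa>) *\<^sub>R \<eta>) * g z))"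
    using lborel_pair.Fubini_integral[OF int] by (simp only: eq integral_mult_right_zero)
qed

text \<open>Both sides have the same pairing with every Gaussian exp (-c |x - y|^2). The average is
  not known in advance to lie in \<open>L2\<close>, which is why \<open>gaussians_separate\<close>
  asks only that these pairings exist.\<close>

lemma conjugated_multiplier_eq_boosted_average:
  fixes f :: "'a::euclidean_space \<Rightarrow> complex"
  assumes S: "schroedinger_group U" and f [measurable]: "f \<in> borel_measurable borel" and fL: "f \<in> L2"
  shows "AE z in lebesgue. U t (\<lambda>x. complex_of_real (exp (- \<kappa>\<^sup>2 * (norm x)\<^sup>2 / 2)) * U (- t) f x) z = boosted_average \<kappa> t f z"
proof -
  note U = schroedinger_unitary[OF S]
  let ?T = "U t (\<lambda>x. complex_of_real (exp (- \<kappa>\<^sup>2 * (norm x)\<^sup>2 / 2)) * U (- t) f x)"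
  have TL: "?T \<in> L2" by (intro unitary_group_L2[OF U] multiplier_L2 fL)
  obtain T where T [measurable]: "T \<in> borel_measurable borel" and TT: "AE x in lebesgue. ?T x = T x"
    using borel_representative[OF L2_measurable[OF TL]] by blast
  have Tm: "T \<in> borel_measurable lebesgue"
    by (rule borel_measurable_lebesgueI[OF T])
  have T2: "T \<in> L2" by (rule L2_cong_AE[OF TL Tm TT])
  have "AE z in lborel. T z - boosted_average \<kappa> t f z = 0"
  proof (rule gaussians_separate)
    fix c :: real and y :: 'a assume c: "0 < c"
    let ?g = "\<lambda>x. complex_of_real (exp (- c * (norm (x - y))\<^sup>2))"
    have gp: "packet c y 0 t t = ?g"
      by (rule ext) (simp add: packet_final)
    have g [measurable]: "?g \<in> borel_measurable borel" by measurable
    have gL: "?g \<in> L2" using packet_L2(1)[OF c, of y 0 t t] unfolding gp .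
    have iT: "integrable lborel (\<lambda>x. T x * ?g x)"
      using L2_integrable_mult_cnj[OF T2 gL] by (simp add: integrable_completion)
    note iQ = boosted_average_pairing[OF f fL g gL, of \<kappa> t]
    show "integrable lborel (\<lambda>x. (T x - boosted_average \<kappa> t f x) * ?g x)"
      using iT iQ(1) by (simp add: left_diff_distrib)
    have "(LINT x|lborel. T x * ?g x) = ip T ?g"
      unfolding ip_def by (subst integral_completion) auto
    also have "\<dots> = ip ?T ?g"
      by (rule ip_cong_AE) (use TT T2 TL gL in \<open>auto intro!: L2_measurable simp: eq_commute\<close>)
    also have "\<dots> = (LINT \<eta>|lborel. of_real (gauss \<eta>) * ip f (packet c y (\<kappa> *\<^sub>R \<eta>) t t))"
      unfolding gp[symmetric] by (rule conjugated_multiplier_pairing[OF S f fL c])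
    also have "\<dots> = (LINT z|lborel. boosted_average \<kappa> t f z * ?g z)"
      unfolding iQ(2)
    proof (rule Bochner_Integration.integral_cong[OF refl], rule arg_cong[where f="\<lambda>w. _ * w"])
      fix \<eta> :: 'a
      let ?v = "(2 * t * \<kappa>) *\<^sub>R \<eta>"
      let ?h = "\<lambda>z. exp (\<i> * of_real (\<kappa> * (\<eta> \<bullet> z) - t * \<kappa>\<^sup>2 * (norm \<eta>)\<^sup>2)) * f (z - ?v) * ?g z"
      have "ip f (packet c y (\<kappa> *\<^sub>R \<eta>) t t) = (LINT x|lborel. f x * cnj (packet c y (\<kappa> *\<^sub>R \<eta>) t t x))"
        unfolding ip_def by (subst integral_completion) (auto intro!: borel_measurable_times borel_measurable_cnj packet_measurable f)
      also have "\<dots> = (LINT x|lborel. ?h (x + ?v))"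
      proof (rule Bochner_Integration.integral_cong[OF refl])
        fix x :: 'a
        have "cnj (packet c y (\<kappa> *\<^sub>R \<eta>) t t x) = ?g (x + ?v) * exp (\<i> * of_real (\<kappa> * (\<eta> \<bullet> x) + t * \<kappa>\<^sup>2 * (norm \<eta>)\<^sup>2))"
          unfolding packet_final by (simp add: exp_cnj power_mult_distrib mult_ac)
        \<comment> \<open>Shifting by \<open>?v\<close> adds 2 t \<kappa>^2 |\<eta>|^2 to the linear
          phase, which reverses the sign of the quadratic correction.\<close>
        moreover have "\<kappa> * (\<eta> \<bullet> (x + ?v)) - t * \<kappa>\<^sup>2 * (norm \<eta>)\<^sup>2 = \<kappa> * (\<eta> \<bullet> x) + t * \<kappa>\<^sup>2 * (norm \<eta>)\<^sup>2"
          unfolding power2_norm_eq_inner by (simp add: inner_simps power2_eq_square algebra_simps)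
        ultimately show "f x * cnj (packet c y (\<kappa> *\<^sub>R \<eta>) t t x) = ?h (x + ?v)"
          by (simp only: add_diff_cancel_right' mult_ac)
      qed
      also have "\<dots> = (LINT z|lborel. ?h z)"
        by (rule lborel_integral_translate) measurable
      finally show "ip f (packet c y (\<kappa> *\<^sub>R \<eta>) t t) = (LINT z|lborel. ?h z)" .
    qed
    finally show "(LINT x|lborel. (T x - boosted_average \<kappa> t f x) * ?g x) = 0"
      using iT iQ(1) by (simp add: left_diff_distrib)
  qed measurable
  then have "AE z in lebesgue. T z - boosted_average \<kappa> t f z = 0" by (rule AE_completion)
  with TT show ?thesis by eventually_elim simp
qed

section \<open>Observability at two times\<close>

text \<open>Far out, |x| \<ge> (1 + |x|)/2 converts the decay rate; on the remaining ball \<rho> is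
  bounded by continuity. The weight in 1 + |x| has no singularity at the origin, so one bound holds
  everywhere.\<close>

lemma bigo_powr_bound:
  fixes \<rho> :: "'a::euclidean_space \<Rightarrow> real"
  assumes \<beta>: "0 < \<beta>" and cont: "continuous_on UNIV \<rho>" and pos: "\<And>x. 0 < \<rho> x"
    and O: "\<rho> \<in> O[at_infinity](\<lambda>x. norm x powr (- \<beta>))"
  obtains K where "0 < K" "\<And>x. \<rho> x \<le> K * (1 + norm x) powr (- \<beta>)"
proof -
  obtain c where c: "0 < c" "\<forall>\<^sub>F x in at_infinity. norm (\<rho> x) \<le> c * norm (norm x powr (- \<beta>))"
    using landau_o.bigE[OF O] by blast
  then obtain b where b: "\<And>x. b \<le> norm x \<Longrightarrow> norm (\<rho> x) \<le> c * norm (norm x powr (- \<beta>))"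
    by (auto simp: eventually_at_infinity)
  define b' where "b' = max b 1"
  have "bounded (\<rho> ` cball 0 b')"
    by (intro compact_imp_bounded compact_continuous_image continuous_on_subset[OF cont]) auto
  then obtain m where "\<And>v. v \<in> \<rho> ` cball 0 b' \<Longrightarrow> norm v \<le> m"
    unfolding bounded_iff by blast
  then have m: "norm (\<rho> x) \<le> m" if "norm x \<le> b'" for x using that by auto
  define K where "K = c * 2 powr \<beta> + \<bar>m\<bar> * (1 + b') powr \<beta>"
  have K: "c * 2 powr \<beta> \<le> K" "\<bar>m\<bar> * (1 + b') powr \<beta> \<le> K" "0 < K"
    using c(1) by (auto simp: K_def intro!: add_pos_nonneg)
  have "\<rho> x \<le> K * (1 + norm x) powr (- \<beta>)" for x
  proof (cases "b' \<le> norm x")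
    case True
    then have x1: "1 \<le> norm x" "b \<le> norm x" by (auto simp: b'_def)
    have "\<rho> x \<le> c * norm x powr (- \<beta>)" using b[OF x1(2)] by simp
    also have "\<dots> \<le> c * ((1 + norm x) / 2) powr (- \<beta>)"
      using x1(1) \<beta> c(1) by (intro mult_left_mono powr_mono2') auto
    also have "\<dots> = c * 2 powr \<beta> * (1 + norm x) powr (- \<beta>)"
      using x1(1) by (simp add: powr_divide powr_minus divide_simps)
    also have "\<dots> \<le> K * (1 + norm x) powr (- \<beta>)" by (intro mult_right_mono K) auto
    finally show ?thesis .
  next
    case False
    have p: "0 < 1 + norm x" by (rule add_pos_nonneg) auto
    have "\<rho> x \<le> \<bar>m\<bar> * 1" using m[of x] False by simp
    also have "\<dots> \<le> \<bar>m\<bar> * ((1 + b') powr \<beta> * (1 + norm x) powr (- \<beta>))"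
    proof (rule mult_left_mono)
      have "(1 + norm x) powr \<beta> \<le> (1 + b') powr \<beta>"
        using False p \<beta> by (intro powr_mono2) auto
      then have "(1 + norm x) powr \<beta> * (1 + norm x) powr (- \<beta>) \<le> (1 + b') powr \<beta> * (1 + norm x) powr (- \<beta>)"
        by (rule mult_right_mono) simp
      then show "1 \<le> (1 + b') powr \<beta> * (1 + norm x) powr (- \<beta>)"
        using p by (simp add: powr_add[symmetric])
    qed simp
    also have "\<dots> = \<bar>m\<bar> * (1 + b') powr \<beta> * (1 + norm x) powr (- \<beta>)" by simp
    also have "\<dots> \<le> K * (1 + norm x) powr (- \<beta>)" by (intro mult_right_mono K) auto
    finally show ?thesis .
  qed
  then show thesis using that K(3) by blast
qed

text \<open>A Lebesgue set has a Borel subset that differs from it by a null set. This subset is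
  equally thick, and integrals of squares over it are no larger than over \<open>Q\<close>, so
  observing on it suffices.\<close>

lemma thick_complement_thin:
  fixes Q :: "'a::euclidean_space set"
  assumes Q: "Q \<in> sets lebesgue" and thick: "thick \<gamma> \<rho> Q" and \<gamma>: "0 \<le> \<gamma>" "\<gamma> \<le> 1" and pos: "\<And>x. 0 < \<rho> x"
  obtains Q' where "Q' \<in> sets borel" "Q' \<subseteq> Q"
    "\<And>z. emeasure lborel (- Q' \<inter> ball z (\<rho> z)) \<le> ennreal (1 - \<gamma>) * emeasure lborel (ball z (\<rho> z))"
proof -
  obtain A N N' where A: "Q = A \<union> N" "N \<subseteq> N'" "N' \<in> null_sets lborel" "A \<in> sets lborel"
    using sets_completionE[OF Q] by metis
  have [measurable]: "A \<in> sets borel" "N' \<in> sets borel" using A by auto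
  have "emeasure lborel (- A \<inter> ball z (\<rho> z)) \<le> ennreal (1 - \<gamma>) * emeasure lborel (ball z (\<rho> z))" for z
  proof -
    let ?B = "ball z (\<rho> z)"
    have fin: "emeasure lborel X < \<infinity>" if "X \<subseteq> ?B" for X
      using emeasure_mono[OF that, of lborel] emeasure_lborel_ball_finite[of z "\<rho> z"] by auto
    have e1: "emeasure lborel X = ennreal (measure lborel X)" if "X \<subseteq> ?B" for X
      using fin[OF that] by (intro emeasure_eq_ennreal_measure) auto
    have "measure lebesgue (Q \<inter> ?B) \<le> measure lborel (A \<inter> ?B)"
    proof -
      have "emeasure lebesgue (Q \<inter> ?B) \<le> emeasure lebesgue ((A \<inter> ?B) \<union> N')"
        using A by (intro emeasure_mono) auto
      also have "\<dots> = emeasure lborel ((A \<inter> ?B) \<union> N')" by (subst emeasure_completion) auto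
      also have "\<dots> = emeasure lborel (A \<inter> ?B)" using A(3) by (intro emeasure_Un_null_set) auto
      finally have "emeasure lebesgue (Q \<inter> ?B) \<le> emeasure lborel (A \<inter> ?B)" .
      then show ?thesis
        unfolding measure_def using fin[of "A \<inter> ?B"] by (intro enn2real_mono) auto
    qed
    moreover have "\<gamma> * measure lebesgue ?B \<le> measure lebesgue (Q \<inter> ?B)"
      using thick by (simp add: thick_def)
    moreover have "measure lebesgue ?B = measure lborel ?B" by (simp add: measure_completion)
    ultimately have le: "\<gamma> * measure lborel ?B \<le> measure lborel (A \<inter> ?B)" by simp
    have "measure lborel ?B = measure lborel (A \<inter> ?B) + measure lborel (- A \<inter> ?B)"
    proof -
      have "?B = (A \<inter> ?B) \<union> (- A \<inter> ?B)" by blast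
      then have "measure lborel ?B = measure lborel ((A \<inter> ?B) \<union> (- A \<inter> ?B))" by simp
      also have "\<dots> = measure lborel (A \<inter> ?B) + measure lborel (- A \<inter> ?B)"
        using fin[of "A \<inter> ?B"] fin[of "- A \<inter> ?B"] by (intro measure_Union) auto
      finally show ?thesis .
    qed
    with le have "measure lborel (- A \<inter> ?B) \<le> (1 - \<gamma>) * measure lborel ?B"
      by (simp add: left_diff_distrib)
    then have "ennreal (measure lborel (- A \<inter> ?B)) \<le> ennreal ((1 - \<gamma>) * measure lborel ?B)"
      by (rule ennreal_leI)
    then show ?thesis using \<gamma> by (simp add: e1 ennreal_mult')
  qed
  then show thesis using that[of A] A by auto
qed

lemma cmod_ip_average_le:
  fixes f Q T :: "'a::euclidean_space \<Rightarrow> complex"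
  assumes f [measurable]: "f \<in> borel_measurable borel" and fL: "f \<in> L2" and TL: "T \<in> L2"
    and Q [measurable]: "Q \<in> borel_measurable borel" and TQ: "AE x in lebesgue. T x = Q x"
  shows "ennreal (cmod (ip f T)) \<le> (\<integral>\<^sup>+ x. ennreal (cmod (f x)) * ennreal (cmod (Q x)) \<partial>lborel)"
proof -
  have "ennreal (cmod (ip f T)) \<le> (\<integral>\<^sup>+ x. ennreal (cmod (f x * cnj (T x))) \<partial>lebesgue)"
    unfolding ip_def by (rule integral_norm_bound_ennreal[OF L2_integrable_mult_cnj[OF fL TL]])
  also have "\<dots> = (\<integral>\<^sup>+ x. ennreal (cmod (f x)) * ennreal (cmod (Q x)) \<partial>lebesgue)"
    using TQ by (intro nn_integral_cong_AE) (auto simp: norm_mult ennreal_mult')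
  also have "\<dots> = (\<integral>\<^sup>+ x. ennreal (cmod (f x)) * ennreal (cmod (Q x)) \<partial>lborel)"
    by (rule nn_integral_completion)
  finally show ?thesis .
qed

lemma L2_lborel:
  fixes f :: "'a::euclidean_space \<Rightarrow> complex"
  assumes [measurable]: "f \<in> borel_measurable borel" and fL: "f \<in> L2"
  shows "integrable lborel (\<lambda>x. (cmod (f x))\<^sup>2)"
    and "(\<integral>\<^sup>+ x. ennreal ((cmod (f x))\<^sup>2) \<partial>lborel) = ennreal ((L2norm f)\<^sup>2)"
proof -
  show i: "integrable lborel (\<lambda>x. (cmod (f x))\<^sup>2)"
    using L2_integrable[OF fL] by (simp add: integrable_completion)
  have "(L2norm f)\<^sup>2 = (LINT x|lborel. (cmod (f x))\<^sup>2)"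
    unfolding L2norm_power2 by (rule integral_completion) measurable
  then show "(\<integral>\<^sup>+ x. ennreal ((cmod (f x))\<^sup>2) \<partial>lborel) = ennreal ((L2norm f)\<^sup>2)"
    using i by (simp add: nn_integral_eq_integral)
qed

lemma shell_mult_L2:
  assumes "1 \<le> p" "f \<in> L2"
  shows "(\<lambda>x::'a::euclidean_space. complex_of_real (shell p n x) * f x) \<in> L2"
  using assms(1)
  by (intro L2_bdd_mult[OF assms(2), where B=1] borel_measurable_lebesgueI)
     (auto simp: shell_nonneg shell_le_1)

lemma cutoff_mult_L2:
  assumes "f \<in> L2"
  shows "(\<lambda>x::'a::euclidean_space. complex_of_real (cutoff p n x) * f x) \<in> L2"
  by (intro L2_bdd_mult[OF assms, where B=1] borel_measurable_lebesgueI)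
     (auto simp: cutoff_bounds)

text \<open>All radii above the critical one are included, since shells inside |y| average over
  larger balls.\<close>

definition thin_at_scale :: "real \<Rightarrow> real \<Rightarrow> 'a::euclidean_space set \<Rightarrow> bool" where
  "thin_at_scale \<epsilon> \<beta> E \<longleftrightarrow> (\<forall>y r. (1 + norm y) powr (- \<beta>) \<le> r \<longrightarrow>
     emeasure lborel (E \<inter> ball y r) \<le> ennreal \<epsilon> * emeasure lborel (ball y r))"

text \<open>The common form of both sums of the summation by parts; \<open>k\<close> absorbs the
  normalisation of the cutoff and a shift of index. The constant 1/4 leaves room for two such
  bounds.\<close>

definition shell_form_bounded ::
    "(real \<Rightarrow> ('a::euclidean_space \<Rightarrow> complex) \<Rightarrow> 'a \<Rightarrow> complex) \<Rightarrow> real \<Rightarrow> real \<Rightarrow> real \<Rightarrow> real \<Rightarrow> real \<Rightarrow> real \<Rightarrow> bool" where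
  "shell_form_bounded U p \<beta> t k C \<epsilon> \<longleftrightarrow> (\<forall>E f N. E \<in> sets borel \<longrightarrow> thin_at_scale \<epsilon> \<beta> E \<longrightarrow>
     f \<in> borel_measurable borel \<longrightarrow> f \<in> L2 \<longrightarrow>
     (\<Sum>n\<le>N. cmod (ip f (U t (\<lambda>x. complex_of_real (exp (- (k / (p powr \<beta>) ^ n)\<^sup>2 * (norm x)\<^sup>2 / 2)) *
          U (- t) (\<lambda>x. complex_of_real (shell p n x) * f x) x))))
     \<le> (1 / 4) * (L2norm f)\<^sup>2 + C * (LINT x:- E|lborel. (cmod (f x))\<^sup>2))"

text \<open>Order of the constants: the row bound \<open>R\<close> knows nothing of
  \<open>E\<close>; then \<theta> is chosen with \<theta> (R + 1) = 1/8; column sums of at most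
  \<theta>/8 contribute another 1/8, and \<epsilon> is the thinness they require. The observed part
  receives the constant R / \<theta>.\<close>

lemma shell_form_bounded:
  fixes U :: "real \<Rightarrow> ('a::euclidean_space \<Rightarrow> complex) \<Rightarrow> 'a \<Rightarrow> complex" and p \<beta> t k :: real
  assumes S: "schroedinger_group U" and p: "1 < p" and \<beta>: "0 < \<beta>" and t: "t \<noteq> 0" and k: "0 < k"
  shows "\<exists>C\<ge>0. \<exists>\<epsilon>>0. shell_form_bounded U p \<beta> t k C \<epsilon>"
proof -
  \<comment> \<open>The displacement scale at index 0; through it the constants depend on the time
    gap.\<close>
  define L where "L = 2 * \<bar>t\<bar> * k"
  have L: "0 < L" using t k by (simp add: L_def)
  define R where "R = 1 + 2 * p * L * gauss_moment TYPE('a) / (1 - 1 / p)"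
  have R: "0 \<le> R"
    unfolding R_def using p L gauss_moment_nonneg[where 'a='a] by (intro add_nonneg_nonneg divide_nonneg_nonneg) auto
  define \<theta> where "\<theta> = 1 / (8 * (R + 1))"
  have \<theta>: "0 < \<theta>" "\<theta> * (R + 1) = 1 / 8" using R by (auto simp: \<theta>_def field_simps)
  obtain \<epsilon> where \<epsilon>: "0 < \<epsilon>" and col: "\<And>(E::'a set) N y. E \<in> sets borel \<Longrightarrow>
       (\<And>y r. (1 + norm y) powr (- \<beta>) \<le> r \<Longrightarrow> emeasure lborel (E \<inter> ball y r) \<le> ennreal \<epsilon> * emeasure lborel (ball y r)) \<Longrightarrow>
       (\<Sum>n\<le>N. ennreal (shell p n y) * (\<integral>\<^sup>+ \<eta>. ennreal (gauss \<eta>) * indicator E (y + (L / (p powr \<beta>) ^ n) *\<^sub>R \<eta>) \<partial>lborel)) \<le> ennreal (\<theta> / 8)"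
    using shell_column_bound[OF p \<beta> L, of "\<theta> / 8", where 'a='a] \<theta>(1) by auto
  \<comment> \<open>Only the square of \<kappa> enters the multiplier; the sign of \<open>t\<close>
    makes the displacement 2 t \<kappa> equal to the nonnegative \<open>lam\<close>.\<close>
  define \<kappa> where "\<kappa> n = sgn t * k / (p powr \<beta>) ^ n" for n :: nat
  define lam where "lam n = L / (p powr \<beta>) ^ n" for n :: nat
  have q1: "1 \<le> (p powr \<beta>) ^ n" for n
    using p \<beta> by (intro one_le_power ge_one_powr_ge_zero) auto
  have lam: "0 \<le> lam n" "lam n \<le> L" for n
  proof -
    show "0 \<le> lam n" using L q1[of n] by (simp add: lam_def)
    have "L / (p powr \<beta>) ^ n \<le> L / 1" using L q1[of n] by (intro divide_left_mono) auto
    then show "lam n \<le> L" by (simp add: lam_def)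
  qed
  have \<kappa>2: "(\<kappa> n)\<^sup>2 = (k / (p powr \<beta>) ^ n)\<^sup>2" for n
    using t by (simp add: \<kappa>_def power_mult_distrib power_divide sgn_if)
  have \<kappa>lam: "2 * t * \<kappa> n = lam n" for n
    by (simp add: \<kappa>_def lam_def L_def sgn_if abs_if)
  have main: "(\<Sum>n\<le>N. cmod (ip f (U t (\<lambda>x. complex_of_real (exp (- (k / (p powr \<beta>) ^ n)\<^sup>2 * (norm x)\<^sup>2 / 2)) *
            U (- t) (\<lambda>x. complex_of_real (shell p n x) * f x) x))))
       \<le> (1 / 4) * (L2norm f)\<^sup>2 + (R / \<theta>) * (LINT x:- E|lborel. (cmod (f x))\<^sup>2)"
    if E [measurable]: "E \<in> sets borel"
    and thin: "thin_at_scale \<epsilon> \<beta> E"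
    and f [measurable]: "f \<in> borel_measurable borel" and fL: "f \<in> L2"
    for E :: "'a set" and f N
  proof -
    let ?T = "\<lambda>n. U t (\<lambda>x. complex_of_real (exp (- (k / (p powr \<beta>) ^ n)\<^sup>2 * (norm x)\<^sup>2 / 2)) *
            U (- t) (\<lambda>x. complex_of_real (shell p n x) * f x) x)"
    let ?w = "\<lambda>n x. complex_of_real (shell p n x) * f x"
    let ?M = "\<lambda>n. \<integral>\<^sup>+ x. \<integral>\<^sup>+ \<eta>. ennreal (gauss \<eta> * (cmod (f x) * (shell p n (x - lam n *\<^sub>R \<eta>) * cmod (f (x - lam n *\<^sub>R \<eta>))))) \<partial>lborel \<partial>lborel" and ?X = "LINT x:- E|lborel. (cmod (f x))\<^sup>2"
    have wm [measurable]: "?w n \<in> borel_measurable borel" for n by measurable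
    have wL: "?w n \<in> L2" for n using p by (intro shell_mult_L2 fL) auto
    have TL: "?T n \<in> L2" for n
      by (intro unitary_group_L2[OF schroedinger_unitary[OF S]] multiplier_L2 wL)
    have bound: "ennreal (cmod (ip f (?T n))) \<le> ?M n" for n
    proof -
      have "AE z in lebesgue. ?T n z = boosted_average (\<kappa> n) t (?w n) z"
        unfolding \<kappa>2[symmetric] by (rule conjugated_multiplier_eq_boosted_average[OF S wm wL])
      then have "ennreal (cmod (ip f (?T n))) \<le> (\<integral>\<^sup>+ x. ennreal (cmod (f x)) * ennreal (cmod (boosted_average (\<kappa> n) t (?w n) x)) \<partial>lborel)"
        by (intro cmod_ip_average_le f fL TL boosted_average_measurable wm)
      also have "\<dots> \<le> (\<integral>\<^sup>+ x. ennreal (cmod (f x)) * (\<integral>\<^sup>+ \<eta>. ennreal (gauss \<eta> * cmod (?w n (x - (2 * t * \<kappa> n) *\<^sub>R \<eta>))) \<partial>lborel) \<partial>lborel)"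
        by (intro nn_integral_mono mult_left_mono cmod_boosted_average_le wm) auto
      also have "\<dots> = ?M n"
        unfolding \<kappa>lam using p
        by (subst nn_integral_cmult[symmetric])
           (auto intro!: nn_integral_cong simp: ennreal_mult'[symmetric] norm_mult shell_nonneg mult_ac)
      finally show ?thesis .
    qed
    have "ennreal (\<Sum>n\<le>N. cmod (ip f (?T n))) = (\<Sum>n\<le>N. ennreal (cmod (ip f (?T n))))"
      by (rule sum_ennreal[symmetric]) (rule norm_ge_zero)
    also have "\<dots> \<le> (\<Sum>n\<le>N. ?M n)"
      by (intro sum_mono bound)
    also have "\<dots> \<le> ennreal (\<theta> * (R + 1) + (\<theta> / 8) / \<theta>) * (\<integral>\<^sup>+ x. ennreal ((cmod (f x))\<^sup>2) \<partial>lborel)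
       + ennreal (R / \<theta>) * (\<integral>\<^sup>+ x. ennreal ((cmod (f x))\<^sup>2) * indicator (- E) x \<partial>lborel)"
    proof (rule averaged_form_bound)
      show "(\<Sum>n\<le>N. shell p n y) \<le> 1" for y :: 'a by (simp add: sum_shell cutoff_bounds)
      show "(\<Sum>n\<le>N. \<integral>\<^sup>+ \<eta>. ennreal (gauss \<eta> * shell p n (x - lam n *\<^sub>R \<eta>)) \<partial>lborel) \<le> ennreal R" for x :: 'a
        unfolding R_def by (rule shell_row_bound[OF p lam])
      show "(\<Sum>n\<le>N. ennreal (shell p n y) * (\<integral>\<^sup>+ \<eta>. ennreal (gauss \<eta>) * indicator E (y + lam n *\<^sub>R \<eta>) \<partial>lborel)) \<le> ennreal (\<theta> / 8)" for y :: 'a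
        unfolding lam_def by (rule col[OF E]) (use thin in \<open>auto simp: thin_at_scale_def\<close>)
    qed (use \<theta> R shell_nonneg[OF less_imp_le[OF p]] in auto)
    also have "\<theta> * (R + 1) + (\<theta> / 8) / \<theta> = 1 / 4" using \<theta> by simp
    also have "(\<integral>\<^sup>+ x. ennreal ((cmod (f x))\<^sup>2) * indicator (- E) x \<partial>lborel) = ennreal ?X"
    proof -
      have "integrable lborel (\<lambda>x. indicator (- E) x *\<^sub>R (cmod (f x))\<^sup>2)"
        by (rule integrable_mult_indicator[OF _ L2_lborel(1)[OF f fL]]) simp
      then show ?thesis
        unfolding set_lebesgue_integral_def
        by (subst nn_integral_eq_integral[symmetric]) (auto intro!: nn_integral_cong simp: indicator_def)
    qed
    also have "(\<integral>\<^sup>+ x. ennreal ((cmod (f x))\<^sup>2) \<partial>lborel) = ennreal ((L2norm f)\<^sup>2)"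
      by (rule L2_lborel(2)[OF f fL])
    finally have "ennreal (\<Sum>n\<le>N. cmod (ip f (?T n))) \<le> ennreal ((1 / 4) * (L2norm f)\<^sup>2 + (R / \<theta>) * ?X)"
    proof -
      assume a: "ennreal (\<Sum>n\<le>N. cmod (ip f (?T n))) \<le> ennreal (1 / 4) * ennreal ((L2norm f)\<^sup>2) + ennreal (R / \<theta>) * ennreal ?X"
      have n: "0 \<le> ?X"
        unfolding set_lebesgue_integral_def by (intro integral_nonneg_AE) auto
      show ?thesis
        using a R \<theta> n by (simp add: ennreal_mult'[symmetric] ennreal_plus[symmetric] del: ennreal_plus)
    qed
    moreover have "0 \<le> ?X"
      unfolding set_lebesgue_integral_def by (intro integral_nonneg_AE) auto
    ultimately show ?thesis using R \<theta> by (subst (asm) ennreal_le_iff) auto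
  qed
  have "shell_form_bounded U p \<beta> t k (R / \<theta>) \<epsilon>"
    unfolding shell_form_bounded_def using main by blast
  moreover have "0 \<le> R / \<theta>" using R \<theta> by simp
  ultimately show ?thesis using \<epsilon> by blast
qed

lemma cutoff_eq_multiplier:
  assumes "0 < q"
  shows "cutoff q n x = exp (- (sqrt 2 / q ^ n)\<^sup>2 * (norm x)\<^sup>2 / 2)"
  using assms by (simp add: cutoff_def power_divide)

lemma cutoff_tendsto_1:
  assumes "1 < p"
  shows "(\<lambda>n. cutoff p n x) \<longlonglongrightarrow> 1"
proof -
  have l: "(\<lambda>n. norm x * inverse (p ^ n)) \<longlonglongrightarrow> norm x * 0"
    by (intro tendsto_intros LIMSEQ_inverse_realpow_zero assms)
  have "(\<lambda>n. exp (- (norm x * inverse (p ^ n))\<^sup>2)) \<longlonglongrightarrow> exp (- (norm x * 0)\<^sup>2)"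
    by (rule tendsto_exp[OF tendsto_minus[OF tendsto_power[OF l]]])
  then show ?thesis by (simp add: cutoff_def divide_inverse)
qed

lemma L2norm_cutoff_tendsto_0:
  fixes f :: "'a::euclidean_space \<Rightarrow> complex"
  assumes p: "1 < p" and fL: "f \<in> L2"
  shows "(\<lambda>n. L2norm (\<lambda>x. of_real (cutoff p n x) * f x - f x)) \<longlonglongrightarrow> 0"
proof -
  have "(\<lambda>n. LINT x|lebesgue. (cmod (of_real (cutoff p n x) * f x - f x))\<^sup>2) \<longlonglongrightarrow> (LINT x::'a|lebesgue. 0)"
  proof (rule integral_dominated_convergence)
    show "integrable lebesgue (\<lambda>x. (cmod (f x))\<^sup>2)" by (rule L2_integrable[OF fL])
    show "(\<lambda>x. (cmod (of_real (cutoff p n x) * f x - f x))\<^sup>2) \<in> borel_measurable lebesgue" for n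
      using L2_measurable[OF L2_diff[OF cutoff_mult_L2[OF fL] fL]] by simp
    show "AE x in lebesgue. (\<lambda>n. (cmod (of_real (cutoff p n x) * f x - f x))\<^sup>2) \<longlonglongrightarrow> 0"
    proof (intro AE_I2)
      fix x
      have "(\<lambda>n. (cmod (of_real (cutoff p n x) * f x - f x))\<^sup>2) \<longlonglongrightarrow> (cmod (of_real 1 * f x - f x))\<^sup>2"
        by (intro tendsto_intros cutoff_tendsto_1 p)
      then show "(\<lambda>n. (cmod (of_real (cutoff p n x) * f x - f x))\<^sup>2) \<longlonglongrightarrow> 0" by simp
    qed
    show "AE x in lebesgue. norm ((cmod (of_real (cutoff p n x) * f x - f x))\<^sup>2) \<le> (cmod (f x))\<^sup>2" for n
    proof (intro AE_I2)
      fix x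
      have "of_real (cutoff p n x) * f x - f x = of_real (cutoff p n x - 1) * f x"
        by (simp add: left_diff_distrib)
      then have "cmod (of_real (cutoff p n x) * f x - f x) = \<bar>cutoff p n x - 1\<bar> * cmod (f x)"
        by (simp only: norm_mult norm_of_real)
      also have "\<dots> \<le> 1 * cmod (f x)"
        using cutoff_bounds[of p n x] by (intro mult_right_mono) auto
      finally show "norm ((cmod (of_real (cutoff p n x) * f x - f x))\<^sup>2) \<le> (cmod (f x))\<^sup>2"
        by (simp add: power_mono)
    qed
  qed simp
  then have "(\<lambda>n. sqrt (LINT x|lebesgue. (cmod (of_real (cutoff p n x) * f x - f x))\<^sup>2)) \<longlonglongrightarrow> sqrt 0"
    by (intro tendsto_real_sqrt) simp
  then show ?thesis by (simp add: L2norm_def)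
qed

lemma ip_real_mult: "ip (\<lambda>x. complex_of_real (w x) * f x) g = ip f (\<lambda>x. complex_of_real (w x) * g x)"
  unfolding ip_def by (simp add: mult_ac)

lemma cmod_ip_commute: "cmod (ip f g) = cmod (ip g f)"
  by (metis complex_mod_cnj ip_cnj)

lemma ip_cong_right:
  assumes "h \<in> L2" "f \<in> L2" "g \<in> L2" "AE x in lebesgue. f x = g x"
  shows "ip h f = ip h g" "ip f h = ip g h"
  using assms by (auto intro!: ip_cong_AE L2_measurable)

text \<open>\<open>c N\<close> pairs the doubly cut off \<open>f\<close> with \<open>f\<close>. Its
  increments are the terms of the two sums, and it tends to the squared norm; bounds uniform in
  \<open>N\<close> survive the limit.\<close>

lemma norm_le_shell_forms:
  fixes U :: "real \<Rightarrow> ('a::euclidean_space \<Rightarrow> complex) \<Rightarrow> 'a \<Rightarrow> complex" and a b t :: real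
  assumes S: "schroedinger_group U" and a: "1 < a" and b: "1 < b"
    and fL: "f \<in> L2" and gL: "g \<in> L2" and gU: "AE x in lebesgue. U t f x = g x"
    and bnd1: "\<And>N. (\<Sum>n\<le>N. cmod (ip f (U (- t) (\<lambda>x. of_real (cutoff b n x) * U t (\<lambda>x. of_real (shell a n x) * f x) x)))) \<le> K1"
    and bnd2: "\<And>N. (\<Sum>n<N. cmod (ip g (U t (\<lambda>x. of_real (cutoff a n x) * U (- t) (\<lambda>x. of_real (shell b (Suc n) x) * g x) x)))) \<le> K2"
  shows "(L2norm f)\<^sup>2 \<le> K1 + K2"
proof -
  note U = schroedinger_unitary[OF S]
  note UL = unitary_group_L2[OF U] and adj = unitary_group_adjoint[OF U]
  note cL = cutoff_mult_L2 and sLa = shell_mult_L2[OF less_imp_le[OF a]] and sLb = shell_mult_L2[OF less_imp_le[OF b]]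
  have fU: "AE x in lebesgue. U (- t) g x = f x"
  proof -
    have "AE x in lebesgue. U (- t) (U t f) x = U (- t) g x"
      by (rule unitary_group_cong_AE[OF U UL[OF fL] gL gU])
    with unitary_group_inverse(1)[OF U fL, of t] show ?thesis by eventually_elim simp
  qed
  have gU': "AE x in lebesgue. g x = U t f x" and fU': "AE x in lebesgue. f x = U (- t) g x"
    using gU fU by (auto simp: eq_commute)
  define k where "k n = U (- t) (\<lambda>x. of_real (cutoff b n x) * g x)" for n
  have kL: "k n \<in> L2" for n unfolding k_def by (intro UL cL gL)
  define c where "c N = ip (\<lambda>x. of_real (cutoff a N x) * k N x) f" for N
  let ?A = "\<lambda>n. cmod (ip f (U (- t) (\<lambda>x. of_real (cutoff b n x) * U t (\<lambda>x. of_real (shell a n x) * f x) x)))"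
  let ?B = "\<lambda>n. cmod (ip g (U t (\<lambda>x. of_real (cutoff a n x) * U (- t) (\<lambda>x. of_real (shell b (Suc n) x) * g x) x)))"
  \<comment> \<open>Multipliers and their conjugates with the flow are symmetric, so the shell
    passes to the input \<open>f\<close>, as in \<open>shell_form_bounded\<close>.\<close>
  have A: "cmod (ip (\<lambda>x. of_real (shell a n x) * k n x) f) = ?A n" for n
  proof -
    let ?w = "\<lambda>x. complex_of_real (shell a n x) * f x"
    have w: "?w \<in> L2" by (rule sLa[OF fL])
    have "ip (\<lambda>x. of_real (shell a n x) * k n x) f = ip (k n) ?w" by (rule ip_real_mult)
    also have "\<dots> = ip (\<lambda>x. of_real (cutoff b n x) * g x) (U (- (- t)) ?w)"
      unfolding k_def by (rule adj[OF cL[OF gL] w])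
    also have "\<dots> = ip g (\<lambda>x. of_real (cutoff b n x) * U t ?w x)" by (simp add: ip_real_mult)
    also have "\<dots> = ip (U t f) (\<lambda>x. of_real (cutoff b n x) * U t ?w x)"
      by (rule ip_cong_right(2)[OF cL[OF UL[OF w]] gL UL[OF fL] gU'])
    also have "\<dots> = ip f (U (- t) (\<lambda>x. of_real (cutoff b n x) * U t ?w x))"
      by (rule adj[OF fL cL[OF UL[OF w]]])
    finally show ?thesis by simp
  qed
  \<comment> \<open>The increment of \<open>k\<close> is a shell of \<open>g\<close> pulled back by
    the flow. Carrying the flow to the other side gives a form in \<open>g\<close>, with cutoff
    index \<open>n\<close> against shell index \<open>Suc n\<close>.\<close>
  have B: "cmod (ip (\<lambda>x. of_real (cutoff a n x) * (k (Suc n) x - k n x)) f) = ?B n" for n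
  proof -
    let ?v = "\<lambda>x. complex_of_real (shell b (Suc n) x) * g x"
    have v: "?v \<in> L2" by (rule sLb[OF gL])
    have vd: "?v = (\<lambda>x. of_real (cutoff b (Suc n) x) * g x - of_real (cutoff b n x) * g x)"
      by (simp add: left_diff_distrib)
    have "AE x in lebesgue. U (- t) ?v x = k (Suc n) x - k n x"
      unfolding vd k_def
      by (rule unitary_group_diff[OF U cL[OF gL, of b "Suc n"] cL[OF gL, of b n], of "- t"])
    then have kv: "AE x in lebesgue. k (Suc n) x - k n x = U (- t) ?v x"
      by (rule AE_mp) (rule AE_I2, rule impI, erule sym)
    have "ip (\<lambda>x. of_real (cutoff a n x) * (k (Suc n) x - k n x)) f = ip (\<lambda>x. of_real (cutoff a n x) * U (- t) ?v x) f"
    proof (rule ip_cong_right(2)[OF fL cL[OF L2_diff[OF kL kL]] cL[OF UL[OF v]]])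
      show "AE x in lebesgue. of_real (cutoff a n x) * (k (Suc n) x - k n x) = of_real (cutoff a n x) * U (- t) ?v x"
        using kv by (rule AE_mp) (rule AE_I2, rule impI, erule arg_cong)
    qed
    also have "\<dots> = ip (\<lambda>x. of_real (cutoff a n x) * U (- t) ?v x) (U (- t) g)"
      by (rule ip_cong_right(1)[OF cL[OF UL[OF v]] fL UL[OF gL] fU'])
    also have "\<dots> = ip (U t (\<lambda>x. of_real (cutoff a n x) * U (- t) ?v x)) g"
      by (rule adj[OF cL[OF UL[OF v]] gL, symmetric])
    also have "cmod \<dots> = ?B n"
      by (rule cmod_ip_commute)
    finally show ?thesis .
  qed
  have step: "cmod (c N) \<le> (\<Sum>n\<le>N. ?A n) + (\<Sum>n<N. ?B n)" for N
  proof (induction N)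
    case 0
    have "c 0 = ip (\<lambda>x. of_real (shell a 0 x) * k 0 x) f" by (simp add: c_def)
    then show ?case using A[of 0] by simp
  next
    case (Suc N)
    \<comment> \<open>The two cutoffs are advanced one at a time: the new shell meets the new
      \<open>k\<close>, and the old cutoff meets the increment of \<open>k\<close>.\<close>
    have "(\<lambda>x. of_real (cutoff a (Suc N) x) * k (Suc N) x) =
       (\<lambda>x. (of_real (shell a (Suc N) x) * k (Suc N) x + of_real (cutoff a N x) * (k (Suc N) x - k N x))
          + of_real (cutoff a N x) * k N x)"
      by (simp add: algebra_simps)
    then have "c (Suc N) = ip (\<lambda>x. of_real (shell a (Suc N) x) * k (Suc N) x) f
        + ip (\<lambda>x. of_real (cutoff a N x) * (k (Suc N) x - k N x)) f + c N"
      unfolding c_def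
      by (simp only: ip_add_left[OF L2_add[OF sLa[OF kL] cL[OF L2_diff[OF kL kL]]] cL[OF kL] fL]
          ip_add_left[OF sLa[OF kL] cL[OF L2_diff[OF kL kL]] fL])
    then have "cmod (c (Suc N)) \<le> ?A (Suc N) + ?B N + cmod (c N)"
      unfolding A[symmetric] B[symmetric]
      by (simp only: order_trans[OF norm_triangle_ineq add_right_mono[OF norm_triangle_ineq]])
    then show ?case using Suc by simp
  qed
  have cb: "cmod (c N) \<le> K1 + K2" for N
    using step[of N] bnd1[of N] bnd2[of N] by linarith
  have lim: "c \<longlonglongrightarrow> ip f f"
  proof -
    let ?e1 = "\<lambda>N. L2norm (\<lambda>x. of_real (cutoff b N x) * g x - g x)"
    let ?e2 = "\<lambda>N. L2norm (\<lambda>x. of_real (cutoff a N x) * f x - f x)"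
    have e: "?e1 \<longlonglongrightarrow> 0" "?e2 \<longlonglongrightarrow> 0"
      by (rule L2norm_cutoff_tendsto_0[OF b gL] L2norm_cutoff_tendsto_0[OF a fL])+
    have kf: "L2norm (\<lambda>x. k N x - f x) = ?e1 N" for N
    proof -
      have "L2norm (\<lambda>x. k N x - f x) = L2norm (\<lambda>x. k N x - U (- t) g x)"
        by (intro L2norm_cong_AE L2_measurable L2_diff kL fL UL gL) (use fU in auto)
      then show ?thesis
        unfolding k_def using unitary_group_L2norm_diff[OF U cL[OF gL] gL] by simp
    qed
    have err: "cmod (c N - ip f f) \<le> ?e1 N * L2norm f + ?e1 N * ?e2 N + L2norm f * ?e2 N" for N
    proof -
      let ?u = "\<lambda>x. k N x - f x" and ?v = "\<lambda>x. complex_of_real (cutoff a N x) * f x - f x"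
      have uv: "?u \<in> L2" "?v \<in> L2" by (intro L2_diff kL fL cL)+
      have "c N = ip (k N) (\<lambda>x. of_real (cutoff a N x) * f x)" unfolding c_def by (rule ip_real_mult)
      \<comment> \<open>Expansion with k N = f + ?u and the cut off \<open>f\<close> equal to f +
        ?v; each remaining term contains an error that tends to 0.\<close>
      also have "\<dots> - ip f f = ip ?u f + ip ?u ?v + ip f ?v"
        using uv kL[of N] fL cL[OF fL, of a N] by (simp add: ip_diff_left ip_diff_right)
      finally have "cmod (c N - ip f f) \<le> cmod (ip ?u f) + cmod (ip ?u ?v) + cmod (ip f ?v)"
        using order_trans[OF norm_triangle_ineq add_right_mono[OF norm_triangle_ineq], of "ip ?u f" "ip ?u ?v" "ip f ?v"]
        by simp
      also have "\<dots> \<le> L2norm ?u * L2norm f + L2norm ?u * L2norm ?v + L2norm f * L2norm ?v"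
        by (intro add_mono cmod_ip_le uv fL)
      finally show ?thesis unfolding kf .
    qed
    have "(\<lambda>N. ?e1 N * L2norm f + ?e1 N * ?e2 N + L2norm f * ?e2 N) \<longlonglongrightarrow> 0 * L2norm f + 0 * 0 + L2norm f * 0"
      by (intro tendsto_intros e)
    then have "(\<lambda>N. ?e1 N * L2norm f + ?e1 N * ?e2 N + L2norm f * ?e2 N) \<longlonglongrightarrow> 0"
      by simp
    then have "(\<lambda>N. c N - ip f f) \<longlonglongrightarrow> 0"
      by (rule Lim_null_comparison[OF always_eventually[OF allI[OF err]]])
    then show ?thesis by (simp add: LIM_zero_iff)
  qed
  have "cmod (ip f f) \<le> K1 + K2"
    by (rule LIMSEQ_le_const2[OF tendsto_norm[OF lim]]) (use cb in auto)
  then show ?thesis by (simp add: ip_self[OF fL] norm_power)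
qed

lemma set_integral_borel_subset_le:
  fixes f h :: "'a::euclidean_space \<Rightarrow> complex"
  assumes "A \<in> sets borel" "A \<subseteq> Q" "Q \<in> sets lebesgue" "f \<in> L2" "h \<in> borel_measurable borel" "AE x in lebesgue. f x = h x"
  shows "(LINT x:A|lborel. (cmod (h x))\<^sup>2) \<le> (LINT x:Q|lebesgue. (cmod (f x))\<^sup>2)"
proof -
  have [measurable]: "A \<in> sets borel" "h \<in> borel_measurable borel" by fact+
  have "(LINT x:A|lborel. (cmod (h x))\<^sup>2) = (LINT x:A|lebesgue. (cmod (h x))\<^sup>2)"
    unfolding set_lebesgue_integral_def by (rule integral_completion[symmetric]) measurable
  also have "\<dots> = (LINT x:A|lebesgue. (cmod (f x))\<^sup>2)"
    unfolding set_lebesgue_integral_def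
  proof (rule integral_cong_AE)
    show "AE x in lebesgue. indicat_real A x *\<^sub>R (cmod (h x))\<^sup>2 = indicat_real A x *\<^sub>R (cmod (f x))\<^sup>2"
      using assms(6) by eventually_elim simp
    have 1: "A \<in> sets lebesgue" by simp
    show "(\<lambda>x. indicat_real A x *\<^sub>R (cmod (h x))\<^sup>2) \<in> borel_measurable lebesgue"
    proof (rule borel_measurable_scaleR[OF borel_measurable_indicator[OF 1]])
      show "(\<lambda>x. (cmod (h x))\<^sup>2) \<in> borel_measurable lebesgue"
        using borel_measurable_lebesgueI[OF assms(5)] by simp
    qed
    show "(\<lambda>x. indicat_real A x *\<^sub>R (cmod (f x))\<^sup>2) \<in> borel_measurable lebesgue"
    proof (rule borel_measurable_scaleR[OF borel_measurable_indicator[OF 1]])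
      show "(\<lambda>x. (cmod (f x))\<^sup>2) \<in> borel_measurable lebesgue"
        using L2_measurable[OF assms(4)] by simp
    qed
  qed
  also have "\<dots> \<le> (LINT x:Q|lebesgue. (cmod (f x))\<^sup>2)"
    unfolding set_lebesgue_integral_def
    using assms(2,3) L2_integrable[OF assms(4)]
    by (intro integral_mono integrable_mult_indicator) (auto simp: indicator_def)
  finally show ?thesis .
qed

text \<open>Only the gap between the two times is fixed, so that the thickness parameter can be
  chosen from the gap alone.\<close>

definition observable_at_gap ::
    "(real \<Rightarrow> ('a::euclidean_space \<Rightarrow> complex) \<Rightarrow> 'a \<Rightarrow> complex) \<Rightarrow> real \<Rightarrow> 'a set \<Rightarrow> 'a set \<Rightarrow> bool" where
  "observable_at_gap U t O1 O2 \<longleftrightarrow> (\<exists>C>0. \<forall>s. \<forall>u0\<in>L2.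
           (L2norm u0)\<^sup>2 \<le> C * ((LINT x:O1|lebesgue. (cmod (U (t + s) u0 x))\<^sup>2) +
                              (LINT x:O2|lebesgue. (cmod (U s u0 x))\<^sup>2)))"

lemma observability_at_time_gap:
  fixes \<rho>1 \<rho>2 :: "'a::euclidean_space \<Rightarrow> real"
    and U :: "real \<Rightarrow> ('a \<Rightarrow> complex) \<Rightarrow> 'a \<Rightarrow> complex"
  assumes \<alpha>: "\<alpha> > 0"
    and \<rho>1: "\<And>x. \<rho>1 x > 0" "0 < K1" "\<And>x. \<rho>1 x \<le> K1 * (1 + norm x) powr (- \<alpha>)"
    and \<rho>2: "\<And>x. \<rho>2 x > 0" "0 < K2" "\<And>x. \<rho>2 x \<le> K2 * (1 + norm x) powr (- (1 / \<alpha>))"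
    and S: "schroedinger_group U" and t: "0 < t"
  shows "\<exists>\<gamma>. 0 < \<gamma> \<and> \<gamma> < 1 \<and>
     (\<forall>O1 O2. O1 \<in> sets lebesgue \<and> thick \<gamma> \<rho>1 O1 \<and> O2 \<in> sets lebesgue \<and> thick \<gamma> \<rho>2 O2 \<longrightarrow>
        observable_at_gap U t O1 O2)"
proof -
  note U = schroedinger_unitary[OF S]
  \<comment> \<open>With a powr (1/\<alpha>) = b and b powr \<alpha> = a, the averaging scale
    demanded by the n-th shell of one family is the inverse n-th radius of the other.\<close>
  define a :: real where "a = 2 powr \<alpha>"
  define b :: real where "b = 2"
  have ab: "1 < a" "1 < b" "a powr (1 / \<alpha>) = b" "b powr \<alpha> = a"
    using \<alpha> by (auto simp: a_def b_def powr_powr gr_one_powr)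
  have ia: "0 < 1 / \<alpha>" using \<alpha> by simp
  have tk: "t \<noteq> 0" "- t \<noteq> 0" "0 < sqrt (2::real)" "0 < sqrt 2 * a" using t ab(1) by auto
  \<comment> \<open>In the first sum the flow acts before the cutoff and its inverse after, hence
    -t. The factor sqrt 2 converts exp (-u^2) to the normalisation exp (-v^2/2).\<close>
  obtain C1 \<epsilon>1 where C1: "0 \<le> C1" "0 < \<epsilon>1"
    and form1: "shell_form_bounded U a (1 / \<alpha>) (- t) (sqrt 2) C1 \<epsilon>1"
    using shell_form_bounded[OF S ab(1) ia tk(2,3)] by blast
  \<comment> \<open>Here the cutoff has index n and the shell index n + 1; the factor
    \<open>a\<close> compensates, as (b powr \<alpha>)^(n+1) / a = a^n.\<close>
  obtain C2 \<epsilon>2 where C2: "0 \<le> C2" "0 < \<epsilon>2"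
    and form2: "shell_form_bounded U b \<alpha> t (sqrt 2 * a) C2 \<epsilon>2"
    using shell_form_bounded[OF S ab(2) \<alpha> tk(1,4)] by blast
  \<comment> \<open>The loss in \<open>thin_larger_balls\<close> for A = K (2 + 2 powr \<beta>), the
    ratio given by \<open>scale_powr_le\<close>.\<close>
  define D where "D K \<beta> = (5 * (1 + K * (2 + 2 powr \<beta>))) ^ DIM('a)" for K \<beta> :: real
  have D: "0 < D K \<beta>" if "0 < K" for K \<beta>
    unfolding D_def using that by (intro zero_less_power mult_pos_pos add_pos_nonneg) auto
  \<comment> \<open>The allowed share 1 - \<gamma> of the complement: below both thresholds even
    after the loss \<open>D\<close>, and at most 1/2 so that \<gamma> is positive. Indices cross
    because the first form uses the set for \<open>\<rho>2\<close> and the second the set for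
    \<open>\<rho>1\<close>.\<close>
  define \<delta> where "\<delta> = min (1 / 2) (min (\<epsilon>1 / D K2 (1 / \<alpha>)) (\<epsilon>2 / D K1 \<alpha>))"
  have \<delta>: "0 < \<delta>" "\<delta> \<le> 1 / 2" "\<delta> * D K2 (1 / \<alpha>) \<le> \<epsilon>1" "\<delta> * D K1 \<alpha> \<le> \<epsilon>2"
  proof -
    show "0 < \<delta>" using C1 C2 D \<rho>1 \<rho>2 by (simp add: \<delta>_def)
    show "\<delta> \<le> 1 / 2" unfolding \<delta>_def by (rule min.cobounded1)
    have "\<delta> \<le> \<epsilon>1 / D K2 (1 / \<alpha>)" unfolding \<delta>_def by (rule min.coboundedI2[OF min.cobounded1])
    then show "\<delta> * D K2 (1 / \<alpha>) \<le> \<epsilon>1" unfolding pos_le_divide_eq[OF D[OF \<rho>2(2)]] .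
    have "\<delta> \<le> \<epsilon>2 / D K1 \<alpha>" unfolding \<delta>_def by (rule min.coboundedI2[OF min.cobounded2])
    then show "\<delta> * D K1 \<alpha> \<le> \<epsilon>2" unfolding pos_le_divide_eq[OF D[OF \<rho>1(2)]] .
  qed
  define \<gamma> where "\<gamma> = 1 - \<delta>"
  have \<gamma>: "0 < \<gamma>" "\<gamma> < 1" "0 \<le> \<gamma>" "\<gamma> \<le> 1" "1 - \<gamma> = \<delta>" using \<delta> by (auto simp: \<gamma>_def)
  have thin: "thin_at_scale \<epsilon> \<beta> E"
    if E: "E \<in> sets borel" and th: "\<And>z. emeasure lborel (E \<inter> ball z (\<rho> z)) \<le> ennreal \<delta> * emeasure lborel (ball z (\<rho> z))"
      and pos: "\<And>z. 0 < \<rho> z" and K: "0 < K" and le: "\<And>x. \<rho> x \<le> K * (1 + norm x) powr (- \<beta>)" and \<beta>: "0 < \<beta>"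
      and \<epsilon>: "\<delta> * D K \<beta> \<le> \<epsilon>"
    for E :: "'a set" and \<rho> K \<beta> \<epsilon>
    unfolding thin_at_scale_def
  proof (intro allI impI)
    fix y :: 'a and r :: real assume r: "(1 + norm y) powr (- \<beta>) \<le> r"
    have r0: "0 < r"
    proof -
      have "0 < 1 + norm y" by (rule add_pos_nonneg) auto
      then have "0 < (1 + norm y) powr (- \<beta>)" by simp
      with r show ?thesis by linarith
    qed
    have A: "0 < K * (2 + 2 powr \<beta>)" using K by (intro mult_pos_pos add_pos_nonneg) auto
    have "emeasure lborel (E \<inter> ball y r) \<le> ennreal (\<delta> * D K \<beta>) * emeasure lborel (ball y r)"
      unfolding D_def
      by (rule thin_larger_balls[OF E less_imp_le[OF \<delta>(1)] A r0 pos _ th])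
         (rule order_trans[OF le scale_powr_le[OF K \<beta> r]])
    also have "\<dots> \<le> ennreal \<epsilon> * emeasure lborel (ball y r)"
      using \<epsilon> by (intro mult_right_mono ennreal_leI) auto
    finally show "emeasure lborel (E \<inter> ball y r) \<le> ennreal \<epsilon> * emeasure lborel (ball y r)" .
  qed
  have "observable_at_gap U t O1 O2"
    if O1: "O1 \<in> sets lebesgue" "thick \<gamma> \<rho>1 O1" and O2: "O2 \<in> sets lebesgue" "thick \<gamma> \<rho>2 O2" for O1 O2
  proof -
    obtain A1 where A1: "A1 \<in> sets borel" "A1 \<subseteq> O1"
      and th1: "\<And>z. emeasure lborel (- A1 \<inter> ball z (\<rho>1 z)) \<le> ennreal \<delta> * emeasure lborel (ball z (\<rho>1 z))"
      using thick_complement_thin[OF O1 \<gamma>(3,4) \<rho>1(1)] unfolding \<gamma>(5) by blast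
    obtain A2 where A2: "A2 \<in> sets borel" "A2 \<subseteq> O2"
      and th2: "\<And>z. emeasure lborel (- A2 \<inter> ball z (\<rho>2 z)) \<le> ennreal \<delta> * emeasure lborel (ball z (\<rho>2 z))"
      using thick_complement_thin[OF O2 \<gamma>(3,4) \<rho>2(1)] unfolding \<gamma>(5) by blast
    have E1: "- A1 \<in> sets borel" and E2: "- A2 \<in> sets borel" using A1 A2 by auto
    note thin1 = thin[OF E1 th1 \<rho>1(1,2,3) \<alpha> \<delta>(4)] and thin2 = thin[OF E2 th2 \<rho>2(1,2,3) ia \<delta>(3)]
    define C where "C = 2 * (C1 + C2) + 1"
    have "(L2norm u0)\<^sup>2 \<le> C * ((LINT x:O1|lebesgue. (cmod (U (t + s) u0 x))\<^sup>2) +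
                              (LINT x:O2|lebesgue. (cmod (U s u0 x))\<^sup>2))" if u0: "u0 \<in> L2" for u0 s
    proof -
      let ?I1 = "LINT x:O1|lebesgue. (cmod (U (t + s) u0 x))\<^sup>2" and ?I2 = "LINT x:O2|lebesgue. (cmod (U s u0 x))\<^sup>2"
      note uL = unitary_group_L2[OF U u0]
      obtain f where f: "f \<in> borel_measurable borel" and uf: "AE x in lebesgue. U s u0 x = f x"
        using borel_representative[OF L2_measurable[OF uL]] by blast
      obtain g where g: "g \<in> borel_measurable borel" and ug: "AE x in lebesgue. U (t + s) u0 x = g x"
        using borel_representative[OF L2_measurable[OF uL]] by blast
      have fL: "f \<in> L2" by (rule L2_cong_AE[OF uL borel_measurable_lebesgueI[OF f] uf])
      have gL: "g \<in> L2" by (rule L2_cong_AE[OF uL borel_measurable_lebesgueI[OF g] ug])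
      have gU: "AE x in lebesgue. U t f x = g x"
      proof -
        have "AE x in lebesgue. U t (U s u0) x = U t f x"
          by (rule unitary_group_cong_AE[OF U uL fL uf])
        with ug unitary_group_add[OF U u0, of t s] show ?thesis by eventually_elim simp
      qed
      have nf: "L2norm f = L2norm u0" and ng: "L2norm g = L2norm u0"
        using L2norm_cong_AE[OF L2_measurable[OF uL] L2_measurable[OF fL] uf]
          L2norm_cong_AE[OF L2_measurable[OF uL] L2_measurable[OF gL] ug] unitary_group_norm[OF U u0] by simp_all
      have "(L2norm f)\<^sup>2 \<le> ((1 / 4) * (L2norm f)\<^sup>2 + C1 * (LINT x:- (- A2)|lborel. (cmod (f x))\<^sup>2))
          + ((1 / 4) * (L2norm g)\<^sup>2 + C2 * (LINT x:- (- A1)|lborel. (cmod (g x))\<^sup>2))"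
      proof (rule norm_le_shell_forms[OF S ab(1,2) fL gL gU])
        fix N
        let ?c = "\<lambda>n. cmod (ip g (U t (\<lambda>x. complex_of_real (exp (- (sqrt 2 * a / (b powr \<alpha>) ^ n)\<^sup>2 * (norm x)\<^sup>2 / 2)) *
            U (- t) (\<lambda>x. complex_of_real (shell b n x) * g x) x)))"
        have "(\<Sum>n\<le>N. cmod (ip f (U (- t) (\<lambda>x. complex_of_real (exp (- (sqrt 2 / (a powr (1 / \<alpha>)) ^ n)\<^sup>2 * (norm x)\<^sup>2 / 2)) *
            U (- (- t)) (\<lambda>x. complex_of_real (shell a n x) * f x) x))))
          \<le> (1 / 4) * (L2norm f)\<^sup>2 + C1 * (LINT x:- (- A2)|lborel. (cmod (f x))\<^sup>2)"
          using form1 E2 thin2 f fL unfolding shell_form_bounded_def by blast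
        then show "(\<Sum>n\<le>N. cmod (ip f (U (- t) (\<lambda>x. of_real (cutoff b n x) * U t (\<lambda>x. of_real (shell a n x) * f x) x))))
          \<le> (1 / 4) * (L2norm f)\<^sup>2 + C1 * (LINT x:- (- A2)|lborel. (cmod (f x))\<^sup>2)"
          using ab by (simp only: cutoff_eq_multiplier[of b] minus_minus)
        have m: "cutoff a n x = exp (- (sqrt 2 * a / (b powr \<alpha>) ^ Suc n)\<^sup>2 * (norm x)\<^sup>2 / 2)" for n and x :: 'a
          using ab(1) by (subst cutoff_eq_multiplier) (auto simp: ab(4))
        \<comment> \<open>After the shift of index the terms are those of the form bound; its extra
          term of index 0 is nonnegative.\<close>
        have "(\<Sum>n<N. cmod (ip g (U t (\<lambda>x. of_real (cutoff a n x) * U (- t) (\<lambda>x. of_real (shell b (Suc n) x) * g x) x))))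
          = (\<Sum>n\<in>Suc ` {..<N}. ?c n)"
          unfolding m by (subst sum.reindex) (auto simp: comp_def)
        also have "\<dots> \<le> (\<Sum>n\<le>N. ?c n)"
          by (rule sum_mono2) auto
        also have "\<dots> \<le> (1 / 4) * (L2norm g)\<^sup>2 + C2 * (LINT x:- (- A1)|lborel. (cmod (g x))\<^sup>2)"
          using form2 E1 thin1 g gL unfolding shell_form_bounded_def by blast
        finally show "(\<Sum>n<N. cmod (ip g (U t (\<lambda>x. of_real (cutoff a n x) * U (- t) (\<lambda>x. of_real (shell b (Suc n) x) * g x) x))))
          \<le> (1 / 4) * (L2norm g)\<^sup>2 + C2 * (LINT x:- (- A1)|lborel. (cmod (g x))\<^sup>2)" .
      qed
      \<comment> \<open>\<open>f\<close> and \<open>g\<close> both have the norm of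
        \<open>u0\<close>, so the two quarters are absorbed into the left side at the price of a
        factor 2.\<close>
      then have "(L2norm u0)\<^sup>2 \<le> 2 * C1 * (LINT x:A2|lborel. (cmod (f x))\<^sup>2) + 2 * C2 * (LINT x:A1|lborel. (cmod (g x))\<^sup>2)"
        by (simp add: nf ng)
      also have "\<dots> \<le> 2 * C1 * ?I2 + 2 * C2 * ?I1"
        using C1 C2
        by (intro add_mono mult_left_mono set_integral_borel_subset_le[OF A1 O1(1) uL g ug]
            set_integral_borel_subset_le[OF A2 O2(1) uL f uf]) auto
      also have "\<dots> \<le> C * ?I2 + C * ?I1"
      proof (intro add_mono mult_right_mono)
        show "0 \<le> ?I2" "0 \<le> ?I1" unfolding set_lebesgue_integral_def by (intro integral_nonneg_AE; simp)+
      qed (use C1 C2 in \<open>auto simp: C_def\<close>)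
      finally show ?thesis by (simp add: distrib_left add.commute)
    qed
    moreover have "0 < C" using C1 C2 by (simp add: C_def)
    ultimately show ?thesis unfolding observable_at_gap_def by blast
  qed
  then show ?thesis using \<gamma>(1,2) by blast
qed

theorem theorem1p5:
  fixes \<alpha> :: real
    and \<rho>1 \<rho>2 :: "'a::euclidean_space \<Rightarrow> real"
    and U :: "real \<Rightarrow> ('a \<Rightarrow> complex) \<Rightarrow> 'a \<Rightarrow> complex"
  assumes "\<alpha> > 0"
    and "continuous_on UNIV \<rho>1" and "\<And>x. \<rho>1 x > 0"
    and "continuous_on UNIV \<rho>2" and "\<And>x. \<rho>2 x > 0"
    and "\<rho>1 \<in> O[at_infinity](\<lambda>x. norm x powr (- \<alpha>))"
    and "\<rho>2 \<in> O[at_infinity](\<lambda>x. norm x powr (- (1 / \<alpha>)))"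
    and "schroedinger_group U"
  shows "\<exists>\<gamma> :: real \<Rightarrow> real. \<forall>T S. 0 < S \<and> S < T \<longrightarrow>
     0 < \<gamma> (T - S) \<and> \<gamma> (T - S) < 1 \<and>
     (\<forall>O1 O2. O1 \<in> sets lebesgue \<and> thick (\<gamma> (T - S)) \<rho>1 O1 \<and>
              O2 \<in> sets lebesgue \<and> thick (\<gamma> (T - S)) \<rho>2 O2 \<longrightarrow>
        (\<exists>C>0. \<forall>u0\<in>L2.
           (L2norm u0)\<^sup>2 \<le> C * ((LINT x:O1|lebesgue. (cmod (U T u0 x))\<^sup>2) +
                              (LINT x:O2|lebesgue. (cmod (U S u0 x))\<^sup>2))))"
proof -
  have ia: "0 < 1 / \<alpha>" using assms(1) by simp
  obtain K1 where K1: "0 < K1" "\<And>x. \<rho>1 x \<le> K1 * (1 + norm x) powr (- \<alpha>)"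
    by (rule bigo_powr_bound[OF assms(1,2,3,6)]; rule that; assumption)
  obtain K2 where K2: "0 < K2" "\<And>x. \<rho>2 x \<le> K2 * (1 + norm x) powr (- (1 / \<alpha>))"
    by (rule bigo_powr_bound[OF ia assms(4,5,7)]; rule that; assumption)
  \<comment> \<open>A property of the gap alone, so that choosing \<gamma> for each gap yields one
    function for all pairs T, S.\<close>
  define P where "P t \<gamma> \<longleftrightarrow> 0 < \<gamma> \<and> \<gamma> < 1 \<and>
     (\<forall>O1 O2. O1 \<in> sets lebesgue \<and> thick \<gamma> \<rho>1 O1 \<and> O2 \<in> sets lebesgue \<and> thick \<gamma> \<rho>2 O2 \<longrightarrow>
        observable_at_gap U t O1 O2)" for t \<gamma>
  have "\<exists>\<gamma>. P t \<gamma>" if "0 < t" for t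
    unfolding P_def by (rule observability_at_time_gap[OF assms(1,3) K1 assms(5) K2 assms(8) that])
  then obtain \<gamma> where \<gamma>: "\<And>t. 0 < t \<Longrightarrow> P t (\<gamma> t)" by metis
  show ?thesis
  proof (intro exI[of _ \<gamma>] allI impI)
    fix T S :: real assume TS: "0 < S \<and> S < T"
    then have P: "P (T - S) (\<gamma> (T - S))" by (intro \<gamma>) simp
    show "0 < \<gamma> (T - S) \<and> \<gamma> (T - S) < 1 \<and>
     (\<forall>O1 O2. O1 \<in> sets lebesgue \<and> thick (\<gamma> (T - S)) \<rho>1 O1 \<and>
              O2 \<in> sets lebesgue \<and> thick (\<gamma> (T - S)) \<rho>2 O2 \<longrightarrow>
        (\<exists>C>0. \<forall>u0\<in>L2.
           (L2norm u0)\<^sup>2 \<le> C * ((LINT x:O1|lebesgue. (cmod (U T u0 x))\<^sup>2) +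
                              (LINT x:O2|lebesgue. (cmod (U S u0 x))\<^sup>2))))"
    proof (intro conjI allI impI)
      show "0 < \<gamma> (T - S)" "\<gamma> (T - S) < 1" using P by (auto simp: P_def)
      fix O1 O2
      assume "O1 \<in> sets lebesgue \<and> thick (\<gamma> (T - S)) \<rho>1 O1 \<and> O2 \<in> sets lebesgue \<and> thick (\<gamma> (T - S)) \<rho>2 O2"
      then have "observable_at_gap U (T - S) O1 O2"
        by (rule conjunct2[OF conjunct2[OF P[unfolded P_def]], rule_format])
      then obtain C where C: "C > 0" "\<And>s u0. u0 \<in> L2 \<Longrightarrow>
           (L2norm u0)\<^sup>2 \<le> C * ((LINT x:O1|lebesgue. (cmod (U ((T - S) + s) u0 x))\<^sup>2) +
                              (LINT x:O2|lebesgue. (cmod (U s u0 x))\<^sup>2))"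
        unfolding observable_at_gap_def by blast
      have TS': "(T - S) + S = T" by simp
      have "(L2norm u0)\<^sup>2 \<le> C * ((LINT x:O1|lebesgue. (cmod (U T u0 x))\<^sup>2) +
                              (LINT x:O2|lebesgue. (cmod (U S u0 x))\<^sup>2))" if "u0 \<in> L2" for u0
        using C(2)[OF that, of S] unfolding TS' .
      with C(1) show "\<exists>C>0. \<forall>u0\<in>L2.
           (L2norm u0)\<^sup>2 \<le> C * ((LINT x:O1|lebesgue. (cmod (U T u0 x))\<^sup>2) +
                              (LINT x:O2|lebesgue. (cmod (U S u0 x))\<^sup>2))"
        by blast
    qed
  qed
qed

end
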